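(* Let $(W,S)$ be a finite Coxeter group, $B$ the corresponding braid group, $B^+\subset B$ the monoid of positive braids, $J\subset S$ a subset, $W_J\subset W$ the subgroup generated by $J$, and $B_J$, $B_J^+$ the braid group and positive braid monoid of $(W_J,J)$. Let $x_0\in W/W_J$ be the coset containing the identity. The functor $\bigoplus_{x\in W/W_J}V_x\mapsto V_{x_0}$ is an equivalence of the category $\mathrm{Mod}_J\text{-}B$ with the category $\mathrm{Mod}\text{-}B_J$ of representations of $B_J$. Similarly, the category $\mathrm{Mod}_J\text{-}B^+$ is equivalent to the category $\mathrm{Mod}\text{-}B_J^+$ of representations of $B_J^+$.
   Context: Representations are over a fixed ground field. $\mathrm{Mod}_J\text{-}B$ is the category of representations of $B$ of the form $V=\bigoplus_{x\in W/W_J}V_x$ such that every $b\in B$ sends $V_x$ to $V_{\bar bx}$, where $b\mapsto\bar b$ is the natural homomorphism $B\to W$, and such that for every $s\in S$ and every $x\in W/W_J$ with $sx\ne x$ one has $s^2|_{V_x}=\mathrm{id}_{V_x}$. Morphisms are morphisms of $B$-modules preserving the direct sum decompositions. $\mathrm{Mod}_J\text{-}B^+$ is the similar category of representations of the monoid $B^+$ (same grading condition and same condition on $s^2$). The group $B_J$ (resp. monoid $B_J^+$) acts on $V_{x_0}$ through its natural map to $B$ (resp. $B^+$) sending generators $s\in J$ to $s$. *)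

theory Defs
  imports "HOL-Algebra.Left_Coset" "HOL-Algebra.Multiplicative_Group"
    "HOL-Algebra.Generated_Groups" "HOL-Algebra.Module"
begin

section \<open>Categories, functors, equivalences\<close>

record ('o, 'm) category =
  Obj :: "'o set"
  Hom :: "'o \<Rightarrow> 'o \<Rightarrow> 'm set"
  Ident :: "'o \<Rightarrow> 'm"
  Comp :: "'o \<Rightarrow> 'o \<Rightarrow> 'o \<Rightarrow> 'm \<Rightarrow> 'm \<Rightarrow> 'm"

text \<open>Hom-sets of different pairs of objects need not be disjoint. Therefore composition takes
  the objects as arguments: for \<open>f : X \<rightarrow> Y\<close> and \<open>g : Y \<rightarrow> Z\<close>, the composite \<open>g\<close> after \<open>f\<close> is
  \<open>Comp C X Y Z g f\<close>.\<close>

locale category =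
  fixes C :: "('o, 'm) category"
  assumes Ident_in: "X \<in> Obj C \<Longrightarrow> Ident C X \<in> Hom C X X"
    and Comp_in: "\<lbrakk>X \<in> Obj C; Y \<in> Obj C; Z \<in> Obj C; f \<in> Hom C X Y; g \<in> Hom C Y Z\<rbrakk>
      \<Longrightarrow> Comp C X Y Z g f \<in> Hom C X Z"
    and Comp_Ident_right: "\<lbrakk>X \<in> Obj C; Y \<in> Obj C; f \<in> Hom C X Y\<rbrakk>
      \<Longrightarrow> Comp C X X Y f (Ident C X) = f"
    and Comp_Ident_left: "\<lbrakk>X \<in> Obj C; Y \<in> Obj C; f \<in> Hom C X Y\<rbrakk>
      \<Longrightarrow> Comp C X Y Y (Ident C Y) f = f"
    and Comp_assoc: "\<lbrakk>X \<in> Obj C; Y \<in> Obj C; Z \<in> Obj C; T \<in> Obj C;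
        f \<in> Hom C X Y; g \<in> Hom C Y Z; h \<in> Hom C Z T\<rbrakk>
      \<Longrightarrow> Comp C X Z T h (Comp C X Y Z g f) = Comp C X Y T (Comp C Y Z T h g) f"

record ('o, 'm, 'p, 'n) functor_data =
  on_obj :: "'o \<Rightarrow> 'p"
  on_hom :: "'o \<Rightarrow> 'o \<Rightarrow> 'm \<Rightarrow> 'n"

locale category_functor = C: category C + D: category D
  for C :: "('o, 'm) category" and D :: "('p, 'n) category"
    and F :: "('o, 'm, 'p, 'n) functor_data" +
  assumes on_obj_in: "X \<in> Obj C \<Longrightarrow> on_obj F X \<in> Obj D"
    and on_hom_in: "\<lbrakk>X \<in> Obj C; Y \<in> Obj C; f \<in> Hom C X Y\<rbrakk>
      \<Longrightarrow> on_hom F X Y f \<in> Hom D (on_obj F X) (on_obj F Y)"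
    and on_hom_Ident: "X \<in> Obj C \<Longrightarrow> on_hom F X X (Ident C X) = Ident D (on_obj F X)"
    and on_hom_Comp: "\<lbrakk>X \<in> Obj C; Y \<in> Obj C; Z \<in> Obj C; f \<in> Hom C X Y; g \<in> Hom C Y Z\<rbrakk>
      \<Longrightarrow> on_hom F X Z (Comp C X Y Z g f)
        = Comp D (on_obj F X) (on_obj F Y) (on_obj F Z) (on_hom F Y Z g) (on_hom F X Y f)"

definition id_functor :: "('o, 'm, 'o, 'm) functor_data" where
  "id_functor = \<lparr>on_obj = (\<lambda>X. X), on_hom = (\<lambda>X Y f. f)\<rparr>"

definition comp_functor ::
  "('p, 'n, 'q, 'r) functor_data \<Rightarrow> ('o, 'm, 'p, 'n) functor_data \<Rightarrow> ('o, 'm, 'q, 'r) functor_data"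
  where "comp_functor G F =
    \<lparr>on_obj = (\<lambda>X. on_obj G (on_obj F X)),
     on_hom = (\<lambda>X Y f. on_hom G (on_obj F X) (on_obj F Y) (on_hom F X Y f))\<rparr>"

definition isomorphism_in :: "('o, 'm) category \<Rightarrow> 'o \<Rightarrow> 'o \<Rightarrow> 'm \<Rightarrow> bool" where
  "isomorphism_in C X Y f \<longleftrightarrow> f \<in> Hom C X Y \<and>
    (\<exists>g \<in> Hom C Y X. Comp C X Y X g f = Ident C X \<and> Comp C Y X Y f g = Ident C Y)"

definition natural_isomorphism ::
  "('o, 'm) category \<Rightarrow> ('p, 'n) category \<Rightarrow> ('o, 'm, 'p, 'n) functor_data
    \<Rightarrow> ('o, 'm, 'p, 'n) functor_data \<Rightarrow> ('o \<Rightarrow> 'n) \<Rightarrow> bool" where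
  "natural_isomorphism C D F G \<eta> \<longleftrightarrow>
    (\<forall>X \<in> Obj C. isomorphism_in D (on_obj F X) (on_obj G X) (\<eta> X)) \<and>
    (\<forall>X \<in> Obj C. \<forall>Y \<in> Obj C. \<forall>f \<in> Hom C X Y.
      Comp D (on_obj F X) (on_obj F Y) (on_obj G Y) (\<eta> Y) (on_hom F X Y f)
      = Comp D (on_obj F X) (on_obj G X) (on_obj G Y) (on_hom G X Y f) (\<eta> X))"

definition equivalence_of_categories ::
  "('o, 'm) category \<Rightarrow> ('p, 'n) category \<Rightarrow> ('o, 'm, 'p, 'n) functor_data \<Rightarrow> bool" where
  "equivalence_of_categories C D F \<longleftrightarrow> category_functor C D F \<and>
    (\<exists>G \<eta> \<epsilon>. category_functor D C G \<and>
      natural_isomorphism C C id_functor (comp_functor G F) \<eta> \<and>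
      natural_isomorphism D D (comp_functor F G) id_functor \<epsilon>)"


section \<open>Groups given by generators and relations\<close>

text \<open>The letter \<open>(a, True)\<close> stands for the generator \<open>a\<close>, the letter \<open>(a, False)\<close> for its
  formal inverse.\<close>

type_synonym 'a group_word = "('a \<times> bool) list"

inductive presentation_eq ::
  "'a set \<Rightarrow> ('a group_word \<times> 'a group_word) set \<Rightarrow> 'a group_word \<Rightarrow> 'a group_word \<Rightarrow> bool"
  for X :: "'a set" and R :: "('a group_word \<times> 'a group_word) set"
where
  refl: "presentation_eq X R u u"
| sym: "presentation_eq X R u v \<Longrightarrow> presentation_eq X R v u"
| trans: "presentation_eq X R u v \<Longrightarrow> presentation_eq X R v w \<Longrightarrow> presentation_eq X R u w"
| append: "presentation_eq X R u v \<Longrightarrow> presentation_eq X R u' v'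
    \<Longrightarrow> presentation_eq X R (u @ u') (v @ v')"
| cancel: "a \<in> X \<Longrightarrow> presentation_eq X R [(a, e), (a, \<not> e)] []"
| relation: "(u, v) \<in> R \<Longrightarrow> presentation_eq X R u v"

definition word_class ::
  "'a set \<Rightarrow> ('a group_word \<times> 'a group_word) set \<Rightarrow> 'a group_word \<Rightarrow> 'a group_word set" where
  "word_class X R u = {v \<in> lists (X \<times> UNIV). presentation_eq X R u v}"

definition presented_group ::
  "'a set \<Rightarrow> ('a group_word \<times> 'a group_word) set \<Rightarrow> 'a group_word set monoid" where
  "presented_group X R =
    \<lparr>carrier = word_class X R ` lists (X \<times> UNIV),
     mult = (\<lambda>A B. \<Union>u \<in> A. \<Union>v \<in> B. word_class X R (u @ v)),
     one = word_class X R []\<rparr>"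

fun word_eval :: "('b, 'z) monoid_scheme \<Rightarrow> ('a \<Rightarrow> 'b) \<Rightarrow> 'a group_word \<Rightarrow> 'b" where
  "word_eval G f [] = \<one>\<^bsub>G\<^esub>"
| "word_eval G f ((a, e) # w) = (if e then f a else inv\<^bsub>G\<^esub> (f a)) \<otimes>\<^bsub>G\<^esub> word_eval G f w"

text \<open>The homomorphism from a presented group to \<open>G\<close> that sends each generator \<open>a\<close> to \<open>f a\<close>.
  It is meaningful when \<open>f\<close> respects the relations, so that \<open>word_eval G f\<close> is constant on each
  class.\<close>

definition presented_hom ::
  "('b, 'z) monoid_scheme \<Rightarrow> ('a \<Rightarrow> 'b) \<Rightarrow> 'a group_word set \<Rightarrow> 'b" where
  "presented_hom G f A = the_elem (word_eval G f ` A)"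


section \<open>Coxeter systems and braid groups\<close>

text \<open>An order \<open>group.ord W (s \<otimes> t) = 0\<close> means that \<open>s \<otimes> t\<close> has infinite order.\<close>

definition coxeter_relations :: "'w monoid \<Rightarrow> 'w set \<Rightarrow> ('w group_word \<times> 'w group_word) set" where
  "coxeter_relations W S =
    {(concat (replicate (group.ord W (s \<otimes>\<^bsub>W\<^esub> t)) [(s, True), (t, True)]), []) | s t.
      s \<in> S \<and> t \<in> S \<and> group.ord W (s \<otimes>\<^bsub>W\<^esub> t) \<noteq> 0}"

definition coxeter_system :: "'w monoid \<Rightarrow> 'w set \<Rightarrow> bool" where
  "coxeter_system W S \<longleftrightarrow> group W \<and> S \<subseteq> carrier W \<and> generate W S = carrier W \<and>
    (\<forall>s \<in> S. group.ord W s = 2) \<and>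
    presented_hom W (\<lambda>s. s) \<in> iso (presented_group S (coxeter_relations W S)) W"

fun alternating_word :: "nat \<Rightarrow> 'a \<Rightarrow> 'a \<Rightarrow> 'a group_word" where
  "alternating_word 0 s t = []"
| "alternating_word (Suc n) s t = (s, True) # alternating_word n t s"

definition braid_relations :: "'w monoid \<Rightarrow> 'w set \<Rightarrow> ('w group_word \<times> 'w group_word) set" where
  "braid_relations W S =
    {(alternating_word (group.ord W (s \<otimes>\<^bsub>W\<^esub> t)) s t,
      alternating_word (group.ord W (s \<otimes>\<^bsub>W\<^esub> t)) t s) | s t.
      s \<in> S \<and> t \<in> S \<and> s \<noteq> t \<and> group.ord W (s \<otimes>\<^bsub>W\<^esub> t) \<noteq> 0}"

definition braid_group :: "'w monoid \<Rightarrow> 'w set \<Rightarrow> 'w group_word set monoid" where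
  "braid_group W S = presented_group S (braid_relations W S)"

definition braid_generator :: "'w monoid \<Rightarrow> 'w set \<Rightarrow> 'w \<Rightarrow> 'w group_word set" where
  "braid_generator W S s = word_class S (braid_relations W S) [(s, True)]"

text \<open>Positive braids form a submonoid of the braid group here, rather than the monoid with the
  same presentation.\<close>

definition braid_monoid :: "'w monoid \<Rightarrow> 'w set \<Rightarrow> 'w group_word set monoid" where
  "braid_monoid W S = (braid_group W S)
    \<lparr>carrier := \<Inter>{H. submonoid H (braid_group W S) \<and> braid_generator W S ` S \<subseteq> H}\<rparr>"

definition braid_to_coxeter :: "'w monoid \<Rightarrow> 'w group_word set \<Rightarrow> 'w" where
  "braid_to_coxeter W = presented_hom W (\<lambda>s. s)"

definition parabolic :: "'w monoid \<Rightarrow> 'w set \<Rightarrow> 'w monoid" where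
  "parabolic W J = W\<lparr>carrier := generate W J\<rparr>"

text \<open>The natural map from the braid group of \<open>(parabolic W J, J)\<close> to that of \<open>(W, S)\<close>.\<close>

definition parabolic_braid_hom ::
  "'w monoid \<Rightarrow> 'w set \<Rightarrow> 'w group_word set \<Rightarrow> 'w group_word set" where
  "parabolic_braid_hom W S = presented_hom (braid_group W S) (braid_generator W S)"


section \<open>Vector spaces and direct sums\<close>

definition linear_maps ::
  "'k ring \<Rightarrow> ('k, 'u) module \<Rightarrow> ('k, 'v) module \<Rightarrow> ('u \<Rightarrow> 'v) set" where
  "linear_maps K U V = {f \<in> carrier U \<rightarrow>\<^sub>E carrier V.
    (\<forall>x \<in> carrier U. \<forall>y \<in> carrier U. f (x \<oplus>\<^bsub>U\<^esub> y) = f x \<oplus>\<^bsub>V\<^esub> f y) \<and>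
    (\<forall>a \<in> carrier K. \<forall>x \<in> carrier U. f (a \<odot>\<^bsub>U\<^esub> x) = a \<odot>\<^bsub>V\<^esub> f x)}"

definition endomorphism_monoid :: "'k ring \<Rightarrow> ('k, 'v) module \<Rightarrow> ('v \<Rightarrow> 'v) monoid" where
  "endomorphism_monoid K V =
    \<lparr>carrier = linear_maps K V V, mult = compose (carrier V), one = (\<lambda>v \<in> carrier V. v)\<rparr>"

text \<open>The fields \<open>mult\<close> and \<open>one\<close> of a \<open>module\<close> record play no role in \<open>Module.module\<close>.\<close>

definition direct_sum :: "'i set \<Rightarrow> ('i \<Rightarrow> ('k, 'v) module) \<Rightarrow> ('k, 'i \<Rightarrow> 'v) module" where
  "direct_sum I V =
    \<lparr>carrier = {f \<in> \<Pi>\<^sub>E i \<in> I. carrier (V i). finite {i \<in> I. f i \<noteq> \<zero>\<^bsub>V i\<^esub>}},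
     mult = undefined, one = undefined,
     zero = (\<lambda>i \<in> I. \<zero>\<^bsub>V i\<^esub>),
     add = (\<lambda>f g. \<lambda>i \<in> I. f i \<oplus>\<^bsub>V i\<^esub> g i),
     smult = (\<lambda>a f. \<lambda>i \<in> I. a \<odot>\<^bsub>V i\<^esub> f i)\<rparr>"

definition summand_inj :: "'i set \<Rightarrow> ('i \<Rightarrow> ('k, 'v) module) \<Rightarrow> 'i \<Rightarrow> 'v \<Rightarrow> 'i \<Rightarrow> 'v" where
  "summand_inj I V x v = (\<lambda>i \<in> I. if i = x then v else \<zero>\<^bsub>V i\<^esub>)"

text \<open>\<open>V x\<close> viewed as a subspace of the direct sum.\<close>

definition summand :: "'i set \<Rightarrow> ('i \<Rightarrow> ('k, 'v) module) \<Rightarrow> 'i \<Rightarrow> ('i \<Rightarrow> 'v) set" where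
  "summand I V x = summand_inj I V x ` carrier (V x)"


section \<open>Representations of a monoid\<close>

text \<open>A representation of a group is the same as a representation of its underlying monoid.\<close>

record ('k, 'v, 'b) representation =
  rep_space :: "('k, 'v) module"
  rep_act :: "'b \<Rightarrow> 'v \<Rightarrow> 'v"

definition is_representation :: "'k ring \<Rightarrow> 'b monoid \<Rightarrow> ('k, 'v, 'b) representation \<Rightarrow> bool" where
  "is_representation K M A \<longleftrightarrow> module K (rep_space A) \<and>
    rep_act A \<in> hom M (endomorphism_monoid K (rep_space A)) \<and>
    rep_act A \<one>\<^bsub>M\<^esub> = \<one>\<^bsub>endomorphism_monoid K (rep_space A)\<^esub>"

definition intertwiners ::
  "'k ring \<Rightarrow> 'b monoid \<Rightarrow> ('k, 'u, 'b) representation \<Rightarrow> ('k, 'v, 'b) representation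
    \<Rightarrow> ('u \<Rightarrow> 'v) set" where
  "intertwiners K M A B = {f \<in> linear_maps K (rep_space A) (rep_space B).
    \<forall>b \<in> carrier M. \<forall>v \<in> carrier (rep_space A). f (rep_act A b v) = rep_act B b (f v)}"

definition rep_category :: "'k ring \<Rightarrow> 'b monoid \<Rightarrow> (('k, 'v, 'b) representation, 'v \<Rightarrow> 'v) category" where
  "rep_category K M =
    \<lparr>Obj = {A. is_representation K M A},
     Hom = intertwiners K M,
     Ident = (\<lambda>A. \<lambda>v \<in> carrier (rep_space A). v),
     Comp = (\<lambda>A B C g f. compose (carrier (rep_space A)) g f)\<rparr>"


section \<open>Representations graded by the cosets of a parabolic subgroup\<close>

abbreviation coset_space :: "'w monoid \<Rightarrow> 'w set \<Rightarrow> 'w set set" where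
  "coset_space W J \<equiv> lcosets\<^bsub>W\<^esub> (generate W J)"

abbreviation base_coset :: "'w monoid \<Rightarrow> 'w set \<Rightarrow> 'w set" where
  "base_coset W J \<equiv> \<one>\<^bsub>W\<^esub> <#\<^bsub>W\<^esub> generate W J"

text \<open>The grading is an external direct sum: \<open>total_act A\<close> acts on the direct sum of the spaces
  \<open>grade A x\<close>. So the spaces \<open>grade A x\<close> and the representations of the parabolic braid group
  live over the same type \<open>'v\<close>, whatever its size.\<close>

record ('k, 'v, 'b, 'i) graded_representation =
  grade :: "'i \<Rightarrow> ('k, 'v) module"
  total_act :: "'b \<Rightarrow> ('i \<Rightarrow> 'v) \<Rightarrow> ('i \<Rightarrow> 'v)"

definition total_rep ::
  "'i set \<Rightarrow> ('k, 'v, 'b, 'i) graded_representation \<Rightarrow> ('k, 'i \<Rightarrow> 'v, 'b) representation" where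
  "total_rep I A = \<lparr>rep_space = direct_sum I (grade A), rep_act = total_act A\<rparr>"

text \<open>Below, \<open>M\<close> is either \<open>braid_group W S\<close> or \<open>braid_monoid W S\<close>.\<close>

definition is_graded_representation ::
  "'k ring \<Rightarrow> 'w monoid \<Rightarrow> 'w set \<Rightarrow> 'w set \<Rightarrow> 'w group_word set monoid
    \<Rightarrow> ('k, 'v, 'w group_word set, 'w set) graded_representation \<Rightarrow> bool" where
  "is_graded_representation K W S J M A \<longleftrightarrow>
    (\<forall>x \<in> coset_space W J. module K (grade A x)) \<and>
    is_representation K M (total_rep (coset_space W J) A) \<and>
    (\<forall>b \<in> carrier M. \<forall>x \<in> coset_space W J.
      total_act A b ` summand (coset_space W J) (grade A) x
        \<subseteq> summand (coset_space W J) (grade A) (braid_to_coxeter W b <#\<^bsub>W\<^esub> x)) \<and>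
    (\<forall>s \<in> S. \<forall>x \<in> coset_space W J. s <#\<^bsub>W\<^esub> x \<noteq> x \<longrightarrow>
      (\<forall>v \<in> summand (coset_space W J) (grade A) x.
        total_act A (braid_generator W S s) (total_act A (braid_generator W S s) v) = v))"

definition graded_intertwiners ::
  "'k ring \<Rightarrow> 'b monoid \<Rightarrow> 'i set \<Rightarrow> ('k, 'u, 'b, 'i) graded_representation
    \<Rightarrow> ('k, 'v, 'b, 'i) graded_representation \<Rightarrow> (('i \<Rightarrow> 'u) \<Rightarrow> ('i \<Rightarrow> 'v)) set" where
  "graded_intertwiners K M I A B = {f \<in> intertwiners K M (total_rep I A) (total_rep I B).
    \<forall>x \<in> I. f ` summand I (grade A) x \<subseteq> summand I (grade B) x}"

definition graded_rep_category ::
  "'k ring \<Rightarrow> 'w monoid \<Rightarrow> 'w set \<Rightarrow> 'w set \<Rightarrow> 'w group_word set monoid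
    \<Rightarrow> (('k, 'v, 'w group_word set, 'w set) graded_representation,
        ('w set \<Rightarrow> 'v) \<Rightarrow> ('w set \<Rightarrow> 'v)) category" where
  "graded_rep_category K W S J M =
    \<lparr>Obj = {A. is_graded_representation K W S J M A},
     Hom = graded_intertwiners K M (coset_space W J),
     Ident = (\<lambda>A. \<lambda>v \<in> carrier (direct_sum (coset_space W J) (grade A)). v),
     Comp = (\<lambda>A B C g f. compose (carrier (direct_sum (coset_space W J) (grade A))) g f)\<rparr>"

definition base_functor ::
  "'w monoid \<Rightarrow> 'w set \<Rightarrow> 'w set
    \<Rightarrow> (('k, 'v, 'w group_word set, 'w set) graded_representation, ('w set \<Rightarrow> 'v) \<Rightarrow> ('w set \<Rightarrow> 'v),
        ('k, 'v, 'w group_word set) representation, 'v \<Rightarrow> 'v) functor_data" where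
  "base_functor W S J =
    \<lparr>on_obj = (\<lambda>A.
       \<lparr>rep_space = grade A (base_coset W J),
        rep_act = (\<lambda>b. \<lambda>v \<in> carrier (grade A (base_coset W J)).
          total_act A (parabolic_braid_hom W S b)
            (summand_inj (coset_space W J) (grade A) (base_coset W J) v) (base_coset W J))\<rparr>),
     on_hom = (\<lambda>A B f. \<lambda>v \<in> carrier (grade A (base_coset W J)).
        f (summand_inj (coset_space W J) (grade A) (base_coset W J) v) (base_coset W J))\<rparr>"

end

theory Submission
  imports Defs
begin

text \<open>Write \<open>w\<^sub>x\<close> for the shortest element of a coset \<open>x\<close> of \<open>W\<^sub>J\<close>, and \<open>x\<^sub>0\<close> for the base coset. For
  \<open>s \<in> S\<close> there are two cases: if \<open>s x \<noteq> x\<close>, then \<open>s w\<^sub>x = w\<^bsub>s x\<^esub>\<close>; if \<open>s x = x\<close>, then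
  \<open>s w\<^sub>x = w\<^sub>x t\<close> with \<open>t \<in> J\<close> (\<open>deodhar\<close>). Sending \<open>(s, x)\<close> to \<open>1\<close> in the first case and to \<open>t\<close> in the
  second extends to a 1-cocycle of \<open>B\<close> on \<open>W/W\<^sub>J\<close> with values in \<open>B\<^sub>J\<close> (\<open>cocycle\<close>), that is, to a
  homomorphism from \<open>B\<close> to a wreath product. The braid relations hold for the following reason. A word
  in \<open>S\<close> read along its path through the cosets projects to a word in \<open>J\<close>, whose reflections are, up
  to conjugation, some of those of the given word (\<open>reflections_projection\<close>). So reduced words
  project to reduced words, the two sides of a braid relation project to reduced words of one
  element of \<open>W\<^sub>J\<close>, and these agree in \<open>B\<^sub>J\<close> by Matsumoto's theorem.

  A representation of \<open>B\<^sub>J\<close> then induces a graded one, with \<open>b\<close> acting from the component \<open>x\<close> to the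
  component \<open>b x\<close> through \<open>cocycle b x\<close>. Its base component is the given representation, because at
  \<open>x\<^sub>0\<close> the cocycle inverts the natural map \<open>B\<^sub>J \<rightarrow> B\<close> (\<open>cocycle_\<iota>\<close>).

  Conversely, let \<open>A\<close> be a graded representation. The positive lift of \<open>w\<^sub>x\<close> to \<open>B\<close> is a product of
  generators each of which moves the coset that it meets. There its square acts as the identity, so
  the lift gives an isomorphism \<open>\<theta>\<close> from the component at \<open>x\<^sub>0\<close> to the component at \<open>x\<close>. Matsumoto's
  theorem for \<open>B\<close> shows that \<open>\<theta>\<close> turns the action of \<open>b\<close> on the component \<open>x\<close> into the action of
  \<open>cocycle b x\<close> on the base component (\<open>\<theta>_commute\<close>). Hence morphisms are the same as morphisms of
  base components (\<open>F_faithful\<close>, \<open>F_full\<close>).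

  Positive braids are covered by the same argument: the cocycle has positive values on generators,
  hence on the monoid that they generate, and the lifts of the \<open>w\<^sub>x\<close> are positive.

  The theory of reduced words rests on one more cocycle. Assigning to a word the set of reflections
  that occur in it an odd number of times gives a \<open>\<int>/2\<close>-valued cocycle on \<open>W\<close>, since the Coxeter
  relations respect it. So this set, the set of inversions, depends only on the product of the
  word. It yields the exchange condition, and it makes the length and the shortest coset
  representatives accessible: \<open>w\<^sub>x\<close> is the element of \<open>x\<close> without inversions in \<open>W\<^sub>J\<close>.\<close>


section \<open>Universal property of a presented group\<close>

lemma word_eval_closed:
  assumes "group G" "f \<in> X \<rightarrow> carrier G" "u \<in> lists (X \<times> UNIV)"
  shows "word_eval G f u \<in> carrier G"
proof -
  interpret group G by fact
  show ?thesis
    using assms(3,2) by (induction u) (auto simp: Pi_iff)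
qed

lemma word_eval_append:
  assumes "group G" "f \<in> X \<rightarrow> carrier G" "u \<in> lists (X \<times> UNIV)" "v \<in> lists (X \<times> UNIV)"
  shows "word_eval G f (u @ v) = word_eval G f u \<otimes>\<^bsub>G\<^esub> word_eval G f v"
proof -
  interpret group G by fact
  show ?thesis
    using assms(3)
  proof (induction u)
    case Nil
    then show ?case using word_eval_closed[OF assms(1,2,4)] by simp
  next
    case (Cons l u)
    obtain a e where l: "l = (a, e)" by (cases l)
    with Cons assms(2) have "(if e then f a else inv\<^bsub>G\<^esub> f a) \<in> carrier G"
      by (auto simp: Pi_iff)
    with Cons l show ?case
      using word_eval_closed[OF assms(1,2,4)] word_eval_closed[OF assms(1,2), of u]
      by (simp add: m_assoc)
  qed
qed

text \<open>The relation \<open>presentation_eq\<close> also relates words with letters outside the generators, where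
  evaluation carries no information. Hence the induction must carry along that being a word in the
  generators is invariant.\<close>

lemma presentation_eq_word_eval:
  assumes "group G" "f \<in> X \<rightarrow> carrier G"
    and R: "R \<subseteq> lists (X \<times> UNIV) \<times> lists (X \<times> UNIV)"
    and rel: "\<And>u v. (u, v) \<in> R \<Longrightarrow> word_eval G f u = word_eval G f v"
    and "presentation_eq X R u v"
  shows "(u \<in> lists (X \<times> UNIV) \<longleftrightarrow> v \<in> lists (X \<times> UNIV)) \<and>
    (u \<in> lists (X \<times> UNIV) \<longrightarrow> word_eval G f u = word_eval G f v)"
proof -
  interpret group G by fact
  show ?thesis
    using assms(5)
  proof induction
    case (append u v u' v')
    then show ?case
      using word_eval_append[OF assms(1,2)] by (auto simp: append_in_lists_conv)
  next
    case (cancel a e)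
    then show ?case using assms(2) by (auto simp: Pi_iff)
  next
    case (relation u v)
    then show ?case using R rel by auto
  qed auto
qed

locale presentation =
  fixes X :: "'a set" and R :: "('a group_word \<times> 'a group_word) set"
  assumes relators: "R \<subseteq> lists (X \<times> UNIV) \<times> lists (X \<times> UNIV)"
begin

abbreviation "P \<equiv> presented_group X R"
abbreviation "cls \<equiv> word_class X R"
abbreviation "words \<equiv> lists (X \<times> (UNIV :: bool set))"

lemma word_class_eq_iff:
  assumes "u \<in> words" "v \<in> words"
  shows "cls u = cls v \<longleftrightarrow> presentation_eq X R u v"
  using assms unfolding word_class_def
  by (auto intro: presentation_eq.intros)

lemma mult_word_class:
  assumes "u \<in> words" "v \<in> words"
  shows "cls u \<otimes>\<^bsub>P\<^esub> cls v = cls (u @ v)"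
proof -
  define c where c: "c = cls (u @ v)"
  have "cls (u' @ v') = c"
    if "u' \<in> cls u" "v' \<in> cls v" for u' v'
  proof -
    have "presentation_eq X R (u @ v) (u' @ v')" "u' @ v' \<in> words"
      using that presentation_eq.append[of X R u u' v v']
      by (simp_all add: word_class_def append_in_lists_conv)
    from this(1) have "presentation_eq X R (u' @ v') (u @ v)"
      by (rule presentation_eq.sym)
    with \<open>u' @ v' \<in> words\<close> show ?thesis
      using assms by (simp add: c word_class_eq_iff append_in_lists_conv)
  qed
  moreover have "u \<in> cls u" "v \<in> cls v"
    using assms by (auto simp: word_class_def intro: presentation_eq.refl)
  ultimately have "(\<Union>u' \<in> cls u. \<Union>v' \<in> cls v. cls (u' @ v')) = c"
    by blast
  then show ?thesis
    by (simp add: presented_group_def c)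
qed

lemma presented_group_carrierE:
  assumes "b \<in> carrier (P)"
  obtains u where "u \<in> words" "b = cls u"
  using assms by (auto simp: presented_group_def)

lemma word_class_in [simp]: "u \<in> words \<Longrightarrow> cls u \<in> carrier (P)"
  by (simp add: presented_group_def)

lemma one_presented_group: "\<one>\<^bsub>P\<^esub> = cls []"
  by (simp add: presented_group_def)

lemma inverse_word:
  assumes "u \<in> words"
  shows "\<exists>v \<in> words. cls v \<otimes>\<^bsub>P\<^esub> cls u
    = \<one>\<^bsub>P\<^esub>"
  using assms
proof (induction u)
  case Nil
  then show ?case
    by (intro bexI[of _ "[]"]) (simp_all add: mult_word_class one_presented_group)
next
  case (Cons l u)
  obtain a e where l: "l = (a, e)" by (cases l)
  obtain v where v: "v \<in> words" "cls (v @ u) = cls []"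
    using Cons by (auto simp: mult_word_class one_presented_group)
  have vu: "presentation_eq X R (v @ u) []"
    using v Cons word_class_eq_iff[of "v @ u" "[]"] by (simp add: append_in_lists_conv)
  have "presentation_eq X R [(a, \<not> e), (a, e)] []"
    using presentation_eq.cancel[of a X R "\<not> e"] Cons l by simp
  then have "presentation_eq X R (v @ ([(a, \<not> e), (a, e)] @ u)) (v @ ([] @ u))"
    by (intro presentation_eq.append presentation_eq.refl)
  then have "presentation_eq X R (v @ [(a, \<not> e), (a, e)] @ u) []"
    using vu by (simp add: presentation_eq.trans[where v="v @ u"])
  then have "cls ((v @ [(a, \<not> e)]) @ (l # u)) = cls []"
    using Cons v l by (subst word_class_eq_iff) (auto simp: append_in_lists_conv)
  moreover have "v @ [(a, \<not> e)] \<in> words"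
    using Cons v l by (auto simp: append_in_lists_conv)
  ultimately show ?case
    using Cons
    by (intro bexI[of _ "v @ [(a, \<not> e)]"])
      (auto simp: mult_word_class one_presented_group append_in_lists_conv)
qed

lemma group_presented_group: "group (P)"
proof (rule groupI)
  show "\<one>\<^bsub>P\<^esub> \<in> carrier (P)"
    by (simp add: one_presented_group)
next
  fix x y z
  assume "x \<in> carrier (P)" "y \<in> carrier (P)"
    "z \<in> carrier (P)"
  then show "x \<otimes>\<^bsub>P\<^esub> y \<otimes>\<^bsub>P\<^esub> z
    = x \<otimes>\<^bsub>P\<^esub> (y \<otimes>\<^bsub>P\<^esub> z)"
    by (elim presented_group_carrierE) (simp add: mult_word_class append_in_lists_conv)
next
  fix x
  assume "x \<in> carrier (P)"
  then show "\<exists>y\<in>carrier (P). y \<otimes>\<^bsub>P\<^esub> x = \<one>\<^bsub>P\<^esub>"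
    using inverse_word by (elim presented_group_carrierE) (metis word_class_in)
next
  fix x y
  assume "x \<in> carrier (P)" "y \<in> carrier (P)"
  then show "x \<otimes>\<^bsub>P\<^esub> y \<in> carrier (P)"
    by (elim presented_group_carrierE) (simp add: mult_word_class append_in_lists_conv)
next
  fix x
  assume "x \<in> carrier (P)"
  then show "\<one>\<^bsub>P\<^esub> \<otimes>\<^bsub>P\<^esub> x = x"
    by (elim presented_group_carrierE) (simp add: mult_word_class one_presented_group)
qed

lemma presented_hom_word_class:
  assumes "group G" "f \<in> X \<rightarrow> carrier G"
    and "\<And>u v. (u, v) \<in> R \<Longrightarrow> word_eval G f u = word_eval G f v"
    and u: "u \<in> words"
  shows "presented_hom G f (cls u) = word_eval G f u"
proof -
  have "word_eval G f ` cls u = {word_eval G f u}"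
    using presentation_eq_word_eval[OF assms(1,2) relators assms(3)] u
    by (fastforce simp: word_class_def intro: presentation_eq.refl)
  then show ?thesis
    by (simp add: presented_hom_def)
qed

lemma presented_hom_hom:
  assumes "group G" "f \<in> X \<rightarrow> carrier G"
    and "\<And>u v. (u, v) \<in> R \<Longrightarrow> word_eval G f u = word_eval G f v"
  shows "presented_hom G f \<in> hom (P) G"
proof (rule homI)
  fix x y
  assume "x \<in> carrier (P)" "y \<in> carrier (P)"
  then show "presented_hom G f (x \<otimes>\<^bsub>P\<^esub> y)
    = presented_hom G f x \<otimes>\<^bsub>G\<^esub> presented_hom G f y"
    by (elim presented_group_carrierE)
      (simp add: presented_hom_word_class[OF assms] mult_word_class append_in_lists_conv
        word_eval_append[OF assms(1,2)])
next
  fix x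
  assume "x \<in> carrier (P)"
  then show "presented_hom G f x \<in> carrier G"
    by (elim presented_group_carrierE)
      (simp add: presented_hom_word_class[OF assms] word_eval_closed[OF assms(1,2)])
qed

lemma word_eval_generators:
  assumes "u \<in> words"
  shows "word_eval (P) (\<lambda>a. cls [(a, True)]) u = cls u"
proof -
  interpret group "P" by (rule group_presented_group)
  show ?thesis
    using assms
  proof (induction u)
    case Nil
    then show ?case by (simp add: one_presented_group)
  next
    case (Cons l u)
    obtain a e where l: "l = (a, e)" and a: "a \<in> X" using Cons by (cases l) auto
    have "cls [(a, False)] \<otimes>\<^bsub>P\<^esub> cls [(a, True)]
      = \<one>\<^bsub>P\<^esub>"
      using a presentation_eq.cancel[of a X R False]
      by (auto simp: mult_word_class one_presented_group word_class_eq_iff)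
    then have "inv\<^bsub>P\<^esub> (cls [(a, True)]) = cls [(a, False)]"
      using a by (intro inv_equality) auto
    then show ?case
      using Cons a l by (cases e) (auto simp: mult_word_class)
  qed
qed

end


section \<open>Permutational wreath products\<close>

text \<open>For a group \<open>W\<close> acting on \<open>X\<close>, homomorphisms to this group that lift a given homomorphism
  to \<open>W\<close> are the same as \<open>H\<close>-valued 1-cocycles on \<open>X\<close>: the second component of a product is
  \<open>x \<mapsto> f (w' x) \<otimes> f' x\<close>.\<close>

definition wreath_product ::
  "('w, 'y) monoid_scheme \<Rightarrow> 'x set \<Rightarrow> ('w \<Rightarrow> 'x \<Rightarrow> 'x) \<Rightarrow> ('h, 'z) monoid_scheme
    \<Rightarrow> ('w \<times> ('x \<Rightarrow> 'h)) monoid" where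
  "wreath_product W X act H =
    \<lparr>carrier = carrier W \<times> (X \<rightarrow>\<^sub>E carrier H),
     mult = (\<lambda>(w, f) (w', f'). (w \<otimes>\<^bsub>W\<^esub> w', \<lambda>x \<in> X. f (act w' x) \<otimes>\<^bsub>H\<^esub> f' x)),
     one = (\<one>\<^bsub>W\<^esub>, \<lambda>x \<in> X. \<one>\<^bsub>H\<^esub>)\<rparr>"

lemma group_wreath_product:
  assumes "group W" "group H"
    and act_closed: "\<And>w x. w \<in> carrier W \<Longrightarrow> x \<in> X \<Longrightarrow> act w x \<in> X"
    and act_one: "\<And>x. x \<in> X \<Longrightarrow> act \<one>\<^bsub>W\<^esub> x = x"
    and act_mult: "\<And>w w' x. w \<in> carrier W \<Longrightarrow> w' \<in> carrier W \<Longrightarrow> x \<in> X \<Longrightarrow>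
      act (w \<otimes>\<^bsub>W\<^esub> w') x = act w (act w' x)"
  shows "group (wreath_product W X act H)"
proof -
  interpret W: group W by fact
  interpret H: group H by fact
  let ?P = "wreath_product W X act H"
  show ?thesis
  proof (rule groupI)
    fix a b c
    assume "a \<in> carrier ?P" "b \<in> carrier ?P" "c \<in> carrier ?P"
    then show "a \<otimes>\<^bsub>?P\<^esub> b \<otimes>\<^bsub>?P\<^esub> c = a \<otimes>\<^bsub>?P\<^esub> (b \<otimes>\<^bsub>?P\<^esub> c)"
      by (auto simp: wreath_product_def W.m_assoc H.m_assoc act_mult act_closed PiE_iff
          intro!: restrict_ext)
  next
    fix a
    assume "a \<in> carrier ?P"
    then obtain w f where a: "a = (w, f)" "w \<in> carrier W" "f \<in> X \<rightarrow>\<^sub>E carrier H"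
      by (auto simp: wreath_product_def)
    let ?b = "(inv\<^bsub>W\<^esub> w, \<lambda>x \<in> X. inv\<^bsub>H\<^esub> (f (act (inv\<^bsub>W\<^esub> w) x)))"
    have b: "?b \<in> carrier ?P"
      using a by (auto simp: wreath_product_def act_closed PiE_iff)
    have "act (inv\<^bsub>W\<^esub> w) (act w x) = x" if "x \<in> X" for x
      using that a act_mult[of "inv\<^bsub>W\<^esub> w" w x] by (simp add: act_one)
    then have "?b \<otimes>\<^bsub>?P\<^esub> a = \<one>\<^bsub>?P\<^esub>"
      using a by (auto simp: wreath_product_def act_closed PiE_iff intro!: restrict_ext)
    with b show "\<exists>b \<in> carrier ?P. b \<otimes>\<^bsub>?P\<^esub> a = \<one>\<^bsub>?P\<^esub>" by blast
  next
    fix a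
    assume "a \<in> carrier ?P"
    then obtain w f where a: "a = (w, f)" "w \<in> carrier W" "f \<in> X \<rightarrow>\<^sub>E carrier H"
      by (auto simp: wreath_product_def)
    have "(\<lambda>x \<in> X. \<one>\<^bsub>H\<^esub> \<otimes>\<^bsub>H\<^esub> f x) = f"
      using a(3) by (intro ext) (auto simp: restrict_def PiE_iff extensional_def)
    then show "\<one>\<^bsub>?P\<^esub> \<otimes>\<^bsub>?P\<^esub> a = a"
      using a by (simp add: wreath_product_def act_closed cong: restrict_cong)
  qed (auto simp: wreath_product_def act_closed PiE_iff)
qed

lemma wreath_product_fst_hom:
  "fst \<in> hom (wreath_product W X act H) W"
  by (auto simp: wreath_product_def hom_def)

section \<open>Words and reflections in a Coxeter group\<close>

abbreviation positive_eval :: "('b, 'z) monoid_scheme \<Rightarrow> ('a \<Rightarrow> 'b) \<Rightarrow> 'a list \<Rightarrow> 'b" where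
  "positive_eval G f ws \<equiv> word_eval G f (map (\<lambda>s. (s, True)) ws)"

lemma positive_eval_closed:
  assumes "group G" "f \<in> X \<rightarrow> carrier G" "set ws \<subseteq> X"
  shows "positive_eval G f ws \<in> carrier G"
  using assms by (intro word_eval_closed[where X = X]) auto

lemma positive_eval_append:
  assumes "group G" "f \<in> X \<rightarrow> carrier G" "set us \<subseteq> X" "set vs \<subseteq> X"
  shows "positive_eval G f (us @ vs) = positive_eval G f us \<otimes>\<^bsub>G\<^esub> positive_eval G f vs"
  using assms by (simp, intro word_eval_append[where X = X]) auto

fun alternating :: "nat \<Rightarrow> 'a \<Rightarrow> 'a \<Rightarrow> 'a list" where
  "alternating 0 s t = []"
| "alternating (Suc n) s t = s # alternating n t s"

lemma alternating_word_eq: "alternating_word n s t = map (\<lambda>s. (s, True)) (alternating n s t)"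
  by (induction n s t rule: alternating.induct) auto

lemma length_alternating [simp]: "length (alternating n s t) = n"
  by (induction n s t rule: alternating.induct) auto

lemma set_alternating: "set (alternating n s t) \<subseteq> {s, t}"
  by (induction n s t rule: alternating.induct) auto

lemma alternating_double: "alternating (2 * n) s t = concat (replicate n [s, t])"
  by (induction n) auto

text \<open>For \<open>ws = s\<^sub>1 \<dots> s\<^sub>k\<close> these are the elements
  \<open>(s\<^bsub>i+1\<^esub> \<dots> s\<^sub>k)\<inverse> s\<^sub>i (s\<^bsub>i+1\<^esub> \<dots> s\<^sub>k)\<close>: multiplying the product of \<open>ws\<close> on the right by one of them
  deletes the letter \<open>s\<^sub>i\<close>.\<close>

fun reflections :: "('w, 'z) monoid_scheme \<Rightarrow> 'w list \<Rightarrow> 'w list" where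
  "reflections W [] = []"
| "reflections W (s # ws) = (let p = positive_eval W (\<lambda>s. s) ws
    in inv\<^bsub>W\<^esub> p \<otimes>\<^bsub>W\<^esub> s \<otimes>\<^bsub>W\<^esub> p) # reflections W ws"

lemma length_reflections [simp]: "length (reflections W ws) = length ws"
  by (induction ws) (auto simp: Let_def)

text \<open>The group \<open>\<int>/2\<close>, on truth values so that its elements can be read as parities.\<close>

definition xor_group :: "bool monoid" where
  "xor_group = \<lparr>carrier = UNIV, mult = (\<noteq>), one = False\<rparr>"

lemma group_xor_group: "group xor_group"
  by (rule groupI) (auto simp: xor_group_def)

context group
begin

lemma conj_inj:
  "a \<in> carrier G \<Longrightarrow> b \<in> carrier G \<Longrightarrow> c \<in> carrier G \<Longrightarrow>
    inv a \<otimes> b \<otimes> a = inv a \<otimes> c \<otimes> a \<longleftrightarrow> b = c"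
  by simp

lemma conj_eq_iff:
  "a \<in> carrier G \<Longrightarrow> b \<in> carrier G \<Longrightarrow> c \<in> carrier G \<Longrightarrow>
    inv a \<otimes> b \<otimes> a = c \<longleftrightarrow> b = a \<otimes> c \<otimes> inv a"
  by (metis inv_closed inv_solve_left' inv_solve_right m_assoc m_closed)

lemma inv_mult_cancel_left: "a \<in> carrier G \<Longrightarrow> b \<in> carrier G \<Longrightarrow> inv a \<otimes> (a \<otimes> b) = b"
  by (simp flip: m_assoc)

lemma mult_inv_cancel_left: "a \<in> carrier G \<Longrightarrow> b \<in> carrier G \<Longrightarrow> a \<otimes> (inv a \<otimes> b) = b"
  by (simp flip: m_assoc)

lemmas cancel_simps = m_assoc inv_mult_group inv_mult_cancel_left mult_inv_cancel_left

end

lemma (in group) pow_mult_swap: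
  assumes "c \<in> carrier G" "d \<in> carrier G"
  shows "c \<otimes> (d \<otimes> c) [^] (n::nat) = (c \<otimes> d) [^] n \<otimes> c"
  using assms
proof (induction n)
  case (Suc n)
  have "c \<otimes> (d \<otimes> c) [^] Suc n = (c \<otimes> (d \<otimes> c) [^] n) \<otimes> (d \<otimes> c)"
    using Suc.prems by (simp add: m_assoc)
  also have "\<dots> = ((c \<otimes> d) [^] n \<otimes> c) \<otimes> (d \<otimes> c)"
    using Suc by simp
  also have "\<dots> = (c \<otimes> d) [^] Suc n \<otimes> c"
    using Suc.prems by (simp add: m_assoc)
  finally show ?case .
qed simp

locale finite_coxeter =
  fixes W :: "'w monoid" (structure) and S :: "'w set"
  assumes coxeter_system: "coxeter_system W S"
    and finite_carrier: "finite (carrier W)"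
begin

sublocale group W
  using coxeter_system by (simp add: coxeter_system_def)

abbreviation prd :: "'w list \<Rightarrow> 'w" where
  "prd \<equiv> positive_eval W (\<lambda>s. s)"

lemma generator_closed [simp]: "s \<in> S \<Longrightarrow> s \<in> carrier W"
  using coxeter_system by (auto simp: coxeter_system_def)

lemma generator_square: "s \<in> S \<Longrightarrow> s \<otimes> s = \<one>"
  using coxeter_system pow_ord_eq_1[of s] nat_pow_Suc[of s 1]
  by (auto simp: coxeter_system_def numeral_2_eq_2)

lemma generator_ne_one: "s \<in> S \<Longrightarrow> s \<noteq> \<one>"
  using coxeter_system by (auto simp: coxeter_system_def)

lemma inv_generator [simp]: "s \<in> S \<Longrightarrow> inv s = s"
  by (simp add: generator_square inv_equality)

lemma generator_cancel_left: "s \<in> S \<Longrightarrow> a \<in> carrier W \<Longrightarrow> s \<otimes> (s \<otimes> a) = a"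
  by (simp add: generator_square flip: m_assoc)

lemma prd_closed [simp]: "set ws \<subseteq> S \<Longrightarrow> prd ws \<in> carrier W"
  using positive_eval_closed[of W "\<lambda>s. s" S ws] is_group by auto

lemma prd_append: "set us \<subseteq> S \<Longrightarrow> set vs \<subseteq> S \<Longrightarrow> prd (us @ vs) = prd us \<otimes> prd vs"
  using positive_eval_append[of W "\<lambda>s. s" S us vs] is_group by auto

lemma reflections_closed: "set ws \<subseteq> S \<Longrightarrow> set (reflections W ws) \<subseteq> carrier W"
  by (induction ws) (auto simp: Let_def)

lemma reflections_append:
  "set us \<subseteq> S \<Longrightarrow> set vs \<subseteq> S \<Longrightarrow>
    reflections W (us @ vs)
      = map (\<lambda>r. inv (prd vs) \<otimes> r \<otimes> prd vs) (reflections W us) @ reflections W vs"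
  by (induction us) (auto simp: Let_def prd_append cancel_simps simp del: map_append)

lemma ord_generators_pos: "s \<in> S \<Longrightarrow> t \<in> S \<Longrightarrow> ord (s \<otimes> t) \<noteq> 0"
  using ord_ge_1[OF finite_carrier, of "s \<otimes> t"] by simp

lemma ord_generators_commute:
  assumes "s \<in> S" "t \<in> S"
  shows "ord (t \<otimes> s) = ord (s \<otimes> t)"
  using ord_inv[of "s \<otimes> t"] assms by (simp add: inv_mult_group)


subsection \<open>Dihedral words\<close>

text \<open>The reflections of an alternating word are the \<open>(c d)\<^sup>i c\<close>, where \<open>c\<close> is its last letter.
  So they repeat with period \<open>ord (s \<otimes> t)\<close>, and not earlier.\<close>

lemma prd_alternating:
  assumes "s \<in> S" "t \<in> S"
  shows "prd (alternating n s t) =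
    (if even n then (s \<otimes> t) [^] (n div 2) else (s \<otimes> t) [^] (n div 2) \<otimes> s)"
  using assms
proof (induction n arbitrary: s t)
  case (Suc n)
  have 1: "prd (alternating (Suc n) s t) = s \<otimes> prd (alternating n t s)"
    by simp
  show ?case
  proof (cases "even n")
    case True
    then show ?thesis
      using Suc pow_mult_swap[of s t] unfolding 1 by (auto simp del: alternating.simps)
  next
    case False
    then have "s \<otimes> prd (alternating n t s) = (s \<otimes> (t \<otimes> s) [^] (n div 2)) \<otimes> t"
      using Suc by (simp add: m_assoc)
    also have "\<dots> = (s \<otimes> t) [^] Suc (n div 2)"
      using Suc(2,3) pow_mult_swap[of s t] by (simp add: m_assoc)
    finally show ?thesis
      using False unfolding 1 by (simp del: alternating.simps)
  qed
qed simp

lemma reflections_alternating: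
  assumes "s \<in> S" "t \<in> S"
  shows "reflections W (alternating n s t) =
    (let (c, d) = (if odd n then (s, t) else (t, s)) in map (\<lambda>i. (c \<otimes> d) [^] i \<otimes> c) (rev [0..<n]))"
  using assms
proof (induction n arbitrary: s t)
  case (Suc n)
  have pow_inv: "inv ((t \<otimes> s) [^] k) = (s \<otimes> t) [^] k" for k :: nat
    using Suc by (simp add: inv_mult_group flip: nat_pow_inv)
  have "inv (prd (alternating n t s)) \<otimes> s \<otimes> prd (alternating n t s) =
    (if even n then (s \<otimes> t) [^] n \<otimes> s else (t \<otimes> s) [^] n \<otimes> t)"
  proof (cases "even n")
    case True
    then obtain k where k: "n = 2 * k" by blast
    then show ?thesis
      using Suc.prems by (simp add: prd_alternating pow_inv m_assoc pow_mult_swap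
          nat_pow_mult mult_2 del: alternating.simps flip: m_assoc)
        (simp add: m_assoc pow_mult_swap nat_pow_mult flip: nat_pow_mult)
  next
    case False
    then obtain k where k: "n = Suc (2 * k)" by (auto elim: oddE)
    have "inv (prd (alternating n t s)) \<otimes> s \<otimes> prd (alternating n t s)
      = t \<otimes> (s \<otimes> t) [^] k \<otimes> s \<otimes> ((t \<otimes> s) [^] k \<otimes> t)"
      using Suc.prems k by (simp add: prd_alternating pow_inv inv_mult_group del: alternating.simps)
    also have "\<dots> = (t \<otimes> s) [^] k \<otimes> (t \<otimes> s) \<otimes> ((t \<otimes> s) [^] k \<otimes> t)"
      using Suc.prems by (simp only: pow_mult_swap generator_closed) (simp add: m_assoc)
    also have "\<dots> = (t \<otimes> s) [^] (Suc k + k) \<otimes> t"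
      using Suc.prems
      by (simp only: m_assoc[symmetric] nat_pow_Suc[symmetric] nat_pow_mult m_closed nat_pow_closed
          generator_closed)
    finally show ?thesis
      using k by (simp add: mult_2)
  qed
  then show ?case
    using Suc by (auto simp: Let_def)
qed simp

lemma distinct_reflections_alternating:
  assumes "s \<in> S" "t \<in> S" "n \<le> ord (s \<otimes> t)"
  shows "distinct (reflections W (alternating n s t))"
proof -
  have "distinct (map (\<lambda>i. (c \<otimes> d) [^] i \<otimes> c) (rev [0..<n]))"
    if cd: "c \<in> S" "d \<in> S" "ord (c \<otimes> d) = ord (s \<otimes> t)" for c d
  proof -
    have "i = j" if ij: "i < n" "j < n" "(c \<otimes> d) [^] i \<otimes> c = (c \<otimes> d) [^] j \<otimes> c" for i j
    proof -
      have "(c \<otimes> d) [^] i = (c \<otimes> d) [^] j"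
        using ij cd by simp
      moreover have "i \<in> {0..ord (c \<otimes> d) - 1}" "j \<in> {0..ord (c \<otimes> d) - 1}"
        using ij cd assms by auto
      ultimately show ?thesis
        using ord_inj[of "c \<otimes> d"] cd by (auto dest: inj_onD)
    qed
    then show ?thesis
      by (auto simp: distinct_map intro!: inj_onI)
  qed
  then show ?thesis
    using assms by (auto simp: reflections_alternating Let_def ord_generators_commute)
qed

lemma prd_alternating_braid:
  assumes "s \<in> S" "t \<in> S"
  defines "m \<equiv> ord (s \<otimes> t)"
  shows "prd (alternating m s t) = prd (alternating m t s)"
proof -
  have one: "(s \<otimes> t) [^] m = \<one>"
    using assms by (simp add: m_def)
  have pow_inv: "inv ((s \<otimes> t) [^] k) = (t \<otimes> s) [^] k" for k :: nat
    using assms by (simp add: inv_mult_group flip: nat_pow_inv)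
  show ?thesis
  proof (cases "even m")
    case True
    then obtain k where k: "m = k + k" by (metis evenE mult_2)
    then have "(s \<otimes> t) [^] k \<otimes> (s \<otimes> t) [^] k = \<one>"
      using one assms by (simp add: nat_pow_mult)
    then have "inv ((s \<otimes> t) [^] k) = (s \<otimes> t) [^] k"
      using assms by (simp add: inv_equality)
    then show ?thesis
      using assms(1,2) k True by (simp add: prd_alternating pow_inv)
  next
    case False
    then obtain k where k: "m = Suc (k + k)" by (metis oddE mult_2 Suc_eq_plus1)
    have "((s \<otimes> t) [^] k \<otimes> s) \<otimes> (t \<otimes> (s \<otimes> t) [^] k) = (s \<otimes> t) [^] Suc k \<otimes> (s \<otimes> t) [^] k"
      using assms(1,2) by (simp add: m_assoc)
    also have "\<dots> = \<one>"
      using one assms(1,2) k by (simp only: nat_pow_mult m_closed generator_closed add_Suc)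
    finally have "inv (t \<otimes> (s \<otimes> t) [^] k) = (s \<otimes> t) [^] k \<otimes> s"
      using assms(1,2) by (intro inv_equality) auto
    then have "(s \<otimes> t) [^] k \<otimes> s = (t \<otimes> s) [^] k \<otimes> t"
      using assms(1,2) by (simp add: inv_mult_group pow_inv)
    then show ?thesis
      using assms(1,2) k False by (simp add: prd_alternating del: alternating.simps)
  qed
qed

end

context finite_coxeter
begin

subsection \<open>Inversions\<close>

lemma word_eval_concat_replicate:
  "word_eval G f (concat (replicate n [(s, True), (t, True)])) = positive_eval G f (alternating (2 * n) s t)"
  by (simp add: alternating_double map_concat)

lemma presentation_coxeter: "presentation S (coxeter_relations W S)"
  by standard (auto simp: coxeter_relations_def)

lemma coxeter_relations_hold:
  "(u, v) \<in> coxeter_relations W S \<Longrightarrow> word_eval W (\<lambda>s. s) u = word_eval W (\<lambda>s. s) v"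
  by (auto simp: coxeter_relations_def word_eval_concat_replicate prd_alternating)

lemma positive_eval_cong_prd:
  assumes "group G" "f \<in> S \<rightarrow> carrier G"
    and rel: "\<And>s t. s \<in> S \<Longrightarrow> t \<in> S \<Longrightarrow>
      positive_eval G f (alternating (2 * ord (s \<otimes> t)) s t) = \<one>\<^bsub>G\<^esub>"
    and "set us \<subseteq> S" "set vs \<subseteq> S" "prd us = prd vs"
  shows "positive_eval G f us = positive_eval G f vs"
proof -
  interpret presentation S "coxeter_relations W S" by (rule presentation_coxeter)
  let ?c = "\<lambda>ws. word_class S (coxeter_relations W S) (map (\<lambda>s. (s, True)) ws)"
  have words: "map (\<lambda>s. (s, True)) us \<in> words" "map (\<lambda>s. (s, True)) vs \<in> words"
    using assms by auto
  have "presented_hom W (\<lambda>s. s) (?c us) = presented_hom W (\<lambda>s. s) (?c vs)"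
    using assms words by (subst (1 2) presented_hom_word_class)
      (auto simp: is_group dest: coxeter_relations_hold)
  moreover have "inj_on (presented_hom W (\<lambda>s. s)) (carrier (presented_group S (coxeter_relations W S)))"
    using coxeter_system by (auto simp: coxeter_system_def iso_def bij_betw_def)
  ultimately have "presentation_eq S (coxeter_relations W S)
      (map (\<lambda>s. (s, True)) us) (map (\<lambda>s. (s, True)) vs)"
    using words by (simp add: word_class_eq_iff inj_on_eq_iff del: in_lists_conv_set)
  moreover have "word_eval G f u = word_eval G f v" if "(u, v) \<in> coxeter_relations W S" for u v
    using that rel by (auto simp: coxeter_relations_def word_eval_concat_replicate)
  ultimately show ?thesis
    using presentation_eq_word_eval[OF assms(1,2) relators] words(1) by blast
qed

lemma count_conj:
  assumes "set rs \<subseteq> carrier W" "b \<in> carrier W" "r \<in> carrier W"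
  shows "count_list (map (\<lambda>r. inv b \<otimes> r \<otimes> b) rs) r = count_list rs (b \<otimes> r \<otimes> inv b)"
  using assms by (induction rs) (auto simp: conj_eq_iff)

lemma even_count_alternating:
  assumes "s \<in> S" "t \<in> S"
  shows "even (count_list (reflections W (alternating (2 * ord (s \<otimes> t)) s t)) r)"
proof -
  let ?m = "ord (s \<otimes> t)"
  let ?C = "\<lambda>i. (t \<otimes> s) [^] i \<otimes> t"
  \<comment> \<open>The reflections are periodic, and the word contains exactly two periods.\<close>
  have C: "?C (i + ?m) = ?C i" for i
    using assms pow_ord_eq_1[of "t \<otimes> s"]
    by (simp add: ord_generators_commute[of t s] flip: nat_pow_mult)
  have "map ?C [0..<2 * ?m] = map ?C [0..<?m] @ map ?C [?m..<?m + ?m]"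
    using upt_add_eq_append[of 0 ?m ?m] by (simp add: mult_2)
  also have "map ?C [?m..<?m + ?m] = map ?C (map (\<lambda>i. i + ?m) [0..<?m])"
    by (simp only: map_add_upt)
  also have "\<dots> = map ?C [0..<?m]"
    using C by simp
  finally show ?thesis
    using assms by (simp add: reflections_alternating Let_def count_list_rev rev_map[symmetric])
qed

text \<open>The parity of the number of occurrences of \<open>r\<close> is an \<open>\<int>/2\<close>-valued cocycle on \<open>W\<close>: this is
  the only place where the Coxeter presentation of \<open>W\<close> enters.\<close>

lemma odd_count_reflections_cong:
  assumes "set us \<subseteq> S" "set vs \<subseteq> S" "prd us = prd vs"
  shows "odd (count_list (reflections W us) r) \<longleftrightarrow> odd (count_list (reflections W vs) r)"
proof (cases "r \<in> carrier W")
  case False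
  then have "r \<notin> set (reflections W us)" "r \<notin> set (reflections W vs)"
    using assms reflections_closed by blast+
  then show ?thesis
    by simp
next
  case r: True
  let ?P = "wreath_product W (carrier W) (\<lambda>w r. w \<otimes> r \<otimes> inv w) xor_group"
  define \<delta> where "\<delta> = (\<lambda>s. \<lambda>r \<in> carrier W. r = s)"
  define n where "n = (\<lambda>ws. \<lambda>r \<in> carrier W. odd (count_list (reflections W ws) r))"
  let ?f = "\<lambda>s. (s, \<delta> s)"
  have P: "group ?P"
    by (rule group_wreath_product) (auto simp: is_group group_xor_group cancel_simps)
  have f: "?f \<in> S \<rightarrow> carrier ?P"
    by (auto simp: wreath_product_def xor_group_def \<delta>_def)
  have eval: "positive_eval ?P ?f ws = (prd ws, n ws)"
    if "set ws \<subseteq> S" for ws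
    using that
  proof (induction ws)
    case Nil
    then show ?case by (auto simp: n_def wreath_product_def xor_group_def)
  next
    case (Cons s ws)
    then have closed: "s \<in> carrier W" "prd ws \<in> carrier W" by auto
    have "(\<lambda>r \<in> carrier W. \<delta> s (prd ws \<otimes> r \<otimes> inv prd ws) \<noteq> n ws r) = n (s # ws)"
      using closed conj_eq_iff[of "prd ws" s] unfolding \<delta>_def n_def
      by (intro restrict_ext) (auto simp: Let_def)
    with Cons show ?case
      by (simp add: wreath_product_def xor_group_def)
  qed
  have "positive_eval ?P ?f (alternating (2 * ord (s \<otimes> t)) s t) = \<one>\<^bsub>?P\<^esub>"
    if "s \<in> S" "t \<in> S" for s t
    using that set_alternating[of "2 * ord (s \<otimes> t)" s t]
    by (subst eval) (auto simp: even_count_alternating prd_alternating n_def wreath_product_def xor_group_def)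
  from positive_eval_cong_prd[OF P f this assms] have "n us r = n vs r"
    using assms by (simp add: eval)
  then show ?thesis
    using r by (simp add: n_def)
qed

text \<open>These are the reflections \<open>r\<close> for which \<open>w \<otimes> r\<close> is shorter than \<open>w\<close>. The description by parities
  gives the rule for products, \<open>inversions_mult\<close>.\<close>

definition inversions :: "'w \<Rightarrow> 'w set" where
  "inversions w = {r. \<exists>ws. set ws \<subseteq> S \<and> prd ws = w \<and> odd (count_list (reflections W ws) r)}"

lemma mem_inversions_prd:
  "set ws \<subseteq> S \<Longrightarrow> r \<in> inversions (prd ws) \<longleftrightarrow> odd (count_list (reflections W ws) r)"
  unfolding inversions_def mem_Collect_eq using odd_count_reflections_cong by metis

lemma odd_count_mem: "odd (count_list rs r) \<Longrightarrow> r \<in> set rs"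
  by (metis count_notin even_zero)

lemma inversions_prd_subset: "set ws \<subseteq> S \<Longrightarrow> inversions (prd ws) \<subseteq> set (reflections W ws)"
  by (rule subsetI, rule odd_count_mem) (simp add: mem_inversions_prd)

lemma inversions_closed: "inversions w \<subseteq> carrier W"
proof
  fix r
  assume "r \<in> inversions w"
  then obtain ws where "set ws \<subseteq> S" "odd (count_list (reflections W ws) r)"
    by (auto simp: inversions_def)
  then show "r \<in> carrier W"
    using odd_count_mem[of "reflections W ws" r] reflections_closed[of ws] by auto
qed

lemma finite_inversions: "finite (inversions w)"
  using inversions_closed finite_carrier finite_subset by blast

lemma generate_word:
  assumes "J \<subseteq> S" "w \<in> generate W J"
  shows "\<exists>ws. set ws \<subseteq> J \<and> prd ws = w"
  using assms(2)
proof induction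
  case one
  show ?case by (intro exI[of _ "[]"]) simp
next
  case (incl h)
  then show ?case using assms by (intro exI[of _ "[h]"]) auto
next
  case (inv h)
  then have "h \<in> S" using assms by auto
  with inv show ?case by (intro exI[of _ "[h]"]) auto
next
  case (eng h1 h2)
  then obtain us vs where "set us \<subseteq> J" "prd us = h1" "set vs \<subseteq> J" "prd vs = h2" by blast
  then show ?case using assms by (intro exI[of _ "us @ vs"]) (auto simp: prd_append simp del: map_append)
qed

lemma word_exists: "w \<in> carrier W \<Longrightarrow> \<exists>ws. set ws \<subseteq> S \<and> prd ws = w"
  using generate_word[of S w] coxeter_system by (simp add: coxeter_system_def)

lemma inversions_mult:
  assumes "a \<in> carrier W" "b \<in> carrier W" "r \<in> carrier W"
  shows "r \<in> inversions (a \<otimes> b) \<longleftrightarrow> (b \<otimes> r \<otimes> inv b \<in> inversions a) \<noteq> (r \<in> inversions b)"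
proof -
  obtain us vs where w: "set us \<subseteq> S" "prd us = a" "set vs \<subseteq> S" "prd vs = b"
    using word_exists assms by metis
  then have "r \<in> inversions (a \<otimes> b) \<longleftrightarrow> odd (count_list (reflections W (us @ vs)) r)"
    using mem_inversions_prd[of "us @ vs" r] by (simp add: prd_append del: map_append)
  then show ?thesis
    using w assms mem_inversions_prd[of us] mem_inversions_prd[of vs]
    by (auto simp: reflections_append count_conj reflections_closed)
qed

lemma inversions_one [simp]: "inversions \<one> = {}"
  using mem_inversions_prd[of "[]"] by auto

lemma inversions_generator:
  assumes "s \<in> S"
  shows "inversions s = {s}"
proof (rule Set.set_eqI)
  show "r \<in> inversions s \<longleftrightarrow> r \<in> {s}" for r
    using assms mem_inversions_prd[of "[s]" r] by (simp add: Let_def split: if_splits)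
qed

lemma inversions_generator_mult:
  assumes "s \<in> S" "w \<in> carrier W" "r \<in> carrier W"
  shows "r \<in> inversions (s \<otimes> w) \<longleftrightarrow> (r = inv w \<otimes> s \<otimes> w) \<noteq> (r \<in> inversions w)"
  using assms conj_eq_iff[of w s r] by (auto simp: inversions_mult inversions_generator)


subsection \<open>Reduced words\<close>

text \<open>Every word for \<open>w\<close> has at least \<open>card (inversions w)\<close> letters, and this bound is attained exactly
  by the words with distinct reflections; so these are the words of minimal length.\<close>

definition reduced :: "'w list \<Rightarrow> bool" where
  "reduced ws \<longleftrightarrow> set ws \<subseteq> S \<and> distinct (reflections W ws)"

lemma inversions_reduced:
  assumes "reduced ws"
  shows "inversions (prd ws) = set (reflections W ws)"
proof -
  have "odd (count_list rs r) \<longleftrightarrow> r \<in> set rs" if "distinct rs" for rs and r :: 'w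
    using that by (induction rs) auto
  then show ?thesis
    using assms by (auto simp: reduced_def mem_inversions_prd)
qed

lemma reduced_iff_length:
  assumes "set ws \<subseteq> S"
  shows "reduced ws \<longleftrightarrow> length ws = card (inversions (prd ws))"
proof
  assume "reduced ws"
  then show "length ws = card (inversions (prd ws))"
    by (auto simp: inversions_reduced reduced_def distinct_card)
next
  assume "length ws = card (inversions (prd ws))"
  then have "length (reflections W ws) \<le> card (set (reflections W ws))"
    using assms inversions_prd_subset[of ws] by (simp add: card_mono)
  then show "reduced ws"
    using assms card_length[of "reflections W ws"] by (auto simp: reduced_def intro: card_distinct)
qed

lemma reduced_ConsD: "reduced (s # ws) \<Longrightarrow> s \<in> S \<and> reduced ws"
  by (auto simp: reduced_def Let_def)

lemma reduced_Cons:
  assumes "s \<in> S" "reduced ws"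
  shows "reduced (s # ws) \<longleftrightarrow> inv (prd ws) \<otimes> s \<otimes> prd ws \<notin> inversions (prd ws)"
  using assms inversions_reduced[OF assms(2)] by (auto simp: reduced_def Let_def)

lemma left_descent_reduced_Cons:
  assumes "reduced (s # ws)"
  defines "p \<equiv> prd (s # ws)"
  shows "inv p \<otimes> s \<otimes> p \<in> inversions p"
proof -
  have S: "s \<in> S" "set ws \<subseteq> S" using assms by (auto simp: reduced_def)
  then have "inv p \<otimes> s \<otimes> p = inv (prd ws) \<otimes> s \<otimes> prd ws"
    by (simp add: p_def cancel_simps generator_cancel_left)
  then show ?thesis
    using assms inversions_reduced[OF assms(1)] by (simp add: Let_def)
qed

lemma delete_letter:
  assumes "set ws \<subseteq> S" "r \<in> set (reflections W ws)"
  shows "\<exists>us t vs. ws = us @ t # vs \<and> prd ws \<otimes> r = prd (us @ vs)"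
  using assms
proof (induction ws)
  case (Cons s ws)
  show ?case
  proof (cases "r \<in> set (reflections W ws)")
    case True
    then obtain us t vs where ws: "ws = us @ t # vs" "prd ws \<otimes> r = prd (us @ vs)"
      using Cons by auto
    have "r \<in> carrier W" using Cons True reflections_closed[of ws] by auto
    then have "prd (s # ws) \<otimes> r = s \<otimes> (prd ws \<otimes> r)"
      using Cons.prems(1) by (simp add: m_assoc)
    also have "\<dots> = prd ((s # us) @ vs)"
      by (simp add: ws(2))
    finally have "prd (s # ws) \<otimes> r = prd ((s # us) @ vs)" .
    then show ?thesis
      using ws by (intro exI[of _ "s # us"]) auto
  next
    case False
    with Cons have "r = inv (prd ws) \<otimes> s \<otimes> prd ws" by (simp add: Let_def)
    with Cons have "prd (s # ws) \<otimes> r = prd ([] @ ws)"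
      by (simp add: cancel_simps generator_cancel_left)
    then show ?thesis by (intro exI[of _ "[]"]) auto
  qed
qed simp

text \<open>If \<open>ws\<close> is reduced with product \<open>p\<close> and \<open>s # ws\<close> is not, then \<open>r = p\<inverse> s p\<close> is a reflection of \<open>ws\<close>,
  and \<open>s p = p r\<close> arises from \<open>ws\<close> by deleting a letter.\<close>

lemma shorten_word:
  assumes "J \<subseteq> S" "set ws \<subseteq> J" "\<not> reduced ws"
  shows "\<exists>us. set us \<subseteq> J \<and> length us < length ws \<and> prd us = prd ws"
  using assms(2,3)
proof (induction ws)
  case Nil
  then show ?case by (simp add: reduced_def)
next
  case (Cons s ws)
  have S: "s \<in> S" "set ws \<subseteq> S" using Cons assms by auto
  show ?case
  proof (cases "reduced ws")
    case False
    then obtain us where "set us \<subseteq> J" "length us < length ws" "prd us = prd ws"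
      using Cons by auto
    then show ?thesis
      using Cons by (intro exI[of _ "s # us"]) auto
  next
    case True
    define r where "r = inv (prd ws) \<otimes> s \<otimes> prd ws"
    have "r \<in> set (reflections W ws)"
      using Cons.prems True S by (auto simp: reduced_def Let_def r_def)
    then obtain us t vs where ws: "ws = us @ t # vs" "prd ws \<otimes> r = prd (us @ vs)"
      using delete_letter[of ws r] S by auto
    moreover have "prd ws \<otimes> r = prd (s # ws)"
      using S by (simp add: r_def cancel_simps)
    ultimately show ?thesis
      using Cons.prems by (intro exI[of _ "us @ vs"]) auto
  qed
qed

lemma reduced_word_exists:
  assumes "J \<subseteq> S" "set ws \<subseteq> J"
  shows "\<exists>us. set us \<subseteq> J \<and> reduced us \<and> prd us = prd ws"
  using assms(2)
proof (induction ws rule: measure_induct_rule[where f = length])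
  case (less ws)
  then show ?case
    using shorten_word[OF assms(1), of ws] by metis
qed

lemma generate_reduced_word:
  assumes "J \<subseteq> S" "w \<in> generate W J"
  shows "\<exists>ws. set ws \<subseteq> J \<and> reduced ws \<and> prd ws = w"
  using generate_word[OF assms] reduced_word_exists[OF assms(1)] by metis

lemma carrier_reduced_word: "w \<in> carrier W \<Longrightarrow> \<exists>ws. reduced ws \<and> prd ws = w"
  using generate_reduced_word[of S w] coxeter_system by (auto simp: coxeter_system_def)

lemma prd_in_generate: "J \<subseteq> S \<Longrightarrow> set ws \<subseteq> J \<Longrightarrow> prd ws \<in> generate W J"
  by (induction ws) (auto intro: generate.intros)

lemma reflections_in_generate:
  assumes "J \<subseteq> S" "set ws \<subseteq> J"
  shows "set (reflections W ws) \<subseteq> generate W J"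
proof -
  interpret subgroup "generate W J" W
    using assms by (intro generate_is_subgroup) auto
  show ?thesis
    using assms(2) prd_in_generate[OF assms(1)]
    by (induction ws) (auto simp: Let_def generate.incl)
qed


subsection \<open>Matsumoto's theorem\<close>

text \<open>If an element has two left descents \<open>s\<close> and \<open>t\<close>, then it has reduced words that start with
  arbitrarily long alternating words, up to length \<open>ord (s \<otimes> t)\<close>. In the induction step, the
  exchange condition deletes a letter; it cannot lie in the alternating prefix, since this prefix
  remains reduced when it is extended.\<close>

lemma reduced_alternating_prefix:
  assumes "J \<subseteq> S" "s \<in> J" "t \<in> J"
    and w: "set ws \<subseteq> J" "reduced ws" "prd ws = p"
    and "inv p \<otimes> s \<otimes> p \<in> inversions p" "inv p \<otimes> t \<otimes> p \<in> inversions p"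
    and "n \<le> ord (s \<otimes> t)"
  shows "\<exists>rest. set rest \<subseteq> J \<and> reduced (alternating n s t @ rest) \<and> prd (alternating n s t @ rest) = p"
  using assms
proof (induction n arbitrary: s t)
  case 0
  then show ?case by auto
next
  case (Suc n)
  have S: "s \<in> S" "t \<in> S" using Suc by auto
  then obtain rest where rest: "set rest \<subseteq> J" "reduced (alternating n t s @ rest)"
      "prd (alternating n t s @ rest) = p"
    using Suc.IH[of t s] Suc.prems by (auto simp: ord_generators_commute simp del: map_append)
  let ?a = "alternating n t s"
  have a: "set ?a \<subseteq> S" and r: "set rest \<subseteq> S"
    using S set_alternating[of n t s] rest Suc.prems by auto
  have p: "p = prd ?a \<otimes> prd rest"
    using rest a r by (simp add: prd_append del: map_append)
  \<comment> \<open>Conjugation by the product of \<open>rest\<close> turns the reflection of the new first letter into \<open>r'\<close>.\<close>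
  define r' where "r' = inv (prd ?a) \<otimes> s \<otimes> prd ?a"
  have r': "r' \<in> carrier W" using S a by (simp add: r'_def)
  have conj: "inv p \<otimes> s \<otimes> p = inv (prd rest) \<otimes> r' \<otimes> prd rest"
    using S a r by (simp add: p r'_def cancel_simps)
  have "r' \<notin> set (reflections W ?a)"
    using distinct_reflections_alternating[OF S, of "Suc n"] Suc.prems by (simp add: Let_def r'_def)
  then have "inv (prd rest) \<otimes> r' \<otimes> prd rest
      \<notin> set (map (\<lambda>r. inv (prd rest) \<otimes> r \<otimes> prd rest) (reflections W ?a))"
    using reflections_closed[OF a] r' r by auto
  moreover have "inv p \<otimes> s \<otimes> p \<in> set (reflections W (?a @ rest))"
    using inversions_reduced[OF rest(2)] rest(3) Suc.prems by simp
  ultimately have "inv p \<otimes> s \<otimes> p \<in> set (reflections W rest)"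
    using a r by (simp add: reflections_append conj)
  then obtain us u vs where rest': "rest = us @ u # vs"
      and del: "prd rest \<otimes> (inv p \<otimes> s \<otimes> p) = prd (us @ vs)"
    using delete_letter[OF r] by blast
  let ?w = "alternating (Suc n) s t @ us @ vs"
  have uv: "set (us @ vs) \<subseteq> S" using r rest' by auto
  have w: "set ?w \<subseteq> S"
    using a uv S by auto
  have "prd ?w = s \<otimes> prd ?a \<otimes> (prd rest \<otimes> (inv p \<otimes> s \<otimes> p))"
    unfolding del using S a uv by (simp add: prd_append m_assoc del: map_append)
  also have "\<dots> = s \<otimes> p \<otimes> (inv p \<otimes> s \<otimes> p)"
    using S a r by (simp add: p cancel_simps)
  also have "\<dots> = p"
    using S a r by (simp add: p cancel_simps generator_cancel_left)
  finally have pw: "prd ?w = p" .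
  then have "reduced ?w"
    using w rest rest' reduced_iff_length[of ?w] reduced_iff_length[of "?a @ rest"] a r by auto
  then show ?case
    using pw rest rest' by (intro exI[of _ "us @ vs"]) auto
qed

text \<open>The only case of substance is that of two words with different first letters \<open>s\<close> and \<open>t\<close>. Their
  product then also has reduced words that start with the two alternating words of length
  \<open>ord (s \<otimes> t)\<close> and agree afterwards. These are related by a braid relation, and each of them has
  the same first letter as one of the given words, which allows induction on the length.\<close>

theorem matsumoto:
  assumes "group G" "J \<subseteq> S" "f \<in> J \<rightarrow> carrier G"
    and braid: "\<And>s t. s \<in> J \<Longrightarrow> t \<in> J \<Longrightarrow> s \<noteq> t \<Longrightarrow>
      positive_eval G f (alternating (ord (s \<otimes> t)) s t) = positive_eval G f (alternating (ord (s \<otimes> t)) t s)"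
    and "set us \<subseteq> J" "set vs \<subseteq> J" "reduced us" "reduced vs" "prd us = prd vs"
  shows "positive_eval G f us = positive_eval G f vs"
  using assms(5-9)
proof (induction "length us" arbitrary: us vs)
  case 0
  then show ?case using reduced_iff_length[of us] reduced_iff_length[of vs] assms(2) by auto
next
  case (Suc n)
  interpret G: group G by fact
  have len: "length ws = Suc n" if "reduced ws" "prd ws = prd us" for ws
    using that Suc reduced_iff_length by (metis reduced_def)
  have same_head: "positive_eval G f (x # xs) = positive_eval G f (x # ys)"
    if "reduced (x # xs)" "reduced (x # ys)" "set (x # xs) \<subseteq> J" "set (x # ys) \<subseteq> J"
      "prd (x # xs) = prd us" "prd (x # ys) = prd us" for x xs ys
  proof -
    have "set xs \<subseteq> S" "set ys \<subseteq> S" "x \<in> S" using that assms(2) by auto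
    moreover have "x \<otimes> prd xs = x \<otimes> prd ys" using that(5,6) by simp
    ultimately have "prd xs = prd ys" by simp
    then have "positive_eval G f xs = positive_eval G f ys"
      using that len[of "x # xs"] reduced_ConsD by (intro Suc.hyps) auto
    then show ?thesis by simp
  qed
  obtain s us' where us: "us = s # us'" using Suc by (cases us) auto
  obtain t vs' where vs: "vs = t # vs'" using len[of vs] Suc by (cases vs) auto
  define p where "p = prd us"
  have st: "s \<in> J" "t \<in> J" "s \<in> S" "t \<in> S" using Suc us vs assms(2) by auto
  show ?case
  proof (cases "s = t")
    case True
    then show ?thesis using same_head[of s us' vs'] Suc us vs by auto
  next
    case False
    let ?m = "ord (s \<otimes> t)"
    obtain m' where m': "?m = Suc m'" using ord_generators_pos[of s t] st by (cases ?m) auto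
    have desc: "inv p \<otimes> s \<otimes> p \<in> inversions p" "inv p \<otimes> t \<otimes> p \<in> inversions p"
      using left_descent_reduced_Cons[of s us'] left_descent_reduced_Cons[of t vs'] Suc us vs
      by (simp_all add: p_def)
    obtain rest where rest: "set rest \<subseteq> J" "reduced (alternating ?m s t @ rest)"
        "prd (alternating ?m s t @ rest) = p"
      using reduced_alternating_prefix[OF assms(2) st(1,2) Suc.prems(1,3) _ desc] by (auto simp: p_def)
    have alt: "set (alternating ?m s t) \<subseteq> J" "set (alternating ?m t s) \<subseteq> J"
      using set_alternating[of ?m s t] set_alternating[of ?m t s] st by auto
    then have alt': "set (alternating ?m s t) \<subseteq> S" "set (alternating ?m t s) \<subseteq> S" "set rest \<subseteq> S"
      using assms(2) rest by auto
    have prd2: "prd (alternating ?m t s @ rest) = p"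
      using rest alt' st by (simp add: prd_append prd_alternating_braid[OF st(3,4)] del: map_append)
    then have red2: "reduced (alternating ?m t s @ rest)"
      using rest alt' reduced_iff_length[of "alternating ?m s t @ rest"]
        reduced_iff_length[of "alternating ?m t s @ rest"] by auto
    have "positive_eval G f us = positive_eval G f (alternating ?m s t @ rest)"
      unfolding us m' alternating.simps append_Cons
      using Suc.prems us rest m' st alt by (intro same_head) (auto simp: p_def)
    also have "\<dots> = positive_eval G f (alternating ?m t s @ rest)"
      using braid[OF st(1,2) False] positive_eval_append[OF assms(1,3) _ rest(1)] alt by simp
    also have "\<dots> = positive_eval G f vs"
      unfolding vs m' alternating.simps append_Cons
      using Suc.prems vs rest m' st alt red2 prd2 by (intro same_head) (auto simp: p_def)
    finally show ?thesis .
  qed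
qed

end

section \<open>Braid groups and positive braids\<close>

lemma presentation_braid: "presentation S (braid_relations W S)"
proof
  have "r \<in> S" if "r \<in> set (alternating n s t)" "s \<in> S" "t \<in> S" for n r s t
    using that set_alternating[of n s t] by auto
  then show "braid_relations W S \<subseteq> lists (S \<times> UNIV) \<times> lists (S \<times> UNIV)"
    by (auto simp: braid_relations_def alternating_word_eq)
qed

lemma group_braid_group: "group (braid_group W S)"
  unfolding braid_group_def by (rule presentation.group_presented_group[OF presentation_braid])

lemma braid_generator_closed: "braid_generator W S \<in> S \<rightarrow> carrier (braid_group W S)"
  unfolding braid_generator_def braid_group_def
  by (auto intro!: presentation.word_class_in[OF presentation_braid])

lemma braid_generator_braid:
  assumes "s \<in> S" "t \<in> S" "s \<noteq> t" "group.ord W (s \<otimes>\<^bsub>W\<^esub> t) \<noteq> 0"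
  defines "m \<equiv> group.ord W (s \<otimes>\<^bsub>W\<^esub> t)"
  shows "positive_eval (braid_group W S) (braid_generator W S) (alternating m s t)
    = positive_eval (braid_group W S) (braid_generator W S) (alternating m t s)"
proof -
  interpret presentation S "braid_relations W S" by (rule presentation_braid)
  have rel: "(map (\<lambda>s. (s, True)) (alternating m s t), map (\<lambda>s. (s, True)) (alternating m t s))
      \<in> braid_relations W S"
    using assms by (auto simp: braid_relations_def alternating_word_eq)
  then have "map (\<lambda>s. (s, True)) (alternating m s t) \<in> words"
      "map (\<lambda>s. (s, True)) (alternating m t s) \<in> words"
    using relators by blast+
  then show ?thesis
    using presentation_eq.relation[OF rel, of S]
    by (simp only: braid_group_def braid_generator_def[abs_def] word_eval_generators word_class_eq_iff)
qed

lemma braid_hom: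
  assumes "group G" "f \<in> S \<rightarrow> carrier G"
    and "\<And>s t. s \<in> S \<Longrightarrow> t \<in> S \<Longrightarrow> s \<noteq> t \<Longrightarrow> group.ord W (s \<otimes>\<^bsub>W\<^esub> t) \<noteq> 0 \<Longrightarrow>
      positive_eval G f (alternating (group.ord W (s \<otimes>\<^bsub>W\<^esub> t)) s t)
      = positive_eval G f (alternating (group.ord W (s \<otimes>\<^bsub>W\<^esub> t)) t s)"
  shows "presented_hom G f \<in> hom (braid_group W S) G"
    and "s \<in> S \<Longrightarrow> presented_hom G f (braid_generator W S s) = f s"
proof -
  interpret presentation S "braid_relations W S" by (rule presentation_braid)
  interpret G: group G by fact
  have rel: "word_eval G f u = word_eval G f v" if "(u, v) \<in> braid_relations W S" for u v
    using that assms(3) by (auto simp: braid_relations_def alternating_word_eq)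
  show "presented_hom G f \<in> hom (braid_group W S) G"
    unfolding braid_group_def by (rule presented_hom_hom[OF assms(1,2) rel])
  show "presented_hom G f (braid_generator W S s) = f s" if "s \<in> S"
    using that assms(2)
    by (auto simp: Pi_iff braid_generator_def presented_hom_word_class[OF assms(1,2) rel])
qed

text \<open>The flag allows the two cases of the equivalence to be treated together.\<close>

definition braid_part :: "'w monoid \<Rightarrow> 'w set \<Rightarrow> bool \<Rightarrow> 'w group_word set monoid" where
  "braid_part W S pos = (if pos then braid_monoid W S else braid_group W S)"

lemma mult_braid_part [simp]: "mult (braid_part W S pos) = mult (braid_group W S)"
  by (simp add: braid_part_def braid_monoid_def)

lemma one_braid_part [simp]: "one (braid_part W S pos) = one (braid_group W S)"
  by (simp add: braid_part_def braid_monoid_def)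

lemma submonoid_carrier_braid_group: "submonoid (carrier (braid_group W S)) (braid_group W S)"
proof -
  interpret group "braid_group W S" by (rule group_braid_group)
  show ?thesis by standard auto
qed

lemma submonoid_braid_part: "submonoid (carrier (braid_part W S pos)) (braid_group W S)"
proof -
  have 1: "braid_generator W S ` S \<subseteq> carrier (braid_group W S)"
    using braid_generator_closed[of W S] by (auto simp: Pi_iff)
  let ?H = "{H. submonoid H (braid_group W S) \<and> braid_generator W S ` S \<subseteq> H}"
  have "submonoid (\<Inter>?H) (braid_group W S)"
  proof
    show "\<Inter>?H \<subseteq> carrier (braid_group W S)"
      using submonoid_carrier_braid_group[of W S] 1 by (intro Inter_lower) simp
  next
    fix x y
    assume "x \<in> \<Inter>?H" "y \<in> \<Inter>?H"
    then show "x \<otimes>\<^bsub>braid_group W S\<^esub> y \<in> \<Inter>?H"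
      by (auto intro: submonoid.m_closed)
  next
    show "\<one>\<^bsub>braid_group W S\<^esub> \<in> \<Inter>?H"
      by (auto intro: submonoid.one_closed)
  qed
  then show ?thesis
    using submonoid_carrier_braid_group[of W S] by (simp add: braid_part_def braid_monoid_def)
qed

lemma braid_part_subset: "carrier (braid_part W S pos) \<subseteq> carrier (braid_group W S)"
  by (rule submonoid.subset[OF submonoid_braid_part])

lemma braid_part_one_closed: "\<one>\<^bsub>braid_group W S\<^esub> \<in> carrier (braid_part W S pos)"
  by (rule submonoid.one_closed[OF submonoid_braid_part])

lemma braid_part_mult_closed:
  "a \<in> carrier (braid_part W S pos) \<Longrightarrow> b \<in> carrier (braid_part W S pos) \<Longrightarrow>
    a \<otimes>\<^bsub>braid_group W S\<^esub> b \<in> carrier (braid_part W S pos)"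
  by (rule submonoid.m_closed[OF submonoid_braid_part])

lemma braid_generator_in_part: "s \<in> S \<Longrightarrow> braid_generator W S s \<in> carrier (braid_part W S pos)"
  using braid_generator_closed[of W S] by (auto simp: braid_part_def braid_monoid_def)

lemma braid_part_inv_closed:
  "\<not> pos \<Longrightarrow> a \<in> carrier (braid_part W S pos) \<Longrightarrow>
    inv\<^bsub>braid_group W S\<^esub> a \<in> carrier (braid_part W S pos)"
  using group.inv_closed[OF group_braid_group] by (simp add: braid_part_def)

text \<open>For positive braids this is the minimality of the monoid that the generators generate; for the
  group, it is an induction on signed words.\<close>

lemma braid_part_induct [consumes 1, case_names one generator mult inv]:
  assumes "b \<in> carrier (braid_part W S pos)"
    and one: "P \<one>\<^bsub>braid_group W S\<^esub>"
    and generator: "\<And>s. s \<in> S \<Longrightarrow> P (braid_generator W S s)"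
    and mult: "\<And>a b. a \<in> carrier (braid_part W S pos) \<Longrightarrow> b \<in> carrier (braid_part W S pos) \<Longrightarrow>
      P a \<Longrightarrow> P b \<Longrightarrow> P (a \<otimes>\<^bsub>braid_group W S\<^esub> b)"
    and inv: "\<And>a. \<not> pos \<Longrightarrow> a \<in> carrier (braid_part W S pos) \<Longrightarrow> P a \<Longrightarrow>
      P (inv\<^bsub>braid_group W S\<^esub> a)"
  shows "P b"
proof (cases pos)
  case True
  let ?H = "{b \<in> carrier (braid_part W S pos). P b}"
  have "submonoid ?H (braid_group W S)"
    by standard (use braid_part_subset one mult braid_part_one_closed braid_part_mult_closed in blast)+
  moreover have "braid_generator W S ` S \<subseteq> ?H"
    using generator by (auto simp: braid_generator_in_part)
  ultimately have "carrier (braid_part W S pos) \<subseteq> ?H"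
    using True by (simp add: braid_part_def braid_monoid_def Inter_lower)
  with assms(1) show ?thesis by auto
next
  case False
  interpret presentation S "braid_relations W S" by (rule presentation_braid)
  interpret B: group "braid_group W S" by (rule group_braid_group)
  obtain u where u: "u \<in> words" "b = word_class S (braid_relations W S) u"
    using assms(1) False presented_group_carrierE by (auto simp: braid_part_def braid_group_def)
  have "P (word_eval (braid_group W S) (braid_generator W S) u)"
    using u(1)
  proof (induction u)
    case (Cons l u)
    obtain s e where l: "l = (s, e)" by (cases l)
    with Cons have s: "s \<in> S" by auto
    then have g: "braid_generator W S s \<in> carrier (braid_part W S pos)"
      by (rule braid_generator_in_part)
    have "word_eval (braid_group W S) (braid_generator W S) u \<in> carrier (braid_part W S pos)"
      using word_eval_closed[OF group_braid_group braid_generator_closed] Cons False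
      by (auto simp: braid_part_def)
    then show ?case
      using Cons l s g False
      by (auto intro!: mult generator inv braid_part_inv_closed simp del: in_lists_conv_set)
  qed (simp add: one)
  then show ?thesis
    using u word_eval_generators[OF u(1)] by (simp add: braid_group_def braid_generator_def[abs_def])
qed

lemma positive_eval_in_part:
  assumes "set ws \<subseteq> S"
  shows "positive_eval (braid_group W S) (braid_generator W S) ws \<in> carrier (braid_part W S pos)"
  using assms
  by (induction ws) (auto intro: braid_part_one_closed braid_part_mult_closed braid_generator_in_part)


section \<open>Minimal representatives of parabolic cosets\<close>

locale parabolic_coxeter = finite_coxeter W S
  for W :: "'w monoid" (structure) and S :: "'w set" +
  fixes J :: "'w set"
  assumes J_subset: "J \<subseteq> S"
begin

abbreviation "WJ \<equiv> generate W J"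
abbreviation "X \<equiv> coset_space W J"
abbreviation "x\<^sub>0 \<equiv> base_coset W J"

sublocale WJ: subgroup WJ W
  using J_subset by (intro generate_is_subgroup) auto

lemma cosetE:
  assumes "x \<in> X"
  obtains w where "w \<in> carrier W" "x = w <# WJ"
  using assms by (auto simp: LCOSETS_def)

lemma coset_in [simp]: "w \<in> carrier W \<Longrightarrow> w <# WJ \<in> X"
  by (auto simp: LCOSETS_def)

lemma base_coset_in [simp]: "x\<^sub>0 \<in> X"
  by simp

lemma coset_act_mult:
  "a \<in> carrier W \<Longrightarrow> b \<in> carrier W \<Longrightarrow> x \<in> X \<Longrightarrow> (a \<otimes> b) <# x = a <# (b <# x)"
  by (elim cosetE) (simp add: lcos_m_assoc WJ.subset m_assoc)

lemma coset_act_closed [simp]: "w \<in> carrier W \<Longrightarrow> x \<in> X \<Longrightarrow> w <# x \<in> X"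
  by (elim cosetE) (simp add: lcos_m_assoc WJ.subset)

lemma coset_act_one [simp]: "x \<in> X \<Longrightarrow> \<one> <# x = x"
  by (elim cosetE) (simp add: lcos_m_assoc WJ.subset)

lemma coset_act_inv: 
  assumes "w \<in> carrier W" "x \<in> X"
  shows "inv w <# (w <# x) = x" "w <# (inv w <# x) = x"
  using assms coset_act_mult[of "inv w" w x] coset_act_mult[of w "inv w" x] by simp_all

lemma coset_act_inj:
  "w \<in> carrier W \<Longrightarrow> x \<in> X \<Longrightarrow> y \<in> X \<Longrightarrow> w <# x = w <# y \<longleftrightarrow> x = y"
  by (metis coset_act_inv(1))

lemma finite_cosets: "finite X"
  using finite_carrier by (auto simp: LCOSETS_def)

lemma coset_eq_iff:
  assumes "a \<in> carrier W" "b \<in> carrier W"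
  shows "a <# WJ = b <# WJ \<longleftrightarrow> inv a \<otimes> b \<in> WJ"
proof
  assume "a <# WJ = b <# WJ"
  then have "b \<in> a <# WJ" using lcos_self[OF assms(2)] WJ.subgroup_axioms by simp
  then show "inv a \<otimes> b \<in> WJ" using WJ.lcos_module_imp[OF is_group assms(1)] by simp
next
  assume "inv a \<otimes> b \<in> WJ"
  then have "b \<in> a <# WJ" using WJ.lcos_module_rev[OF is_group] assms by blast
  then show "a <# WJ = b <# WJ"
    using l_repr_independence[of b a WJ] assms WJ.subgroup_axioms by simp
qed

lemma card_inversions_le: "set ws \<subseteq> S \<Longrightarrow> card (inversions (prd ws)) \<le> length ws"
  using inversions_prd_subset[of ws] card_length[of "reflections W ws"] card_mono[of "set (reflections W ws)"]
  by (metis List.finite_set le_trans length_reflections)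

text \<open>This is the shortest element of the coset. It is described by the absence of inversions in \<open>WJ\<close>,
  because the rule for the inversions of a product shows at once how this condition behaves when
  \<open>w\<close> is multiplied by a generator on the left.\<close>

definition rep :: "'w set \<Rightarrow> 'w" where
  "rep x = (SOME w. w \<in> carrier W \<and> w <# WJ = x \<and> inversions w \<inter> WJ = {})"

text \<open>An inversion \<open>r \<in> WJ\<close> of \<open>w\<close> leads to a shorter element \<open>w \<otimes> r\<close> of the same coset.\<close>

lemma rep_exists:
  assumes "x \<in> X"
  shows "\<exists>w. w \<in> carrier W \<and> w <# WJ = x \<and> inversions w \<inter> WJ = {}"
proof -
  obtain w\<^sub>0 where w0: "w\<^sub>0 \<in> carrier W \<and> w\<^sub>0 <# WJ = x"
    using assms by (elim cosetE) auto
  obtain w where w: "w \<in> carrier W" "w <# WJ = x"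
    and min: "\<And>v. v \<in> carrier W \<Longrightarrow> v <# WJ = x \<Longrightarrow> card (inversions w) \<le> card (inversions v)"
    using ex_has_least_nat[of "\<lambda>w. w \<in> carrier W \<and> w <# WJ = x", OF w0, of "\<lambda>w. card (inversions w)"]
    by blast
  obtain ws where ws: "reduced ws" "prd ws = w"
    using carrier_reduced_word[OF w(1)] by blast
  have False if r: "r \<in> inversions w" "r \<in> WJ" for r
  proof -
    have S: "set ws \<subseteq> S" using ws by (simp add: reduced_def)
    have "r \<in> set (reflections W ws)" using inversions_reduced ws r by auto
    then obtain us t vs where del: "ws = us @ t # vs" "w \<otimes> r = prd (us @ vs)"
      using delete_letter[OF S] ws by blast
    have "(w \<otimes> r) <# WJ = w <# WJ"
      using w r coset_eq_iff[of w "w \<otimes> r"] by (simp add: inv_mult_cancel_left)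
    then have "card (inversions w) \<le> card (inversions (w \<otimes> r))"
      using w r by (intro min) auto
    also have "\<dots> < card (inversions w)"
      using card_inversions_le[of "us @ vs"] S del reduced_iff_length[OF S] ws by simp
    finally show False by simp
  qed
  then show ?thesis using w by blast
qed

lemma rep:
  assumes "x \<in> X"
  shows rep_closed [simp]: "rep x \<in> carrier W"
    and coset_rep [simp]: "rep x <# WJ = x"
    and inversions_rep: "inversions (rep x) \<inter> WJ = {}"
  using someI_ex[OF rep_exists[OF assms]] by (simp_all add: rep_def)

lemma inversions_WJ: "v \<in> WJ \<Longrightarrow> inversions v \<subseteq> WJ"
  using generate_reduced_word[OF J_subset, of v] inversions_reduced
    reflections_in_generate[OF J_subset] by metis

lemma inversions_empty:
  assumes "w \<in> carrier W" "inversions w = {}"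
  shows "w = \<one>"
proof -
  obtain ws where "reduced ws" "prd ws = w"
    using carrier_reduced_word[OF assms(1)] by blast
  then show ?thesis
    using assms reduced_iff_length[of ws] by (auto simp: reduced_def)
qed

text \<open>Two such elements of a coset differ by some \<open>v \<in> WJ\<close>. The inversions of \<open>v\<close> lie in \<open>WJ\<close>, so the rule
  for products makes each of them an inversion of one of the two elements. Hence \<open>v\<close> has none.\<close>

lemma rep_unique:
  assumes "w \<in> carrier W" "inversions w \<inter> WJ = {}"
  shows "rep (w <# WJ) = w"
proof -
  let ?a = "rep (w <# WJ)"
  let ?v = "inv ?a \<otimes> w"
  have a: "?a \<in> carrier W" "?a <# WJ = w <# WJ" "inversions ?a \<inter> WJ = {}"
    using assms inversions_rep by auto
  have v: "?v \<in> WJ" "?v \<in> carrier W"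
    using a(1,2) assms(1) coset_eq_iff[OF a(1) assms(1)] by auto
  have w: "w = ?a \<otimes> ?v"
    using a assms by (simp add: mult_inv_cancel_left)
  have "inversions ?v = {}"
  proof (rule ccontr)
    assume "inversions ?v \<noteq> {}"
    then obtain r where r: "r \<in> inversions ?v" "r \<in> WJ" "r \<in> carrier W"
      using inversions_WJ[OF v(1)] by auto
    then have "?v \<otimes> r \<otimes> inv ?v \<in> WJ"
      using v by (simp del: inv_mult_group)
    then have "?v \<otimes> r \<otimes> inv ?v \<notin> inversions ?a"
      using a by auto
    then have "r \<in> inversions w"
      using inversions_mult[OF a(1) v(2) r(3)] r w by simp
    then show False using r assms by auto
  qed
  then have "?v = \<one>" using inversions_empty v by simp
  with w a show ?thesis by (metis r_one)
qed

lemma rep_base_coset [simp]: "rep x\<^sub>0 = \<one>"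
  using rep_unique[of \<one>] by simp

lemma generator_moves_coset:
  assumes "s \<in> S" "x \<in> X"
  shows "s <# x = x \<longleftrightarrow> inv (rep x) \<otimes> s \<otimes> rep x \<in> WJ"
proof -
  have "s <# x = (s \<otimes> rep x) <# WJ"
    using assms by (metis coset_rep lcos_m_assoc WJ.subset generator_closed rep_closed)
  then show ?thesis
    using coset_eq_iff[of "rep x" "s \<otimes> rep x"] assms by (auto simp: m_assoc)
qed

lemma rep_move:
  assumes "s \<in> S" "x \<in> X" "s <# x \<noteq> x"
  shows "rep (s <# x) = s \<otimes> rep x"
proof -
  have "inv (rep x) \<otimes> s \<otimes> rep x \<notin> WJ"
    using assms generator_moves_coset by simp
  moreover have "r \<in> carrier W" if "r \<in> WJ" for r
    using that by simp
  ultimately have "inversions (s \<otimes> rep x) \<inter> WJ = {}"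
    using assms inversions_rep[of x] by (auto simp: inversions_generator_mult)
  then have "rep ((s \<otimes> rep x) <# WJ) = s \<otimes> rep x"
    using assms by (intro rep_unique) auto
  moreover have "(s \<otimes> rep x) <# WJ = s <# x"
    using assms by (metis coset_rep lcos_m_assoc WJ.subset generator_closed rep_closed)
  ultimately show ?thesis by simp
qed

text \<open>Deodhar's lemma. The element \<open>r\<close> in question is the only inversion of \<open>s \<otimes> rep x = rep x \<otimes> r\<close>
  in \<open>WJ\<close>, hence the only inversion of \<open>r\<close> itself, so \<open>r\<close> has length one.\<close>

lemma deodhar:
  assumes "s \<in> S" "x \<in> X" "s <# x = x"
  shows "inv (rep x) \<otimes> s \<otimes> rep x \<in> J"
proof -
  define r where "r = inv (rep x) \<otimes> s \<otimes> rep x"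
  have r: "r \<in> WJ" "r \<in> carrier W"
    using assms generator_moves_coset by (auto simp: r_def)
  have s_rep: "s \<otimes> rep x = rep x \<otimes> r"
    using assms by (simp add: r_def cancel_simps)
  have "q = r" if q: "q \<in> inversions r" for q
  proof -
    have qW: "q \<in> WJ" "q \<in> carrier W" using q inversions_WJ[OF r(1)] by auto
    then have "r \<otimes> q \<otimes> inv r \<in> WJ" using r by simp
    then have "q \<in> inversions (s \<otimes> rep x)"
      using inversions_mult[of "rep x" r q] inversions_rep[of x] qW q r assms s_rep by auto
    moreover have "q \<notin> inversions (rep x)" using inversions_rep[of x] qW assms by auto
    ultimately show "q = r"
      using inversions_generator_mult[of s "rep x" q] qW assms by (simp add: r_def)
  qed
  then have "card (inversions r) \<le> 1"
    by (auto intro: card_le_Suc0_iff_eq[THEN iffD2] finite_inversions)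
  moreover obtain ws where ws: "set ws \<subseteq> J" "reduced ws" "prd ws = r"
    using generate_reduced_word[OF J_subset r(1)] by blast
  ultimately have "length ws \<le> 1"
    using reduced_iff_length[of ws] by (auto simp: reduced_def)
  moreover have "r \<noteq> \<one>"
  proof
    assume "r = \<one>"
    then have "s \<otimes> rep x = rep x" using s_rep assms by simp
    then show False using assms generator_ne_one[of s] by simp
  qed
  ultimately have "\<exists>t. ws = [t]" using ws by (cases ws) auto
  then show ?thesis using ws J_subset by (auto simp: r_def)
qed

end

section \<open>The cocycle with values in the parabolic braid group\<close>

context parabolic_coxeter
begin

abbreviation "B \<equiv> braid_group W S"
abbreviation "BJ \<equiv> braid_group (parabolic W J) J"
abbreviation "\<sigma> \<equiv> braid_generator W S"
abbreviation "\<sigma>J \<equiv> braid_generator (parabolic W J) J"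
abbreviation "bar \<equiv> braid_to_coxeter W"
abbreviation "\<iota> \<equiv> parabolic_braid_hom W S"

sublocale B: group B by (rule group_braid_group)
sublocale BJ: group BJ by (rule group_braid_group)

lemma J_S [simp]: "t \<in> J \<Longrightarrow> t \<in> S"
  using J_subset by auto

lemma \<sigma>_closed [simp]: "s \<in> S \<Longrightarrow> \<sigma> s \<in> carrier B"
  using braid_generator_closed[of W S] by (auto simp: Pi_iff)

lemma \<sigma>J_closed [simp]: "t \<in> J \<Longrightarrow> \<sigma>J t \<in> carrier BJ"
  using braid_generator_closed[of "parabolic W J" J] by (auto simp: Pi_iff)

lemma ord_parabolic:
  assumes "w \<in> WJ"
  shows "group.ord (parabolic W J) w = ord w"
proof -
  interpret P: group "parabolic W J"
    unfolding parabolic_def by (rule WJ.subgroup_is_group[OF is_group])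
  have "w [^]\<^bsub>parabolic W J\<^esub> n = w [^] n" for n :: nat
    by (induction n) (simp_all add: parabolic_def)
  then show ?thesis
    using assms by (subst P.ord_unique) (auto simp: parabolic_def pow_eq_id)
qed

lemma ord_parabolic_generators:
  "s \<in> J \<Longrightarrow> t \<in> J \<Longrightarrow> group.ord (parabolic W J) (s \<otimes>\<^bsub>parabolic W J\<^esub> t) = ord (s \<otimes> t)"
  using ord_parabolic[of "s \<otimes> t"] generate.incl[of _ J W] by (simp add: parabolic_def)

lemma \<sigma>_braid:
  "s \<in> S \<Longrightarrow> t \<in> S \<Longrightarrow> s \<noteq> t \<Longrightarrow>
    positive_eval B \<sigma> (alternating (ord (s \<otimes> t)) s t) = positive_eval B \<sigma> (alternating (ord (s \<otimes> t)) t s)"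
  using braid_generator_braid[of s S t W] ord_generators_pos by simp

lemma \<sigma>J_braid:
  assumes "s \<in> J" "t \<in> J" "s \<noteq> t"
  shows "positive_eval BJ \<sigma>J (alternating (ord (s \<otimes> t)) s t)
    = positive_eval BJ \<sigma>J (alternating (ord (s \<otimes> t)) t s)"
  using braid_generator_braid[of s J t "parabolic W J"] assms
  by (simp add: ord_parabolic_generators ord_generators_pos)

lemma bar_hom: "bar \<in> hom B W"
  unfolding braid_to_coxeter_def
  by (rule braid_hom(1)[OF is_group _ prd_alternating_braid]) auto

lemma bar_\<sigma> [simp]: "s \<in> S \<Longrightarrow> bar (\<sigma> s) = s"
  unfolding braid_to_coxeter_def
  by (rule braid_hom(2)[OF is_group _ prd_alternating_braid]) auto

lemma \<sigma>_braid_parabolic: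
  assumes "s \<in> J" "t \<in> J" "s \<noteq> t"
  defines "m \<equiv> group.ord (parabolic W J) (s \<otimes>\<^bsub>parabolic W J\<^esub> t)"
  shows "positive_eval B \<sigma> (alternating m s t) = positive_eval B \<sigma> (alternating m t s)"
  unfolding m_def ord_parabolic_generators[OF assms(1,2)]
  by (rule \<sigma>_braid) (use assms in auto)

lemma \<iota>_hom: "\<iota> \<in> hom BJ B"
  unfolding parabolic_braid_hom_def
  by (rule braid_hom(1)[OF B.is_group _ \<sigma>_braid_parabolic]) auto

lemma \<iota>_\<sigma>J [simp]: "t \<in> J \<Longrightarrow> \<iota> (\<sigma>J t) = \<sigma> t"
  unfolding parabolic_braid_hom_def
  by (rule braid_hom(2)[OF B.is_group _ \<sigma>_braid_parabolic]) auto

sublocale bar: group_hom B W bar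
  using bar_hom by unfold_locales
sublocale \<iota>: group_hom BJ B \<iota>
  using \<iota>_hom by unfold_locales

text \<open>Write \<open>w\<^sub>x\<close> for \<open>rep x\<close> and let \<open>us = s\<^sub>1 \<dots> s\<^sub>k\<close>. The projected word records the letters
  \<open>t\<close> of \<open>J\<close> with \<open>s\<^sub>i w\<^sub>y = w\<^sub>y t\<close>, where \<open>y\<close> runs through the cosets on the path
  from \<open>x\<close> to \<open>s\<^sub>1 \<dots> s\<^sub>k x\<close>; steps that change the coset leave no letter.\<close>

fun projection :: "'w list \<Rightarrow> 'w set \<Rightarrow> 'w list" where
  "projection [] x = []"
| "projection (s # us) x =
    (let r = inv (rep (prd us <# x)) \<otimes> s \<otimes> rep (prd us <# x)
     in if r \<in> WJ then r # projection us x else projection us x)"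

lemma set_projection: "set us \<subseteq> S \<Longrightarrow> x \<in> X \<Longrightarrow> set (projection us x) \<subseteq> J"
  by (induction us) (auto simp: Let_def deodhar generator_moves_coset)

lemma projection_closed: "set us \<subseteq> S \<Longrightarrow> x \<in> X \<Longrightarrow> prd (projection us x) \<in> WJ"
  using set_projection prd_in_generate[OF J_subset] by blast

lemma prd_projection:
  assumes "set us \<subseteq> S" "x \<in> X"
  shows "prd us \<otimes> rep x = rep (prd us <# x) \<otimes> prd (projection us x)"
  using assms(1)
proof (induction us)
  case Nil
  then show ?case using assms by simp
next
  case (Cons s us)
  let ?y = "prd us <# x"
  have S: "s \<in> S" "set us \<subseteq> S" "?y \<in> X" using Cons assms by auto
  have q: "prd (projection us x) \<in> carrier W" using projection_closed[OF S(2) assms(2)] by simp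
  have sy: "prd (s # us) <# x = s <# ?y"
    using S assms by (simp add: coset_act_mult)
  have IH: "prd us \<otimes> rep x = rep ?y \<otimes> prd (projection us x)"
    using Cons by simp
  have "prd (s # us) \<otimes> rep x = s \<otimes> rep ?y \<otimes> prd (projection us x)"
    using S assms q by (simp add: IH m_assoc)
  also have "\<dots> = rep (s <# ?y) \<otimes> prd (projection (s # us) x)"
  proof (cases "s <# ?y = ?y")
    case True
    then show ?thesis
      using S q generator_moves_coset[of s ?y] by (simp add: Let_def cancel_simps)
  next
    case False
    then show ?thesis
      using S q generator_moves_coset[of s ?y] by (simp add: Let_def rep_move)
  qed
  finally show ?case by (simp only: sy)
qed

text \<open>Up to conjugation by \<open>rep x\<close>, the reflections of the projected word are those reflections
  of the word that lie in \<open>WJ\<close>. Hence the projection of a reduced word is reduced.\<close>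

lemma reflections_projection:
  assumes "set us \<subseteq> S" "x \<in> X"
  shows "reflections W (projection us x)
    = filter (\<lambda>r. r \<in> WJ) (map (\<lambda>r. inv (rep x) \<otimes> r \<otimes> rep x) (reflections W us))"
  using assms(1)
proof (induction us)
  case (Cons s us)
  let ?y = "prd us <# x" and ?q = "prd (projection us x)" and ?p = "prd us"
  let ?r = "inv (rep ?y) \<otimes> s \<otimes> rep ?y"
  have S: "s \<in> S" "set us \<subseteq> S" "?y \<in> X" "x \<in> X" "?p \<in> carrier W" using Cons assms by auto
  have q: "?q \<in> WJ" "?q \<in> carrier W" using projection_closed[OF S(2) assms(2)] by auto
  have "inv (rep x) \<otimes> (inv ?p \<otimes> s \<otimes> ?p) \<otimes> rep x = inv (?p \<otimes> rep x) \<otimes> s \<otimes> (?p \<otimes> rep x)"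
    using S by (simp add: cancel_simps)
  also have "\<dots> = inv (rep ?y \<otimes> ?q) \<otimes> s \<otimes> (rep ?y \<otimes> ?q)"
    using prd_projection[OF S(2,4)] by simp
  also have "\<dots> = inv ?q \<otimes> ?r \<otimes> ?q"
    using S q by (simp add: cancel_simps)
  finally have conj: "inv (rep x) \<otimes> (inv ?p \<otimes> s \<otimes> ?p) \<otimes> rep x = inv ?q \<otimes> ?r \<otimes> ?q" .
  have "inv ?q \<otimes> ?r \<otimes> ?q \<in> WJ \<longleftrightarrow> ?r \<in> WJ"
  proof
    assume *: "inv ?q \<otimes> ?r \<otimes> ?q \<in> WJ"
    have "?r = ?q \<otimes> (inv ?q \<otimes> ?r \<otimes> ?q) \<otimes> inv ?q"
      using S q by (simp add: cancel_simps)
    with * q show "?r \<in> WJ" by (metis WJ.m_closed WJ.m_inv_closed)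
  qed (use q in simp)
  then show ?case
    using Cons S by (simp add: Let_def conj)
qed simp

lemma reduced_projection:
  assumes "reduced us" "x \<in> X"
  shows "reduced (projection us x)"
proof -
  have S: "set us \<subseteq> S" using assms by (simp add: reduced_def)
  have "inj_on (\<lambda>r. inv (rep x) \<otimes> r \<otimes> rep x) (set (reflections W us))"
  proof (rule inj_onI)
    fix q r
    assume "q \<in> set (reflections W us)" "r \<in> set (reflections W us)"
      "inv (rep x) \<otimes> q \<otimes> rep x = inv (rep x) \<otimes> r \<otimes> rep x"
    then show "q = r"
      using conj_inj[of "rep x" q r] reflections_closed[OF S] assms(2) by auto
  qed
  then have "distinct (reflections W (projection us x))"
    using assms S by (simp add: reflections_projection reduced_def distinct_map)
  then show ?thesis
    using set_projection[OF S assms(2)] J_subset by (auto simp: reduced_def)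
qed

text \<open>The value of the cocycle on a generator: the letter \<open>r\<close> with \<open>s \<otimes> rep x = rep x \<otimes> r\<close> if \<open>s\<close> fixes the
  coset \<open>x\<close>, and trivial if \<open>s\<close> moves it.\<close>

definition step :: "'w \<Rightarrow> 'w set \<Rightarrow> 'w group_word set" where
  "step s x = (let r = inv (rep x) \<otimes> s \<otimes> rep x in if r \<in> WJ then \<sigma>J r else \<one>\<^bsub>BJ\<^esub>)"

abbreviation "wreath \<equiv> wreath_product W X (\<lambda>w x. w <# x) BJ"

definition wreath_generator :: "'w \<Rightarrow> 'w \<times> ('w set \<Rightarrow> 'w group_word set)" where
  "wreath_generator s = (s, \<lambda>x \<in> X. step s x)"

lemma step_closed [simp]: "s \<in> S \<Longrightarrow> x \<in> X \<Longrightarrow> step s x \<in> carrier BJ"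
  by (auto simp: step_def Let_def deodhar generator_moves_coset)

lemma group_wreath: "group wreath"
  by (rule group_wreath_product) (auto simp: is_group BJ.is_group coset_act_mult)

lemma wreath_generator_closed: "wreath_generator \<in> S \<rightarrow> carrier wreath"
  by (auto simp: wreath_product_def wreath_generator_def)

lemma positive_eval_wreath:
  assumes "set us \<subseteq> S"
  shows "positive_eval wreath wreath_generator us
    = (prd us, \<lambda>x \<in> X. positive_eval BJ \<sigma>J (projection us x))"
proof -
  define n where "n = (\<lambda>us. \<lambda>x \<in> X. positive_eval BJ \<sigma>J (projection us x))"
  have "positive_eval wreath wreath_generator us = (prd us, n us)"
    using assms
  proof (induction us)
    case Nil
    then show ?case by (auto simp: wreath_product_def n_def)
  next
    case (Cons s us)
    have "positive_eval BJ \<sigma>J (projection us x) \<in> carrier BJ" if "x \<in> X" for x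
      using that Cons.prems set_projection[of us x]
      by (intro positive_eval_closed[of _ _ J]) (auto simp: BJ.is_group)
    then have n: "(\<lambda>x \<in> X. step s (prd us <# x) \<otimes>\<^bsub>BJ\<^esub> n us x) = n (s # us)"
      using Cons.prems unfolding n_def by (intro restrict_ext) (auto simp: step_def Let_def)
    have "positive_eval wreath wreath_generator (s # us)
      = wreath_generator s \<otimes>\<^bsub>wreath\<^esub> (prd us, n us)"
      using Cons by simp
    also have "\<dots> = (prd (s # us), \<lambda>x \<in> X. step s (prd us <# x) \<otimes>\<^bsub>BJ\<^esub> n us x)"
      using Cons.prems by (auto simp: wreath_product_def wreath_generator_def intro!: restrict_ext)
    finally show ?case by (simp only: n)
  qed
  then show ?thesis by (simp only: n_def)
qed

text \<open>At each coset, the two sides project to reduced words in \<open>J\<close> for the same element of \<open>WJ\<close>, so that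
  Matsumoto's theorem applies in \<open>BJ\<close>.\<close>

lemma wreath_braid:
  assumes "s \<in> S" "t \<in> S"
  defines "m \<equiv> ord (s \<otimes> t)"
  shows "positive_eval wreath wreath_generator (alternating m s t)
    = positive_eval wreath wreath_generator (alternating m t s)"
proof -
  let ?a = "alternating m s t" and ?b = "alternating m t s"
  have S: "set ?a \<subseteq> S" "set ?b \<subseteq> S"
    using set_alternating[of m s t] set_alternating[of m t s] assms by auto
  have red: "reduced ?a" "reduced ?b"
    using S assms by (auto simp: reduced_def distinct_reflections_alternating ord_generators_commute)
  have eq: "prd ?a = prd ?b"
    using assms prd_alternating_braid by simp
  have "positive_eval BJ \<sigma>J (projection ?a x) = positive_eval BJ \<sigma>J (projection ?b x)"
    if "x \<in> X" for x
  proof (rule matsumoto[OF BJ.is_group J_subset _ \<sigma>J_braid])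
    have "rep (prd ?b <# x) \<otimes> prd (projection ?a x) = rep (prd ?b <# x) \<otimes> prd (projection ?b x)"
      using prd_projection[OF S(1) that] prd_projection[OF S(2) that] eq by simp
    then show "prd (projection ?a x) = prd (projection ?b x)"
      using that S projection_closed[of ?a x] projection_closed[of ?b x] by simp
  qed (use that S red in \<open>simp_all add: set_projection reduced_projection\<close>)
  then show ?thesis
    using eq S by (auto simp: positive_eval_wreath intro!: restrict_ext)
qed

definition cocycle :: "'w group_word set \<Rightarrow> 'w set \<Rightarrow> 'w group_word set" where
  "cocycle b x = snd (presented_hom wreath wreath_generator b) x"

lemma wreath_hom: "presented_hom wreath wreath_generator \<in> hom B wreath"
  by (rule braid_hom(1)[OF group_wreath wreath_generator_closed wreath_braid])

lemma wreath_hom_\<sigma>: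
  "s \<in> S \<Longrightarrow> presented_hom wreath wreath_generator (\<sigma> s) = wreath_generator s"
  by (rule braid_hom(2)[OF group_wreath wreath_generator_closed wreath_braid])

lemma cocycle_\<sigma>: "s \<in> S \<Longrightarrow> x \<in> X \<Longrightarrow> cocycle (\<sigma> s) x = step s x"
  by (simp add: cocycle_def wreath_hom_\<sigma> wreath_generator_def)

lemma wreath_hom_fst:
  assumes "b \<in> carrier B"
  shows "fst (presented_hom wreath wreath_generator b) = bar b"
proof -
  interpret h: group_hom B W "fst \<circ> presented_hom wreath wreath_generator"
    using Group.hom_compose[OF wreath_hom wreath_product_fst_hom] by unfold_locales
  from assms have "b \<in> carrier (braid_part W S False)" by (simp add: braid_part_def)
  then have "(fst \<circ> presented_hom wreath wreath_generator) b = bar b"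
  proof (induction rule: braid_part_induct)
    case one
    then show ?case by (simp del: o_apply)
  next
    case (generator s)
    then have "fst (wreath_generator s) = bar (\<sigma> s)" by (simp add: wreath_generator_def)
    with generator show ?case by (simp add: wreath_hom_\<sigma>)
  next
    case (mult a b)
    then show ?case by (simp add: braid_part_def del: o_apply)
  next
    case (inv a)
    then show ?case by (simp add: braid_part_def del: o_apply)
  qed
  then show ?thesis by simp
qed

lemma cocycle_closed [simp]:
  assumes "b \<in> carrier B" "x \<in> X"
  shows "cocycle b x \<in> carrier BJ"
proof -
  have "presented_hom wreath wreath_generator b \<in> carrier wreath"
    using hom_in_carrier[OF wreath_hom] assms by simp
  then show ?thesis
    using assms by (auto simp: wreath_product_def cocycle_def)
qed

lemma cocycle_mult:
  assumes "a \<in> carrier B" "b \<in> carrier B" "x \<in> X"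
  shows "cocycle (a \<otimes>\<^bsub>B\<^esub> b) x = cocycle a (bar b <# x) \<otimes>\<^bsub>BJ\<^esub> cocycle b x"
  using assms hom_mult[OF wreath_hom assms(1,2)] wreath_hom_fst[of b]
  by (simp add: cocycle_def wreath_product_def case_prod_unfold)

lemma cocycle_one [simp]:
  assumes "x \<in> X"
  shows "cocycle \<one>\<^bsub>B\<^esub> x = \<one>\<^bsub>BJ\<^esub>"
  using cocycle_mult[of "\<one>\<^bsub>B\<^esub>" "\<one>\<^bsub>B\<^esub>" x] assms cocycle_closed[of "\<one>\<^bsub>B\<^esub>" x] by simp

lemma cocycle_inv:
  assumes "a \<in> carrier B" "x \<in> X"
  shows "cocycle (inv\<^bsub>B\<^esub> a) (bar a <# x) = inv\<^bsub>BJ\<^esub> (cocycle a x)"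
  using cocycle_mult[of "inv\<^bsub>B\<^esub> a" a x] assms by (simp add: BJ.inv_equality)

lemma bar_\<iota>: "b \<in> carrier BJ \<Longrightarrow> bar (\<iota> b) \<in> WJ"
proof -
  assume "b \<in> carrier BJ"
  then have "b \<in> carrier (braid_part (parabolic W J) J False)" by (simp add: braid_part_def)
  then show ?thesis
    by (induction rule: braid_part_induct) (auto simp: braid_part_def generate.incl)
qed

lemma \<iota>_base_coset: "b \<in> carrier BJ \<Longrightarrow> bar (\<iota> b) <# x\<^sub>0 = x\<^sub>0"
  using coset_eq_iff[of \<one> "bar (\<iota> b)"] bar_\<iota>[of b]
  by (simp add: lcos_mult_one WJ.subset)

lemma cocycle_\<iota>:
  assumes "b \<in> carrier BJ"
  shows "cocycle (\<iota> b) x\<^sub>0 = b"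
proof -
  from assms have "b \<in> carrier (braid_part (parabolic W J) J False)" by (simp add: braid_part_def)
  then show ?thesis
  proof (induction rule: braid_part_induct)
    case (generator t)
    then show ?case by (simp add: cocycle_\<sigma> step_def generate.incl)
  next
    case (mult a b)
    then show ?case by (simp add: braid_part_def cocycle_mult \<iota>_base_coset)
  next
    case (inv a)
    then show ?case
      using cocycle_inv[of "\<iota> a" x\<^sub>0] by (simp add: braid_part_def \<iota>_base_coset)
  qed simp
qed

text \<open>The cocycle is positive on generators, and the values of a cocycle on a product are products of
  its values on the factors. This is how the monoid of positive braids enters.\<close>

lemma cocycle_in_part:
  assumes "b \<in> carrier (braid_part W S pos)" "x \<in> X"
  shows "cocycle b x \<in> carrier (braid_part (parabolic W J) J pos)"
  using assms
proof (induction arbitrary: x rule: braid_part_induct)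
  case one
  then show ?case by (simp add: braid_part_one_closed)
next
  case (generator s)
  then show ?case
    by (auto simp: cocycle_\<sigma> step_def Let_def braid_part_one_closed braid_generator_in_part deodhar
        generator_moves_coset)
next
  case (mult a b)
  then show ?case
    using braid_part_subset[of W S pos]
    by (subst cocycle_mult) (auto intro!: braid_part_mult_closed)
next
  case (inv a)
  then show ?case by (simp add: braid_part_def)
qed

lemma \<iota>_in_part:
  assumes "b \<in> carrier (braid_part (parabolic W J) J pos)"
  shows "\<iota> b \<in> carrier (braid_part W S pos)"
  using assms
proof (induction rule: braid_part_induct)
  case one
  then show ?case by (simp add: braid_part_one_closed)
next
  case (generator t)
  then show ?case by (simp add: braid_generator_in_part)
next
  case (mult a b)
  then have "a \<in> carrier BJ" "b \<in> carrier BJ"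
    using braid_part_subset[of "parabolic W J" J pos] by auto
  with mult show ?case by (simp add: braid_part_mult_closed)
next
  case (inv a)
  then show ?case by (simp add: braid_part_def)
qed


section \<open>Positive lifts of coset representatives\<close>

definition lift :: "'w \<Rightarrow> 'w group_word set" where
  "lift w = positive_eval B \<sigma> (SOME ws. reduced ws \<and> prd ws = w)"

lemma lift_prd:
  assumes "reduced ws"
  shows "lift (prd ws) = positive_eval B \<sigma> ws"
proof -
  let ?us = "SOME us. reduced us \<and> prd us = prd ws"
  have us: "reduced ?us \<and> prd ?us = prd ws"
    by (rule someI[where x = ws]) (simp add: assms)
  show ?thesis
    unfolding lift_def
    by (rule matsumoto[OF B.is_group subset_refl])
      (use us assms \<sigma>_braid in \<open>auto simp: reduced_def\<close>)
qed

lemma lift_one [simp]: "lift \<one> = \<one>\<^bsub>B\<^esub>"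
  using lift_prd[of "[]"] by (simp add: reduced_def)

lemma lift_in_part: "w \<in> carrier W \<Longrightarrow> lift w \<in> carrier (braid_part W S pos)"
  using carrier_reduced_word[of w] lift_prd positive_eval_in_part by (metis reduced_def)

lemma lift_closed [simp]: "w \<in> carrier W \<Longrightarrow> lift w \<in> carrier B"
  using lift_in_part[of w False] by (simp add: braid_part_def)

lemma bar_lift [simp]:
  assumes "w \<in> carrier W"
  shows "bar (lift w) = w"
proof -
  have "bar (positive_eval B \<sigma> ws) = prd ws" if "set ws \<subseteq> S" for ws
    using that
  proof (induction ws)
    case (Cons s ws)
    then show ?case
      using positive_eval_in_part[of ws S W False] by (simp add: braid_part_def)
  qed simp
  moreover obtain ws where "reduced ws" "prd ws = w"
    using carrier_reduced_word[OF assms] by blast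
  ultimately show ?thesis
    using lift_prd[of ws] by (auto simp: reduced_def)
qed

lemma lift_generator_mult:
  assumes "s \<in> S" "w \<in> carrier W" "inv w \<otimes> s \<otimes> w \<notin> inversions w"
  shows "lift (s \<otimes> w) = \<sigma> s \<otimes>\<^bsub>B\<^esub> lift w"
proof -
  obtain ws where ws: "reduced ws" "prd ws = w"
    using carrier_reduced_word[OF assms(2)] by blast
  then have "reduced (s # ws)"
    using assms by (simp add: reduced_Cons)
  from lift_prd[OF this] lift_prd[OF ws(1)] ws show ?thesis by simp
qed

text \<open>One of \<open>rep x\<close> and \<open>rep (s <# x) = s \<otimes> rep x\<close> is longer than the other, and \<open>lift\<close> is
  multiplicative where lengths add up.\<close>

lemma lift_rep_move:
  assumes "s \<in> S" "x \<in> X" "s <# x \<noteq> x"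
  shows "lift (rep (s <# x)) = \<sigma> s \<otimes>\<^bsub>B\<^esub> lift (rep x) \<or>
    lift (rep x) = \<sigma> s \<otimes>\<^bsub>B\<^esub> lift (rep (s <# x))"
proof -
  let ?w = "rep x"
  let ?r = "inv ?w \<otimes> s \<otimes> ?w"
  have w: "?w \<in> carrier W" "rep (s <# x) = s \<otimes> ?w" using assms rep_move by auto
  show ?thesis
  proof (cases "?r \<in> inversions ?w")
    case False
    then show ?thesis using lift_generator_mult[of s ?w] assms w by simp
  next
    case True
    have "inv (s \<otimes> ?w) \<otimes> s \<otimes> (s \<otimes> ?w) = ?r"
      using assms w by (simp add: cancel_simps generator_cancel_left)
    moreover have "?r \<notin> inversions (s \<otimes> ?w)"
      using True assms w by (simp add: inversions_generator_mult)
    ultimately have "lift (s \<otimes> (s \<otimes> ?w)) = \<sigma> s \<otimes>\<^bsub>B\<^esub> lift (s \<otimes> ?w)"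
      using assms w by (intro lift_generator_mult) auto
    then show ?thesis using assms w by (simp add: generator_cancel_left)
  qed
qed

text \<open>With \<open>s \<otimes> rep x = rep x \<otimes> r\<close> as in Deodhar's lemma, lengths add up on both sides, and \<open>lift\<close> can be
  computed from either of them.\<close>

lemma lift_rep_fixed:
  assumes "s \<in> S" "x \<in> X" "s <# x = x"
  shows "\<sigma> s \<otimes>\<^bsub>B\<^esub> lift (rep x) = lift (rep x) \<otimes>\<^bsub>B\<^esub> \<iota> (cocycle (\<sigma> s) x)"
proof -
  let ?w = "rep x"
  define r where "r = inv ?w \<otimes> s \<otimes> ?w"
  have w: "?w \<in> carrier W" using assms by simp
  have r: "r \<in> J" "r \<in> WJ" "r \<in> S" "r \<in> carrier W"
    using deodhar[OF assms] generate.incl[of r J W] by (auto simp: r_def)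
  have notin: "r \<notin> inversions ?w" using inversions_rep[OF assms(2)] r by auto
  have sw: "s \<otimes> ?w = ?w \<otimes> r" using assms by (simp add: r_def cancel_simps)
  have 1: "lift (s \<otimes> ?w) = \<sigma> s \<otimes>\<^bsub>B\<^esub> lift ?w"
    using notin assms by (intro lift_generator_mult) (auto simp: r_def)
  obtain ws where ws: "reduced ws" "prd ws = ?w" "set ws \<subseteq> S"
    using carrier_reduced_word[OF w] by (auto simp: reduced_def)
  have prd: "prd (ws @ [r]) = ?w \<otimes> r"
    using ws r prd_append[of ws "[r]"] by simp
  have "inversions (?w \<otimes> r) = insert r (inversions ?w)"
  proof (rule Set.set_eqI)
    fix q
    show "q \<in> inversions (?w \<otimes> r) \<longleftrightarrow> q \<in> insert r (inversions ?w)"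
      using inversions_generator_mult[of s ?w q] inversions_closed assms notin r
      by (cases "q \<in> carrier W") (auto simp: sw[symmetric] r_def[symmetric] dest: subsetD[OF inversions_closed])
  qed
  then have "reduced (ws @ [r])"
    using ws r prd notin reduced_iff_length[of ws] reduced_iff_length[of "ws @ [r]"] finite_inversions
    by simp
  then have 2: "lift (?w \<otimes> r) = lift ?w \<otimes>\<^bsub>B\<^esub> \<sigma> r"
    using lift_prd[of "ws @ [r]"] lift_prd[of ws] prd ws r
      positive_eval_append[OF B.is_group, of \<sigma> S ws "[r]"] by auto
  have "\<iota> (cocycle (\<sigma> s) x) = \<sigma> r"
    using assms r by (simp add: cocycle_\<sigma> step_def r_def[symmetric])
  then show ?thesis
    using 1 2 sw by simp
qed

text \<open>If \<open>s # us\<close> is a reduced word for the representative of a coset, then \<open>us\<close> is one for the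
  representative of another coset, since its inversions are among those of \<open>s # us\<close>.\<close>

lemma coset_induct [consumes 1, case_names base move]:
  assumes "x \<in> X"
    and base: "P x\<^sub>0"
    and move: "\<And>s x. s \<in> S \<Longrightarrow> x \<in> X \<Longrightarrow> P x \<Longrightarrow> s <# x \<noteq> x \<Longrightarrow>
      lift (rep (s <# x)) = \<sigma> s \<otimes>\<^bsub>B\<^esub> lift (rep x) \<Longrightarrow> P (s <# x)"
  shows "P x"
proof -
  have "P (prd ws <# WJ)" if "reduced ws" "inversions (prd ws) \<inter> WJ = {}" for ws
    using that
  proof (induction ws)
    case Nil
    then show ?case using base by simp
  next
    case (Cons s us)
    have s: "s \<in> S" "reduced us" "set us \<subseteq> S"
      using reduced_ConsD[OF Cons.prems(1)] by (auto simp: reduced_def)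
    have "inversions (prd us) \<inter> WJ = {}"
      using Cons.prems inversions_reduced[OF Cons.prems(1)] inversions_reduced[OF s(2)] by auto
    then have P: "P (prd us <# WJ)" and rep: "rep (prd us <# WJ) = prd us"
      using Cons s by (auto intro: rep_unique)
    have rep': "rep (prd (s # us) <# WJ) = prd (s # us)"
      using Cons.prems by (intro rep_unique) (auto simp: reduced_def)
    have act: "s <# (prd us <# WJ) = prd (s # us) <# WJ"
      using s by (simp add: lcos_m_assoc WJ.subset)
    have "s <# (prd us <# WJ) \<noteq> prd us <# WJ"
    proof
      assume "s <# (prd us <# WJ) = prd us <# WJ"
      then have "s \<otimes> prd us = prd us" using rep rep' act by simp
      then show False using s generator_ne_one[of s] by simp
    qed
    moreover have "lift (rep (s <# (prd us <# WJ))) = \<sigma> s \<otimes>\<^bsub>B\<^esub> lift (rep (prd us <# WJ))"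
      unfolding act rep rep' using lift_prd[OF Cons.prems(1)] lift_prd[OF s(2)] by simp
    ultimately show ?case
      using move[OF s(1) coset_in P] s unfolding act by simp
  qed
  moreover obtain ws where "reduced ws" "prd ws = rep x"
    using carrier_reduced_word[of "rep x"] assms(1) by auto
  ultimately have "P (rep x <# WJ)"
    using inversions_rep[OF assms(1)] by metis
  then show ?thesis
    using coset_rep[OF assms(1)] by simp
qed

end

section \<open>Fully faithful, essentially surjective functors\<close>

text \<open>The quasi-inverse transports morphisms along chosen isomorphisms \<open>e Y : F (g\<^sub>0 Y) \<rightarrow> Y\<close>.
  Composites are normalized by bracketing to the left, so that \<open>e\<close> and its inverse meet.\<close>

lemma equivalence_of_categories_fully_faithful:
  assumes F: "category_functor C D F"
    and faithful: "\<And>X Y f g. X \<in> Obj C \<Longrightarrow> Y \<in> Obj C \<Longrightarrow> f \<in> Hom C X Y \<Longrightarrow> g \<in> Hom C X Y \<Longrightarrow>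
      on_hom F X Y f = on_hom F X Y g \<Longrightarrow> f = g"
    and full: "\<And>X Y h. X \<in> Obj C \<Longrightarrow> Y \<in> Obj C \<Longrightarrow> h \<in> Hom D (on_obj F X) (on_obj F Y) \<Longrightarrow>
      \<exists>f \<in> Hom C X Y. on_hom F X Y f = h"
    and surj: "\<And>Y. Y \<in> Obj D \<Longrightarrow> \<exists>X \<in> Obj C. \<exists>e. isomorphism_in D (on_obj F X) Y e"
  shows "equivalence_of_categories C D F"
proof -
  interpret category_functor C D F by fact
  have "\<forall>Y \<in> Obj D. \<exists>t. case t of (X, e, e') \<Rightarrow> X \<in> Obj C \<and> e \<in> Hom D (on_obj F X) Y \<and> e' \<in> Hom D Y (on_obj F X) \<and>
    Comp D (on_obj F X) Y (on_obj F X) e' e = Ident D (on_obj F X) \<and>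
    Comp D Y (on_obj F X) Y e e' = Ident D Y"
    using surj unfolding isomorphism_in_def by fastforce
  then obtain c where c: "\<forall>Y \<in> Obj D. case c Y of (X, e, e') \<Rightarrow> X \<in> Obj C \<and>
    e \<in> Hom D (on_obj F X) Y \<and> e' \<in> Hom D Y (on_obj F X) \<and>
    Comp D (on_obj F X) Y (on_obj F X) e' e = Ident D (on_obj F X) \<and>
    Comp D Y (on_obj F X) Y e e' = Ident D Y"
    by (elim bchoice[THEN exE])
  define g\<^sub>0 where "g\<^sub>0 = (\<lambda>Y. fst (c Y))"
  define e where "e = (\<lambda>Y. fst (snd (c Y)))"
  define e' where "e' = (\<lambda>Y. snd (snd (c Y)))"
  define P where "P = (\<lambda>Y. on_obj F (g\<^sub>0 Y))"
  have g0: "g\<^sub>0 Y \<in> Obj C" and P: "P Y \<in> Obj D"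
    and e: "e Y \<in> Hom D (P Y) Y" and e': "e' Y \<in> Hom D Y (P Y)"
    and e'e: "Comp D (P Y) Y (P Y) (e' Y) (e Y) = Ident D (P Y)"
    and ee': "Comp D Y (P Y) Y (e Y) (e' Y) = Ident D Y" if "Y \<in> Obj D" for Y
    using bspec[OF c that] on_obj_in
    by (auto simp: g\<^sub>0_def e_def e'_def P_def case_prod_unfold)
  have cancel: "Comp D Y (P Y) Z (Comp D (P Y) Y Z h (e Y)) (e' Y) = h"
    if "Y \<in> Obj D" "Z \<in> Obj D" "h \<in> Hom D Y Z" for Y Z h
    using that e e' ee' P D.Comp_assoc[of Y "P Y" Y Z "e' Y" "e Y" h] D.Comp_Ident_right by simp
  have cancel': "Comp D (P Y) Y Z (Comp D Y (P Y) Z h (e' Y)) (e Y) = h"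
    if "Y \<in> Obj D" "Z \<in> Obj D" "h \<in> Hom D (P Y) Z" for Y Z h
    using that e e' e'e P D.Comp_assoc[of "P Y" Y "P Y" Z "e Y" "e' Y" h] D.Comp_Ident_right by simp
  define transport where "transport =
    (\<lambda>Y Z h. Comp D (P Y) Y (P Z) (Comp D Y Z (P Z) (e' Z) h) (e Y))"
  have transport_eq: "transport Y Z h = Comp D (P Y) Y (P Z) (Comp D Y Z (P Z) (e' Z) h) (e Y)" for Y Z h
    by (simp add: transport_def)
  define lift where "lift = (\<lambda>X Y h. SOME f. f \<in> Hom C X Y \<and> on_hom F X Y f = h)"
  have lift: "lift X Y h \<in> Hom C X Y \<and> on_hom F X Y (lift X Y h) = h"
    if "X \<in> Obj C" "Y \<in> Obj C" "h \<in> Hom D (on_obj F X) (on_obj F Y)" for X Y h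
    unfolding lift_def by (rule someI_ex) (use full[OF that] in blast)
  define G where "G = \<lparr>on_obj = g\<^sub>0, on_hom = (\<lambda>Y Z h. lift (g\<^sub>0 Y) (g\<^sub>0 Z) (transport Y Z h))\<rparr>"
  have transport: "transport Y Z h \<in> Hom D (P Y) (P Z)"
    if "Y \<in> Obj D" "Z \<in> Obj D" "h \<in> Hom D Y Z" for Y Z h
    unfolding transport_eq using that e e' P by (intro D.Comp_in[where Y = Y] D.Comp_in[where Y = Z]) auto
  have G_hom: "on_hom G Y Z h \<in> Hom C (g\<^sub>0 Y) (g\<^sub>0 Z)"
      and FG_hom: "on_hom F (g\<^sub>0 Y) (g\<^sub>0 Z) (on_hom G Y Z h) = transport Y Z h"
    if "Y \<in> Obj D" "Z \<in> Obj D" "h \<in> Hom D Y Z" for Y Z h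
    using lift[of "g\<^sub>0 Y" "g\<^sub>0 Z" "transport Y Z h"] transport[OF that] g0 that by (auto simp: G_def P_def)
  have transport_Ident: "transport Y Y (Ident D Y) = Ident D (P Y)" if "Y \<in> Obj D" for Y
    using that e e' e'e P by (simp add: transport_eq D.Comp_Ident_right)
  have transport_Comp: "transport X Z (Comp D X Y Z k h) = Comp D (P X) (P Y) (P Z) (transport Y Z k) (transport X Y h)"
    if "X \<in> Obj D" "Y \<in> Obj D" "Z \<in> Obj D" "h \<in> Hom D X Y" "k \<in> Hom D Y Z" for X Y Z h k
  proof -
    have in': "Comp D Y Z (P Z) (e' Z) k \<in> Hom D Y (P Z)" "Comp D X Y (P Y) (e' Y) h \<in> Hom D X (P Y)"
      using that e' P by (auto intro: D.Comp_in)
    have "Comp D (P X) (P Y) (P Z) (transport Y Z k) (transport X Y h)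
      = Comp D (P X) X (P Z) (Comp D X (P Y) (P Z) (transport Y Z k) (Comp D X Y (P Y) (e' Y) h)) (e X)"
      unfolding transport_eq[of X Y h]
      using that in' e P transport D.Comp_assoc[of "P X" X "P Y" "P Z" "e X" _ "transport Y Z k"] by simp
    also have "Comp D X (P Y) (P Z) (transport Y Z k) (Comp D X Y (P Y) (e' Y) h)
      = Comp D X Y (P Z) (Comp D Y (P Y) (P Z) (transport Y Z k) (e' Y)) h"
      using that e' P transport D.Comp_assoc[of X Y "P Y" "P Z" h "e' Y" "transport Y Z k"] by simp
    also have "Comp D Y (P Y) (P Z) (transport Y Z k) (e' Y) = Comp D Y Z (P Z) (e' Z) k"
      unfolding transport_eq using that in' P by (intro cancel) auto
    also have "Comp D X Y (P Z) (Comp D Y Z (P Z) (e' Z) k) h = Comp D X Z (P Z) (e' Z) (Comp D X Y Z k h)"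
      using that e' P D.Comp_assoc[of X Y Z "P Z" h k "e' Z"] by simp
    finally show ?thesis by (simp add: transport_eq)
  qed
  have G: "category_functor D C G"
  proof
    fix X
    assume "X \<in> Obj D"
    then show "on_obj G X \<in> Obj C" "on_hom G X X (Ident D X) = Ident C (on_obj G X)"
      using g0 G_hom[of X X "Ident D X"] FG_hom[of X X "Ident D X"] transport_Ident
        D.Ident_in C.Ident_in on_hom_Ident faithful[of "g\<^sub>0 X" "g\<^sub>0 X"]
      by (auto simp: G_def P_def)
  next
    fix X Y f
    assume "X \<in> Obj D" "Y \<in> Obj D" "f \<in> Hom D X Y"
    then show "on_hom G X Y f \<in> Hom C (on_obj G X) (on_obj G Y)"
      using G_hom by (simp add: G_def)
  next
    fix X Y Z f g
    assume *: "X \<in> Obj D" "Y \<in> Obj D" "Z \<in> Obj D" "f \<in> Hom D X Y" "g \<in> Hom D Y Z"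
    then have gf: "Comp D X Y Z g f \<in> Hom D X Z" by (rule D.Comp_in)
    have "on_hom G X Z (Comp D X Y Z g f) = Comp C (g\<^sub>0 X) (g\<^sub>0 Y) (g\<^sub>0 Z) (on_hom G Y Z g) (on_hom G X Y f)"
    proof (rule faithful)
      show "on_hom F (g\<^sub>0 X) (g\<^sub>0 Z) (on_hom G X Z (Comp D X Y Z g f)) = on_hom F (g\<^sub>0 X) (g\<^sub>0 Z)
          (Comp C (g\<^sub>0 X) (g\<^sub>0 Y) (g\<^sub>0 Z) (on_hom G Y Z g) (on_hom G X Y f))"
        using * gf g0 G_hom FG_hom transport_Comp by (simp add: on_hom_Comp P_def)
    qed (use * gf g0 G_hom in \<open>auto intro: C.Comp_in\<close>)
    then show "on_hom G X Z (Comp D X Y Z g f)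
      = Comp C (on_obj G X) (on_obj G Y) (on_obj G Z) (on_hom G Y Z g) (on_hom G X Y f)"
      by (simp add: G_def)
  qed
  have \<epsilon>: "natural_isomorphism D D (comp_functor F G) id_functor e"
    unfolding natural_isomorphism_def
  proof (intro conjI ballI)
    fix Y
    assume "Y \<in> Obj D"
    then show "isomorphism_in D (on_obj (comp_functor F G) Y) (on_obj id_functor Y) (e Y)"
      using e[of Y] e'[of Y] ee'[of Y] e'e[of Y]
      by (auto simp: isomorphism_in_def comp_functor_def id_functor_def G_def P_def
          intro!: bexI[of _ "e' Y"])
  next
    fix X Y f
    assume *: "X \<in> Obj D" "Y \<in> Obj D" "f \<in> Hom D X Y"
    have in': "Comp D X Y (P Y) (e' Y) f \<in> Hom D X (P Y)"
      using * e' P by (auto intro: D.Comp_in)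
    have "Comp D (P X) (P Y) Y (e Y) (transport X Y f)
      = Comp D (P X) X Y (Comp D X (P Y) Y (e Y) (Comp D X Y (P Y) (e' Y) f)) (e X)"
      unfolding transport_eq using * in' e P D.Comp_assoc[of "P X" X "P Y" Y "e X" _ "e Y"] by simp
    also have "Comp D X (P Y) Y (e Y) (Comp D X Y (P Y) (e' Y) f) = f"
      using * e e' ee' P D.Comp_assoc[of X Y "P Y" Y f "e' Y" "e Y"] D.Comp_Ident_left by simp
    finally show "Comp D (on_obj (comp_functor F G) X) (on_obj (comp_functor F G) Y) (on_obj id_functor Y)
        (e Y) (on_hom (comp_functor F G) X Y f)
      = Comp D (on_obj (comp_functor F G) X) (on_obj id_functor X) (on_obj id_functor Y)
        (on_hom id_functor X Y f) (e X)"
      using * FG_hom[of X Y f] by (simp add: comp_functor_def id_functor_def G_def P_def)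
  qed
  define \<eta> where "\<eta> = (\<lambda>X. lift X (g\<^sub>0 (on_obj F X)) (e' (on_obj F X)))"
  have \<eta>: "\<eta> X \<in> Hom C X (g\<^sub>0 (on_obj F X))" "on_hom F X (g\<^sub>0 (on_obj F X)) (\<eta> X) = e' (on_obj F X)"
    if "X \<in> Obj C" for X
    using lift[of X "g\<^sub>0 (on_obj F X)" "e' (on_obj F X)"] that g0 on_obj_in e' by (auto simp: \<eta>_def P_def)
  have "natural_isomorphism C C id_functor (comp_functor G F) \<eta>"
    unfolding natural_isomorphism_def
  proof (intro conjI ballI)
    fix X
    assume X: "X \<in> Obj C"
    let ?Y = "g\<^sub>0 (on_obj F X)"
    have Y: "?Y \<in> Obj C" "on_obj F X \<in> Obj D" using X g0 on_obj_in by auto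
    define \<zeta> where "\<zeta> = lift ?Y X (e (on_obj F X))"
    have \<zeta>: "\<zeta> \<in> Hom C ?Y X" "on_hom F ?Y X \<zeta> = e (on_obj F X)"
      using lift[of ?Y X "e (on_obj F X)"] X Y e by (auto simp: \<zeta>_def P_def)
    have "Comp C X ?Y X \<zeta> (\<eta> X) = Ident C X"
    proof (rule faithful[OF X X])
      show "on_hom F X X (Comp C X ?Y X \<zeta> (\<eta> X)) = on_hom F X X (Ident C X)"
        using X Y \<zeta> \<eta>[OF X] ee' by (simp add: on_hom_Comp on_hom_Ident P_def)
    qed (use X Y \<zeta> \<eta>[OF X] C.Comp_in C.Ident_in in auto)
    moreover have "Comp C ?Y X ?Y (\<eta> X) \<zeta> = Ident C ?Y"
    proof (rule faithful[OF Y(1) Y(1)])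
      show "on_hom F ?Y ?Y (Comp C ?Y X ?Y (\<eta> X) \<zeta>) = on_hom F ?Y ?Y (Ident C ?Y)"
        using X Y \<zeta> \<eta>[OF X] e'e by (simp add: on_hom_Comp on_hom_Ident P_def)
    qed (use X Y \<zeta> \<eta>[OF X] C.Comp_in C.Ident_in in auto)
    ultimately show "isomorphism_in C (on_obj id_functor X) (on_obj (comp_functor G F) X) (\<eta> X)"
      using \<zeta> \<eta>[OF X] by (auto simp: isomorphism_in_def comp_functor_def id_functor_def G_def)
  next
    fix X Y f
    assume *: "X \<in> Obj C" "Y \<in> Obj C" "f \<in> Hom C X Y"
    let ?X = "g\<^sub>0 (on_obj F X)" and ?Y = "g\<^sub>0 (on_obj F Y)"
    have FX: "on_obj F X \<in> Obj D" "on_obj F Y \<in> Obj D" "?X \<in> Obj C" "?Y \<in> Obj C"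
      and Ff: "on_hom F X Y f \<in> Hom D (on_obj F X) (on_obj F Y)"
      using * g0 on_obj_in on_hom_in by auto
    let ?Gf = "on_hom G (on_obj F X) (on_obj F Y) (on_hom F X Y f)"
    have Gf: "?Gf \<in> Hom C ?X ?Y" "on_hom F ?X ?Y ?Gf = transport (on_obj F X) (on_obj F Y) (on_hom F X Y f)"
      using FX Ff G_hom FG_hom by auto
    have "Comp C X Y ?Y (\<eta> Y) f = Comp C X ?X ?Y ?Gf (\<eta> X)"
    proof (rule faithful[OF *(1) FX(4)])
      have "Comp D (on_obj F X) (P (on_obj F X)) (P (on_obj F Y))
          (transport (on_obj F X) (on_obj F Y) (on_hom F X Y f)) (e' (on_obj F X))
        = Comp D (on_obj F X) (on_obj F Y) (P (on_obj F Y)) (e' (on_obj F Y)) (on_hom F X Y f)"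
        unfolding transport_eq using FX Ff e' P by (intro cancel) (auto intro: D.Comp_in)
      then show "on_hom F X ?Y (Comp C X Y ?Y (\<eta> Y) f) = on_hom F X ?Y (Comp C X ?X ?Y ?Gf (\<eta> X))"
        using * FX Gf \<eta> by (simp add: on_hom_Comp P_def)
    qed (use * FX Gf \<eta> C.Comp_in in auto)
    then show "Comp C (on_obj id_functor X) (on_obj id_functor Y) (on_obj (comp_functor G F) Y)
        (\<eta> Y) (on_hom id_functor X Y f)
      = Comp C (on_obj id_functor X) (on_obj (comp_functor G F) X) (on_obj (comp_functor G F) Y)
        (on_hom (comp_functor G F) X Y f) (\<eta> X)"
      by (simp add: comp_functor_def id_functor_def G_def)
  qed
  with F G \<epsilon> show ?thesis
    unfolding equivalence_of_categories_def by blast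
qed

section \<open>Linear maps and direct sums\<close>

lemma linear_mapsI:
  assumes "f \<in> carrier U \<rightarrow>\<^sub>E carrier V"
    and "\<And>x y. x \<in> carrier U \<Longrightarrow> y \<in> carrier U \<Longrightarrow> f (x \<oplus>\<^bsub>U\<^esub> y) = f x \<oplus>\<^bsub>V\<^esub> f y"
    and "\<And>a x. a \<in> carrier K \<Longrightarrow> x \<in> carrier U \<Longrightarrow> f (a \<odot>\<^bsub>U\<^esub> x) = a \<odot>\<^bsub>V\<^esub> f x"
  shows "f \<in> linear_maps K U V"
  using assms by (simp add: linear_maps_def)

lemma
  assumes "f \<in> linear_maps K U V"
  shows linear_map_closed: "x \<in> carrier U \<Longrightarrow> f x \<in> carrier V"
    and linear_map_add: "x \<in> carrier U \<Longrightarrow> y \<in> carrier U \<Longrightarrow> f (x \<oplus>\<^bsub>U\<^esub> y) = f x \<oplus>\<^bsub>V\<^esub> f y"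
    and linear_map_smult: "a \<in> carrier K \<Longrightarrow> x \<in> carrier U \<Longrightarrow> f (a \<odot>\<^bsub>U\<^esub> x) = a \<odot>\<^bsub>V\<^esub> f x"
    and linear_map_extensional: "f \<in> extensional (carrier U)"
    and linear_map_PiE: "f \<in> carrier U \<rightarrow>\<^sub>E carrier V"
  using assms by (auto simp: linear_maps_def PiE_iff)

lemma linear_map_eqI:
  assumes "f \<in> linear_maps K U V" "g \<in> linear_maps K U V'"
    and "\<And>x. x \<in> carrier U \<Longrightarrow> f x = g x"
  shows "f = g"
  using assms linear_map_extensional by (metis extensionalityI)

lemma linear_map_zero:
  assumes "module K U" "module K V" "f \<in> linear_maps K U V"
  shows "f \<zero>\<^bsub>U\<^esub> = \<zero>\<^bsub>V\<^esub>"
proof -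
  interpret U: module K U by fact
  interpret V: module K V by fact
  have "f \<zero>\<^bsub>U\<^esub> = f (\<zero>\<^bsub>K\<^esub> \<odot>\<^bsub>U\<^esub> \<zero>\<^bsub>U\<^esub>)" by simp
  also have "\<dots> = \<zero>\<^bsub>K\<^esub> \<odot>\<^bsub>V\<^esub> f \<zero>\<^bsub>U\<^esub>"
    by (rule linear_map_smult[OF assms(3)]) simp_all
  also have "\<dots> = \<zero>\<^bsub>V\<^esub>"
    using linear_map_closed[OF assms(3)] by simp
  finally show ?thesis .
qed

lemma linear_map_compose:
  assumes "f \<in> linear_maps K U V" "g \<in> linear_maps K V V'" "module K U"
  shows "compose (carrier U) g f \<in> linear_maps K U V'"
proof -
  interpret U: module K U by fact
  show ?thesis
    using assms(1,2)
    by (intro linear_mapsI)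
      (auto simp: compose_def linear_map_closed linear_map_add linear_map_smult)
qed

lemma linear_map_inverse:
  assumes "f \<in> linear_maps K U V" "bij_betw f (carrier U) (carrier V)" "module K U" "module K V"
  defines "g \<equiv> (\<lambda>v \<in> carrier V. inv_into (carrier U) f v)"
  shows "g \<in> linear_maps K V U"
    and "u \<in> carrier U \<Longrightarrow> g (f u) = u"
    and "v \<in> carrier V \<Longrightarrow> f (g v) = v"
proof -
  interpret U: module K U by fact
  interpret V: module K V by fact
  note f = linear_map_closed[OF assms(1)] linear_map_add[OF assms(1)] linear_map_smult[OF assms(1)]
  show gf: "g (f u) = u" if "u \<in> carrier U" for u
    using that assms(2) f(1) by (simp add: g_def bij_betw_def inv_into_f_f)
  show fg: "f (g v) = v" if "v \<in> carrier V" for v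
    using that assms(2) by (simp add: g_def bij_betw_def f_inv_into_f)
  have g: "g v \<in> carrier U" if "v \<in> carrier V" for v
    using that assms(2) by (simp add: g_def bij_betw_def inv_into_into)
  have "g (v \<oplus>\<^bsub>V\<^esub> w) = g v \<oplus>\<^bsub>U\<^esub> g w" if "v \<in> carrier V" "w \<in> carrier V" for v w
  proof -
    have "g (v \<oplus>\<^bsub>V\<^esub> w) = g (f (g v \<oplus>\<^bsub>U\<^esub> g w))"
      using that by (simp add: f fg g)
    then show ?thesis using that by (simp add: gf g)
  qed
  moreover have "g (a \<odot>\<^bsub>V\<^esub> v) = a \<odot>\<^bsub>U\<^esub> g v" if "a \<in> carrier K" "v \<in> carrier V" for a v
  proof -
    have "g (a \<odot>\<^bsub>V\<^esub> v) = g (f (a \<odot>\<^bsub>U\<^esub> g v))"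
      using that by (simp add: f fg g)
    then show ?thesis using that by (simp add: gf g)
  qed
  moreover have "g \<in> carrier V \<rightarrow>\<^sub>E carrier U"
    using g by (auto simp: g_def)
  ultimately show "g \<in> linear_maps K V U"
    by (intro linear_mapsI)
qed

locale finite_direct_sum =
  fixes K :: "'k ring" and I :: "'i set" and V :: "'i \<Rightarrow> ('k, 'v) module"
  assumes cring_K: "cring K" and finite_I: "finite I"
    and module_V: "i \<in> I \<Longrightarrow> module K (V i)"
begin

abbreviation "dsum \<equiv> direct_sum I V"
abbreviation "inclusion \<equiv> summand_inj I V"

lemma abelian_group_V: "i \<in> I \<Longrightarrow> abelian_group (V i)"
  using module_V by (simp add: module_def)

lemma carrier_total: "carrier dsum = (\<Pi>\<^sub>E i \<in> I. carrier (V i))"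
  using finite_I by (auto simp: direct_sum_def)

lemma zero_V [simp]: "i \<in> I \<Longrightarrow> \<zero>\<^bsub>V i\<^esub> \<in> carrier (V i)"
  using abelian_group_V by (metis abelian_group.axioms(1) abelian_monoid.zero_closed)

lemma add_apply: "i \<in> I \<Longrightarrow> (f \<oplus>\<^bsub>dsum\<^esub> g) i = f i \<oplus>\<^bsub>V i\<^esub> g i"
  and zero_apply: "i \<in> I \<Longrightarrow> \<zero>\<^bsub>dsum\<^esub> i = \<zero>\<^bsub>V i\<^esub>"
  and smult_apply: "i \<in> I \<Longrightarrow> (a \<odot>\<^bsub>dsum\<^esub> f) i = a \<odot>\<^bsub>V i\<^esub> f i"
  by (simp_all add: direct_sum_def)

lemma total_eqI: "f \<in> carrier dsum \<Longrightarrow> g \<in> carrier dsum \<Longrightarrow> (\<And>i. i \<in> I \<Longrightarrow> f i = g i) \<Longrightarrow> f = g"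
  unfolding carrier_total by (rule PiE_ext)

lemma total_apply_closed: "f \<in> carrier dsum \<Longrightarrow> i \<in> I \<Longrightarrow> f i \<in> carrier (V i)"
  unfolding carrier_total by (rule PiE_mem)

lemma total_closed:
  shows "f \<in> carrier dsum \<Longrightarrow> g \<in> carrier dsum \<Longrightarrow> f \<oplus>\<^bsub>dsum\<^esub> g \<in> carrier dsum"
    and "\<zero>\<^bsub>dsum\<^esub> \<in> carrier dsum"
    and "a \<in> carrier K \<Longrightarrow> f \<in> carrier dsum \<Longrightarrow> a \<odot>\<^bsub>dsum\<^esub> f \<in> carrier dsum"
proof -
  show "\<zero>\<^bsub>dsum\<^esub> \<in> carrier dsum"
    unfolding carrier_total by (auto simp: direct_sum_def)
  show "f \<oplus>\<^bsub>dsum\<^esub> g \<in> carrier dsum" if "f \<in> carrier dsum" "g \<in> carrier dsum"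
    unfolding carrier_total
  proof (rule PiE_I)
    fix i assume "i \<in> I"
    then interpret module K "V i" by (rule module_V)
    show "(f \<oplus>\<^bsub>dsum\<^esub> g) i \<in> carrier (V i)"
      using \<open>i \<in> I\<close> that by (simp add: add_apply total_apply_closed)
  qed (simp add: direct_sum_def)
  show "a \<odot>\<^bsub>dsum\<^esub> f \<in> carrier dsum" if "a \<in> carrier K" "f \<in> carrier dsum"
    unfolding carrier_total
  proof (rule PiE_I)
    fix i assume "i \<in> I"
    then interpret module K "V i" by (rule module_V)
    show "(a \<odot>\<^bsub>dsum\<^esub> f) i \<in> carrier (V i)"
      using \<open>i \<in> I\<close> that by (simp add: smult_apply total_apply_closed)
  qed (simp add: direct_sum_def)
qed

lemma abelian_group_total: "abelian_group dsum"
proof (rule abelian_groupI)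
  fix f g h
  assume "f \<in> carrier dsum" "g \<in> carrier dsum" "h \<in> carrier dsum"
  then show "(f \<oplus>\<^bsub>dsum\<^esub> g) \<oplus>\<^bsub>dsum\<^esub> h = f \<oplus>\<^bsub>dsum\<^esub> (g \<oplus>\<^bsub>dsum\<^esub> h)"
    by (intro total_eqI)
      (auto simp: total_closed add_apply total_apply_closed abelian_monoid.a_assoc
        abelian_group.axioms(1)[OF abelian_group_V])
next
  fix f g
  assume "f \<in> carrier dsum" "g \<in> carrier dsum"
  then show "f \<oplus>\<^bsub>dsum\<^esub> g = g \<oplus>\<^bsub>dsum\<^esub> f"
    by (intro total_eqI)
      (auto simp: total_closed add_apply total_apply_closed
        intro: abelian_monoid.a_comm[OF abelian_group.axioms(1)[OF abelian_group_V]])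
next
  fix f
  assume f: "f \<in> carrier dsum"
  then show "\<zero>\<^bsub>dsum\<^esub> \<oplus>\<^bsub>dsum\<^esub> f = f"
    by (intro total_eqI)
      (auto simp: total_closed add_apply zero_apply total_apply_closed abelian_monoid.l_zero
        abelian_group.axioms(1)[OF abelian_group_V])
  have neg: "(\<lambda>i \<in> I. \<ominus>\<^bsub>V i\<^esub> f i) \<in> carrier dsum"
    using f abelian_group.a_inv_closed[OF abelian_group_V] by (auto simp: carrier_total PiE_iff)
  with f show "\<exists>g \<in> carrier dsum. g \<oplus>\<^bsub>dsum\<^esub> f = \<zero>\<^bsub>dsum\<^esub>"
    by (intro bexI[OF _ neg] total_eqI)
      (auto simp: total_closed add_apply zero_apply total_apply_closed
        abelian_group.l_neg[OF abelian_group_V])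
qed (auto simp: total_closed)

lemma module_total: "module K dsum"
  by (rule moduleI[OF cring_K abelian_group_total])
    (auto intro!: total_eqI simp: total_closed add_apply smult_apply total_apply_closed
      cring.cring_simprules[OF cring_K]
      module.smult_l_distr[OF module_V] module.smult_r_distr[OF module_V]
      module.smult_assoc1[OF module_V] module.smult_one[OF module_V])

lemma inj_apply: "i \<in> I \<Longrightarrow> inclusion j v i = (if i = j then v else \<zero>\<^bsub>V i\<^esub>)"
  by (simp add: summand_inj_def)

lemma inj_closed: "j \<in> I \<Longrightarrow> v \<in> carrier (V j) \<Longrightarrow> inclusion j v \<in> carrier dsum"
  by (auto simp: carrier_total summand_inj_def)

lemma inj_add:
  assumes "j \<in> I" "v \<in> carrier (V j)" "w \<in> carrier (V j)"
  shows "inclusion j (v \<oplus>\<^bsub>V j\<^esub> w) = inclusion j v \<oplus>\<^bsub>dsum\<^esub> inclusion j w"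
proof -
  interpret module K "V j" using assms by (simp add: module_V)
  have "\<zero>\<^bsub>V i\<^esub> \<oplus>\<^bsub>V i\<^esub> \<zero>\<^bsub>V i\<^esub> = \<zero>\<^bsub>V i\<^esub>" if "i \<in> I" for i
    using that abelian_monoid.l_zero[OF abelian_group.axioms(1)[OF abelian_group_V]] by simp
  then show ?thesis
    using assms by (intro total_eqI) (auto simp: inj_apply add_apply inj_closed total_closed)
qed

lemma inj_smult:
  assumes "j \<in> I" "v \<in> carrier (V j)" "a \<in> carrier K"
  shows "inclusion j (a \<odot>\<^bsub>V j\<^esub> v) = a \<odot>\<^bsub>dsum\<^esub> inclusion j v"
proof -
  interpret module K "V j" using assms by (simp add: module_V)
  show ?thesis
    using assms module.smult_r_null[OF module_V]
    by (intro total_eqI) (auto simp: inj_apply smult_apply inj_closed total_closed)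
qed

lemma mem_summand: "j \<in> I \<Longrightarrow> f \<in> summand I V j \<longleftrightarrow> f j \<in> carrier (V j) \<and> f = inclusion j (f j)"
  by (auto simp: summand_def inj_apply)

end

text \<open>The components of \<open>v\<close> at indices other than \<open>x\<close> contribute nothing to the component of \<open>f v\<close> at
  \<open>\<sigma> x\<close>, because \<open>\<sigma>\<close> is injective; they are removed from \<open>v\<close> one at a time.\<close>

lemma shifting_linear_map_apply:
  fixes V :: "'i \<Rightarrow> ('k, 'v) module" and U :: "'i \<Rightarrow> ('k, 'u) module"
  assumes V: "finite_direct_sum K I V" and U: "finite_direct_sum K I U"
    and f: "f \<in> linear_maps K (direct_sum I V) (direct_sum I U)"
    and \<sigma>: "inj_on \<sigma> I" "\<sigma> ` I \<subseteq> I"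
    and shift: "\<And>x. x \<in> I \<Longrightarrow> f ` summand I V x \<subseteq> summand I U (\<sigma> x)"
    and v: "v \<in> carrier (direct_sum I V)" and x: "x \<in> I"
  shows "f v (\<sigma> x) = f (summand_inj I V x (v x)) (\<sigma> x)"
proof -
  interpret V: finite_direct_sum K I V by fact
  interpret U: finite_direct_sum K I U by fact
  define rest where "rest = (\<lambda>y (v :: 'i \<Rightarrow> 'v). \<lambda>i \<in> I. if i = y then \<zero>\<^bsub>V i\<^esub> else v i)"
  have rest_apply: "rest y v i = (if i = y then \<zero>\<^bsub>V i\<^esub> else v i)" if "i \<in> I" for i y v
    using that by (simp add: rest_def)
  have rest: "rest y v \<in> carrier V.dsum" "v = V.inclusion y (v y) \<oplus>\<^bsub>V.dsum\<^esub> rest y v"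
    if "v \<in> carrier V.dsum" "y \<in> I" for v y
  proof -
    show *: "rest y v \<in> carrier V.dsum"
      using that by (auto simp: V.carrier_total rest_def)
    show "v = V.inclusion y (v y) \<oplus>\<^bsub>V.dsum\<^esub> rest y v"
    proof (rule V.total_eqI)
      fix i assume "i \<in> I"
      then interpret module K "V i" by (rule V.module_V)
      have "v i \<oplus>\<^bsub>V i\<^esub> \<zero>\<^bsub>V i\<^esub> = v i" "\<zero>\<^bsub>V i\<^esub> \<oplus>\<^bsub>V i\<^esub> v i = v i"
        using V.total_apply_closed[OF that(1) \<open>i \<in> I\<close>] by simp_all
      then show "v i = (V.inclusion y (v y) \<oplus>\<^bsub>V.dsum\<^esub> rest y v) i"
        using \<open>i \<in> I\<close> that V.total_apply_closed[of v i]
        by (cases "i = y") (auto simp: V.add_apply V.inj_apply rest_def)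
    qed (use * that in \<open>auto simp: V.total_closed V.inj_closed V.total_apply_closed\<close>)
  qed
  have split: "f v (\<sigma> x) = f (V.inclusion y (v y)) (\<sigma> x) \<oplus>\<^bsub>U (\<sigma> x)\<^esub> f (rest y v) (\<sigma> x)"
    if "v \<in> carrier V.dsum" "y \<in> I" for v y
  proof -
    have "V.inclusion y (v y) \<in> carrier V.dsum"
      using that by (simp add: V.inj_closed V.total_apply_closed)
    then have "f v = f (V.inclusion y (v y)) \<oplus>\<^bsub>U.dsum\<^esub> f (rest y v)"
      using rest[OF that] linear_map_add[OF f, of "V.inclusion y (v y)" "rest y v"] by simp
    then show ?thesis
      using \<sigma> x by (auto simp: U.add_apply)
  qed
  have \<sigma>x: "\<sigma> x \<in> I" using \<sigma> x by auto
  interpret Ux: module K "U (\<sigma> x)" by (rule U.module_V[OF \<sigma>x])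
  have vanish: "f v (\<sigma> x) = \<zero>\<^bsub>U (\<sigma> x)\<^esub>"
    if "finite F" "F \<subseteq> I" "x \<notin> F" "v \<in> carrier V.dsum" "\<And>y. y \<in> I - F \<Longrightarrow> v y = \<zero>\<^bsub>V y\<^esub>" for F v
    using that
  proof (induction F arbitrary: v)
    case empty
    then have "v = \<zero>\<^bsub>V.dsum\<^esub>"
      by (intro V.total_eqI) (auto simp: V.total_closed V.zero_apply)
    then show ?case
      using linear_map_zero[OF V.module_total U.module_total f] \<sigma>x by (simp add: U.zero_apply)
  next
    case (insert y F)
    have y: "y \<in> I" "\<sigma> y \<in> I" "\<sigma> y \<noteq> \<sigma> x"
      using insert.prems \<sigma> x by (auto dest: inj_onD)
    have "f (V.inclusion y (v y)) \<in> summand I U (\<sigma> y)"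
      using shift[OF y(1)] V.total_apply_closed[OF insert.prems(3) y(1)] by (auto simp: summand_def)
    then have "f (V.inclusion y (v y)) (\<sigma> x) = \<zero>\<^bsub>U (\<sigma> x)\<^esub>"
      using y \<sigma>x by (auto simp: summand_def U.inj_apply)
    moreover have "f (rest y v) (\<sigma> x) = \<zero>\<^bsub>U (\<sigma> x)\<^esub>"
      using insert.prems rest(1)[OF insert.prems(3) y(1)]
      by (intro insert.IH) (auto simp: rest_apply)
    ultimately show ?case
      using split[OF insert.prems(3) y(1)] by simp
  qed
  have "f (rest x v) (\<sigma> x) = \<zero>\<^bsub>U (\<sigma> x)\<^esub>"
    using V.finite_I rest(1)[OF v x] by (intro vanish[of "I - {x}"]) (auto simp: rest_apply x)
  moreover have "f (V.inclusion x (v x)) (\<sigma> x) \<in> carrier (U (\<sigma> x))"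
    using v x \<sigma>x V.inj_closed V.total_apply_closed linear_map_closed[OF f] U.total_apply_closed by simp
  ultimately show ?thesis
    using split[OF v x] by simp
qed


section \<open>Categories of representations\<close>

lemma
  assumes "is_representation K M A"
  shows rep_module: "module K (rep_space A)"
    and rep_linear: "b \<in> carrier M \<Longrightarrow> rep_act A b \<in> linear_maps K (rep_space A) (rep_space A)"
    and rep_mult: "a \<in> carrier M \<Longrightarrow> b \<in> carrier M \<Longrightarrow> v \<in> carrier (rep_space A) \<Longrightarrow>
      rep_act A (a \<otimes>\<^bsub>M\<^esub> b) v = rep_act A a (rep_act A b v)"
    and rep_one: "v \<in> carrier (rep_space A) \<Longrightarrow> rep_act A \<one>\<^bsub>M\<^esub> v = v"
  using assms
  by (auto simp: is_representation_def hom_def endomorphism_monoid_def compose_def Pi_iff)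

lemma rep_act_closed:
  "is_representation K M A \<Longrightarrow> b \<in> carrier M \<Longrightarrow> v \<in> carrier (rep_space A) \<Longrightarrow>
    rep_act A b v \<in> carrier (rep_space A)"
  using rep_linear linear_map_closed by metis

lemma is_representationI:
  assumes "module K (rep_space A)"
    and lin: "\<And>b. b \<in> carrier M \<Longrightarrow> rep_act A b \<in> linear_maps K (rep_space A) (rep_space A)"
    and mult: "\<And>a b v. a \<in> carrier M \<Longrightarrow> b \<in> carrier M \<Longrightarrow> v \<in> carrier (rep_space A) \<Longrightarrow>
      rep_act A (a \<otimes>\<^bsub>M\<^esub> b) v = rep_act A a (rep_act A b v)"
    and one: "\<And>v. v \<in> carrier (rep_space A) \<Longrightarrow> rep_act A \<one>\<^bsub>M\<^esub> v = v"
    and M: "\<one>\<^bsub>M\<^esub> \<in> carrier M" "\<And>a b. a \<in> carrier M \<Longrightarrow> b \<in> carrier M \<Longrightarrow> a \<otimes>\<^bsub>M\<^esub> b \<in> carrier M"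
  shows "is_representation K M A"
proof -
  have "rep_act A (a \<otimes>\<^bsub>M\<^esub> b) = compose (carrier (rep_space A)) (rep_act A a) (rep_act A b)"
    if "a \<in> carrier M" "b \<in> carrier M" for a b
    using linear_map_extensional[OF lin[OF M(2)[OF that]]] that
    by (intro extensionalityI[of _ "carrier (rep_space A)"]) (auto simp: compose_def mult)
  moreover have "rep_act A \<one>\<^bsub>M\<^esub> = (\<lambda>v \<in> carrier (rep_space A). v)"
    using linear_map_extensional[OF lin[OF M(1)]]
    by (intro extensionalityI[of _ "carrier (rep_space A)"]) (auto simp: one)
  ultimately show ?thesis
    using assms(1) lin by (auto simp: is_representation_def hom_def endomorphism_monoid_def)
qed

lemma
  assumes "f \<in> intertwiners K M A B"
  shows intertwiner_linear: "f \<in> linear_maps K (rep_space A) (rep_space B)"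
    and intertwiner_commute: "b \<in> carrier M \<Longrightarrow> v \<in> carrier (rep_space A) \<Longrightarrow>
      f (rep_act A b v) = rep_act B b (f v)"
  using assms by (auto simp: intertwiners_def)

lemma intertwiner_compose:
  assumes "is_representation K M A" "f \<in> intertwiners K M A B" "g \<in> intertwiners K M B C"
  shows "compose (carrier (rep_space A)) g f \<in> intertwiners K M A C"
  using assms linear_map_compose[OF _ _ rep_module]
  by (auto simp: intertwiners_def compose_def rep_act_closed linear_map_closed)

lemma intertwiner_id:
  assumes "is_representation K M A"
  shows "(\<lambda>v \<in> carrier (rep_space A). v) \<in> intertwiners K M A A"
proof -
  interpret module K "rep_space A" using assms by (rule rep_module)
  show ?thesis
    using assms by (auto simp: intertwiners_def rep_act_closed intro!: linear_mapsI)
qed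

lemma intertwiner_laws:
  assumes "f \<in> intertwiners K M A B"
  shows "compose (carrier (rep_space A)) f (\<lambda>v \<in> carrier (rep_space A). v) = f"
    and "compose (carrier (rep_space A)) (\<lambda>v \<in> carrier (rep_space B). v) f = f"
    and "compose (carrier (rep_space A)) h (compose (carrier (rep_space A)) g f)
      = compose (carrier (rep_space A)) (compose (carrier (rep_space B)) h g) f"
proof -
  have f: "f \<in> carrier (rep_space A) \<rightarrow> carrier (rep_space B)" "f \<in> extensional (carrier (rep_space A))"
    using linear_map_PiE[OF intertwiner_linear[OF assms]] by (auto simp: PiE_def)
  show "compose (carrier (rep_space A)) f (\<lambda>v \<in> carrier (rep_space A). v) = f"
    using f by (rule compose_Id)
  show "compose (carrier (rep_space A)) (\<lambda>v \<in> carrier (rep_space B). v) f = f"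
    using f by (rule Id_compose)
  show "compose (carrier (rep_space A)) h (compose (carrier (rep_space A)) g f)
      = compose (carrier (rep_space A)) (compose (carrier (rep_space B)) h g) f"
    using f by (intro compose_assoc) auto
qed

lemma category_rep_category: "category (rep_category K M)"
  by standard
    (auto simp: rep_category_def intertwiner_id intertwiner_compose intertwiner_laws)

lemma rep_category_isomorphismI:
  assumes "is_representation K M A" "is_representation K M B"
    and "f \<in> intertwiners K M A B" "g \<in> intertwiners K M B A"
    and "\<And>v. v \<in> carrier (rep_space A) \<Longrightarrow> g (f v) = v" "\<And>v. v \<in> carrier (rep_space B) \<Longrightarrow> f (g v) = v"
  shows "isomorphism_in (rep_category K M) A B f"
  using assms unfolding isomorphism_in_def rep_category_def
  by (auto simp: compose_def intro!: bexI[of _ g] restrict_ext)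

section \<open>Graded representations by components\<close>

type_synonym ('k, 'v, 'w) coset_graded =
  "('k, 'v, 'w group_word set, 'w set) graded_representation"

locale graded_setup = parabolic_coxeter W S J
  for W :: "'w monoid" (structure) and S J :: "'w set" +
  fixes K :: "'k ring" and pos :: bool
  assumes field_K: "field K"
begin

abbreviation "M \<equiv> braid_part W S pos"
abbreviation "MJ \<equiv> braid_part (parabolic W J) J pos"
abbreviation graded :: "('k, 'v, 'w) coset_graded \<Rightarrow> bool" where
  "graded A \<equiv> is_graded_representation K W S J M A"
abbreviation "inc A \<equiv> summand_inj X (grade A)"
abbreviation "graded_sum A \<equiv> direct_sum X (grade A)"

lemma cring_K: "cring K"
  using field_K by (simp add: field.axioms(1) domain.axioms(1))

lemma M_subset [simp]: "b \<in> carrier M \<Longrightarrow> b \<in> carrier B"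
  using braid_part_subset[of W S pos] by auto

lemma MJ_subset [simp]: "b \<in> carrier MJ \<Longrightarrow> b \<in> carrier BJ"
  using braid_part_subset[of "parabolic W J" J pos] by auto

lemma coset_bar_closed [simp]: "b \<in> carrier B \<Longrightarrow> x \<in> X \<Longrightarrow> bar b <# x \<in> X"
  by simp

lemma \<sigma>_in_M [simp]: "s \<in> S \<Longrightarrow> \<sigma> s \<in> carrier M"
  by (rule braid_generator_in_part)

lemma \<iota>_in_M [simp]: "b \<in> carrier MJ \<Longrightarrow> \<iota> b \<in> carrier M"
  by (rule \<iota>_in_part)

lemma cocycle_in_MJ [simp]: "b \<in> carrier M \<Longrightarrow> x \<in> X \<Longrightarrow> cocycle b x \<in> carrier MJ"
  by (rule cocycle_in_part)

lemma lift_in_M [simp]: "w \<in> carrier W \<Longrightarrow> lift w \<in> carrier M"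
  by (rule lift_in_part)

lemma graded_module: "graded A \<Longrightarrow> x \<in> X \<Longrightarrow> module K (grade A x)"
  by (simp add: is_graded_representation_def)

lemma graded_dsum: "graded A \<Longrightarrow> finite_direct_sum K X (grade A)"
  by (simp add: finite_direct_sum_def cring_K finite_cosets graded_module)

lemma graded_rep: "graded A \<Longrightarrow> is_representation K M (total_rep X A)"
  by (simp add: is_graded_representation_def)

lemma total_act_linear:
  "graded A \<Longrightarrow> b \<in> carrier M \<Longrightarrow> total_act A b \<in> linear_maps K (graded_sum A) (graded_sum A)"
  using rep_linear[OF graded_rep] by (simp add: total_rep_def)

lemma total_act_summand:
  assumes "graded A" "b \<in> carrier M" "x \<in> X"
  shows "total_act A b ` summand X (grade A) x \<subseteq> summand X (grade A) (bar b <# x)"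
  using assms by (simp add: is_graded_representation_def)

text \<open>The matrix entry of \<open>b\<close> from the component \<open>x\<close> to the component \<open>bar b <# x\<close>. All other entries in
  this column vanish, so the entries determine the action.\<close>

definition action ::
  "('k, 'v, 'w) coset_graded \<Rightarrow> 'w group_word set \<Rightarrow> 'w set \<Rightarrow> 'v \<Rightarrow> 'v"
  where "action A b x = (\<lambda>v \<in> carrier (grade A x). total_act A b (inc A x v) (bar b <# x))"

lemma total_act_inc:
  assumes "graded A" "b \<in> carrier M" "x \<in> X" "v \<in> carrier (grade A x)"
  shows "total_act A b (inc A x v) = inc A (bar b <# x) (action A b x v)"
    and action_closed: "action A b x v \<in> carrier (grade A (bar b <# x))"
proof -
  interpret finite_direct_sum K X "grade A" by (rule graded_dsum[OF assms(1)])
  have "total_act A b (inc A x v) \<in> summand X (grade A) (bar b <# x)"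
    using total_act_summand[OF assms(1-3)] assms(4) by (auto simp: summand_def)
  then show "total_act A b (inc A x v) = inc A (bar b <# x) (action A b x v)"
    "action A b x v \<in> carrier (grade A (bar b <# x))"
    using assms mem_summand[of "bar b <# x"] by (auto simp: action_def)
qed

lemma total_act_apply:
  assumes "graded A" "b \<in> carrier M" "v \<in> carrier (graded_sum A)" "x \<in> X"
  shows "total_act A b v (bar b <# x) = action A b x (v x)"
proof -
  have V: "finite_direct_sum K X (grade A)" by (rule graded_dsum[OF assms(1)])
  then have "v x \<in> carrier (grade A x)"
    using assms by (simp add: finite_direct_sum.total_apply_closed)
  moreover have "total_act A b v (bar b <# x) = total_act A b (inc A x (v x)) (bar b <# x)"
    using assms by (intro shifting_linear_map_apply[OF V V total_act_linear, where \<sigma> = "\<lambda>x. bar b <# x"])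
      (auto simp: coset_act_inj total_act_summand intro!: inj_onI)
  ultimately show ?thesis by (simp add: action_def)
qed

lemma action_linear:
  assumes "graded A" "b \<in> carrier M" "x \<in> X"
  shows "action A b x \<in> linear_maps K (grade A x) (grade A (bar b <# x))"
proof -
  interpret finite_direct_sum K X "grade A" by (rule graded_dsum[OF assms(1)])
  interpret module K "grade A x" using graded_module[OF assms(1,3)] .
  note lin = linear_map_add[OF total_act_linear[OF assms(1,2)]]
    linear_map_smult[OF total_act_linear[OF assms(1,2)]]
  show ?thesis
  proof (rule linear_mapsI)
    show "action A b x \<in> carrier (grade A x) \<rightarrow>\<^sub>E carrier (grade A (bar b <# x))"
      using action_closed[OF assms] by (auto simp: action_def)
  next
    fix u v
    assume "u \<in> carrier (grade A x)" "v \<in> carrier (grade A x)"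
    then show "action A b x (u \<oplus>\<^bsub>grade A x\<^esub> v) =
      action A b x u \<oplus>\<^bsub>grade A (bar b <# x)\<^esub> action A b x v"
      using assms by (simp add: action_def inj_add inj_closed lin add_apply)
  next
    fix a v
    assume "a \<in> carrier K" "v \<in> carrier (grade A x)"
    then show "action A b x (a \<odot>\<^bsub>grade A x\<^esub> v) = a \<odot>\<^bsub>grade A (bar b <# x)\<^esub> action A b x v"
      using assms by (simp add: action_def inj_smult inj_closed lin smult_apply)
  qed
qed

lemma action_one:
  assumes "graded A" "x \<in> X" "v \<in> carrier (grade A x)"
  shows "action A \<one>\<^bsub>B\<^esub> x v = v"
proof -
  interpret finite_direct_sum K X "grade A" by (rule graded_dsum[OF assms(1)])
  have "total_act A \<one>\<^bsub>B\<^esub> (inc A x v) = inc A x v"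
    using rep_one[OF graded_rep[OF assms(1)]] inj_closed[OF assms(2,3)] by (simp add: total_rep_def)
  then show ?thesis
    using assms by (simp add: action_def inj_apply)
qed

lemma action_mult:
  assumes "graded A" "a \<in> carrier M" "b \<in> carrier M" "x \<in> X" "v \<in> carrier (grade A x)"
  shows "action A (a \<otimes>\<^bsub>B\<^esub> b) x v = action A a (bar b <# x) (action A b x v)"
proof -
  interpret finite_direct_sum K X "grade A" by (rule graded_dsum[OF assms(1)])
  have "total_act A (a \<otimes>\<^bsub>B\<^esub> b) (inc A x v) = total_act A a (total_act A b (inc A x v))"
    using rep_mult[OF graded_rep[OF assms(1)] assms(2,3)] inj_closed[OF assms(4,5)]
    by (simp add: total_rep_def)
  also have "\<dots> = total_act A a (inc A (bar b <# x) (action A b x v))"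
    by (simp only: total_act_inc[OF assms(1,3-5)])
  finally have "total_act A (a \<otimes>\<^bsub>B\<^esub> b) (inc A x v) (bar (a \<otimes>\<^bsub>B\<^esub> b) <# x)
      = total_act A a (inc A (bar b <# x) (action A b x v)) (bar a <# (bar b <# x))"
    using assms by (simp add: coset_act_mult)
  then show ?thesis
    using assms(5) action_closed[OF assms(1,3-5)] unfolding action_def[of A _ "bar b <# x"]
      action_def[of A "a \<otimes>\<^bsub>B\<^esub> b"] by simp
qed

lemma generator_coset_square: "s \<in> S \<Longrightarrow> x \<in> X \<Longrightarrow> s <# (s <# x) = x"
  using coset_act_mult[of s s x] by (simp add: generator_square)

lemma action_square:
  assumes "graded A" "s \<in> S" "x \<in> X" "s <# x \<noteq> x" "v \<in> carrier (grade A x)"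
  shows "action A (\<sigma> s) (s <# x) (action A (\<sigma> s) x v) = v"
proof -
  interpret finite_direct_sum K X "grade A" by (rule graded_dsum[OF assms(1)])
  have "inc A x v \<in> summand X (grade A) x"
    using assms by (auto simp: summand_def)
  then have "total_act A (\<sigma> s) (total_act A (\<sigma> s) (inc A x v)) = inc A x v"
    using assms by (simp add: is_graded_representation_def)
  moreover have "total_act A (\<sigma> s) (total_act A (\<sigma> s) (inc A x v))
      = inc A x (action A (\<sigma> s) (s <# x) (action A (\<sigma> s) x v))"
    using total_act_inc[OF assms(1) _ assms(3,5), of "\<sigma> s"]
      action_closed[OF assms(1) _ assms(3,5), of "\<sigma> s"]
      total_act_inc[OF assms(1), of "\<sigma> s" "s <# x" "action A (\<sigma> s) x v"] assms
    by (simp add: generator_coset_square)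
  ultimately have "inc A x (action A (\<sigma> s) (s <# x) (action A (\<sigma> s) x v)) x = inc A x v x"
    by simp
  then show ?thesis
    using assms by (simp add: inj_apply)
qed

text \<open>Identification of all components with the one at the base coset: a minimal representative
  acts through its positive lift, which is a product of generators that move the coset at each
  step and hence act invertibly.\<close>

definition \<theta> where "\<theta> A x = action A (lift (rep x)) x\<^sub>0"

lemma rep_base [simp]: "x \<in> X \<Longrightarrow> rep x <# x\<^sub>0 = x"
  by (simp add: lcos_mult_one WJ.subset)

lemma \<theta>_linear:
  assumes "graded A" "x \<in> X"
  shows "\<theta> A x \<in> linear_maps K (grade A x\<^sub>0) (grade A x)"
  using action_linear[OF assms(1), of "lift (rep x)" x\<^sub>0] assms(2) by (simp add: \<theta>_def)

lemma \<theta>_base: "graded A \<Longrightarrow> v \<in> carrier (grade A x\<^sub>0) \<Longrightarrow> \<theta> A x\<^sub>0 v = v"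
  by (simp add: \<theta>_def action_one del: rep_base)

lemma \<theta>_move:
  assumes "graded A" "s \<in> S" "x \<in> X" "lift (rep (s <# x)) = \<sigma> s \<otimes>\<^bsub>B\<^esub> lift (rep x)"
    and "v \<in> carrier (grade A x\<^sub>0)"
  shows "\<theta> A (s <# x) v = action A (\<sigma> s) x (\<theta> A x v)"
  using action_mult[OF assms(1), of "\<sigma> s" "lift (rep x)" x\<^sub>0 v] assms by (simp add: \<theta>_def)

lemma \<theta>_bij:
  assumes A: "graded A" and "x \<in> X"
  shows "bij_betw (\<theta> A x) (carrier (grade A x\<^sub>0)) (carrier (grade A x))"
  using assms(2)
proof (induction rule: coset_induct)
  case base
  have "bij_betw id (carrier (grade A x\<^sub>0)) (carrier (grade A x\<^sub>0))" by simp
  then show ?case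
    by (rule bij_betw_cong[THEN iffD1, rotated]) (simp add: \<theta>_base A)
next
  case (move s x)
  have moved: "s <# (s <# x) \<noteq> s <# x"
    using move by (simp add: generator_coset_square)
  have "bij_betw (action A (\<sigma> s) x) (carrier (grade A x)) (carrier (grade A (s <# x)))"
    using move moved action_square[OF A, of s x] action_square[OF A, of s "s <# x"]
      action_closed[OF A, of "\<sigma> s" x] action_closed[OF A, of "\<sigma> s" "s <# x"]
    by (intro bij_betw_byWitness[where f' = "action A (\<sigma> s) (s <# x)"])
      (auto simp: generator_coset_square)
  with move.IH have "bij_betw (action A (\<sigma> s) x \<circ> \<theta> A x) (carrier (grade A x\<^sub>0)) (carrier (grade A (s <# x)))"
    by (rule bij_betw_trans)
  then show ?case
    by (rule bij_betw_cong[THEN iffD1, rotated]) (simp add: \<theta>_move[OF A move(1,2,4)])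
qed

lemma \<theta>_closed [simp]:
  "graded A \<Longrightarrow> x \<in> X \<Longrightarrow> v \<in> carrier (grade A x\<^sub>0) \<Longrightarrow> \<theta> A x v \<in> carrier (grade A x)"
  using linear_map_closed[OF \<theta>_linear] .

abbreviation "base_action A c \<equiv> action A (\<iota> c) x\<^sub>0"

lemma base_action_closed:
  "graded A \<Longrightarrow> c \<in> carrier MJ \<Longrightarrow> v \<in> carrier (grade A x\<^sub>0) \<Longrightarrow>
    base_action A c v \<in> carrier (grade A x\<^sub>0)"
  using action_closed[of A "\<iota> c" x\<^sub>0 v] by (simp add: \<iota>_base_coset)

lemma base_action_mult:
  "graded A \<Longrightarrow> c \<in> carrier MJ \<Longrightarrow> d \<in> carrier MJ \<Longrightarrow> v \<in> carrier (grade A x\<^sub>0) \<Longrightarrow>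
    base_action A (c \<otimes>\<^bsub>BJ\<^esub> d) v = base_action A c (base_action A d v)"
  using action_mult[of A "\<iota> c" "\<iota> d" x\<^sub>0 v] by (simp add: \<iota>_base_coset)

lemma base_action_one: "graded A \<Longrightarrow> v \<in> carrier (grade A x\<^sub>0) \<Longrightarrow> base_action A \<one>\<^bsub>BJ\<^esub> v = v"
  by (simp add: action_one)

text \<open>On generators, the cases of the cocycle match the two rules for lifts of representatives. If \<open>s\<close>
  moves \<open>x\<close> and \<open>s <# x\<close> has the shorter representative, the condition on squares enters.\<close>

lemma \<theta>_commute_generator:
  assumes A: "graded A" and s: "s \<in> S" and x: "x \<in> X" and u: "u \<in> carrier (grade A x\<^sub>0)"
  shows "action A (\<sigma> s) x (\<theta> A x u) = \<theta> A (s <# x) (base_action A (cocycle (\<sigma> s) x) u)"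
proof (cases "s <# x = x")
  case True
  have c: "cocycle (\<sigma> s) x \<in> carrier MJ"
    using s x by simp
  have "action A (\<sigma> s) x (\<theta> A x u) = action A (\<sigma> s \<otimes>\<^bsub>B\<^esub> lift (rep x)) x\<^sub>0 u"
    using A s x u action_mult[of A "\<sigma> s" "lift (rep x)" x\<^sub>0 u] by (simp add: \<theta>_def)
  also have "\<dots> = action A (lift (rep x) \<otimes>\<^bsub>B\<^esub> \<iota> (cocycle (\<sigma> s) x)) x\<^sub>0 u"
    using lift_rep_fixed[OF s x True] by simp
  also have "\<dots> = \<theta> A x (base_action A (cocycle (\<sigma> s) x) u)"
    using A s x u c action_mult[of A "lift (rep x)" "\<iota> (cocycle (\<sigma> s) x)" x\<^sub>0 u]
    by (simp add: \<theta>_def \<iota>_base_coset)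
  finally show ?thesis using True by simp
next
  case False
  then have "inv (rep x) \<otimes> s \<otimes> rep x \<notin> WJ"
    using generator_moves_coset s x by simp
  then have c: "cocycle (\<sigma> s) x = \<one>\<^bsub>BJ\<^esub>"
    using s x by (simp add: cocycle_\<sigma> step_def)
  have "action A (\<sigma> s) x (\<theta> A x u) = \<theta> A (s <# x) u"
    using lift_rep_move[OF s x False]
  proof
    assume "lift (rep (s <# x)) = \<sigma> s \<otimes>\<^bsub>B\<^esub> lift (rep x)"
    then show ?thesis using \<theta>_move[OF A s x _ u] by simp
  next
    assume *: "lift (rep x) = \<sigma> s \<otimes>\<^bsub>B\<^esub> lift (rep (s <# x))"
    then have "\<theta> A x u = action A (\<sigma> s) (s <# x) (\<theta> A (s <# x) u)"
      using \<theta>_move[OF A s _ _ u, of "s <# x"] s x by (simp add: generator_coset_square)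
    then show ?thesis
      using action_square[OF A s, of "s <# x" "\<theta> A (s <# x) u"] A s x u False
      by (simp add: generator_coset_square)
  qed
  then show ?thesis
    using A u by (simp add: c action_one)
qed

text \<open>Both sides are multiplicative in \<open>b\<close>, the right-hand side by the cocycle rule, so that the case
  of generators suffices.\<close>

lemma \<theta>_commute:
  assumes A: "graded A" and "b \<in> carrier M" "x \<in> X" "u \<in> carrier (grade A x\<^sub>0)"
  shows "action A b x (\<theta> A x u) = \<theta> A (bar b <# x) (base_action A (cocycle b x) u)"
  using assms(2-)
proof (induction arbitrary: x u rule: braid_part_induct)
  case one
  then show ?case using A by (simp add: action_one)
next
  case (generator s)
  then show ?case using \<theta>_commute_generator[OF A] by simp
next
  case (mult a b)
  let ?y = "bar b <# x"
  have closed: "a \<in> carrier B" "b \<in> carrier B" "?y \<in> X"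
    "base_action A (cocycle b x) u \<in> carrier (grade A x\<^sub>0)"
    using mult base_action_closed[OF A] by auto
  have "action A (a \<otimes>\<^bsub>B\<^esub> b) x (\<theta> A x u) = action A a ?y (action A b x (\<theta> A x u))"
    using mult A by (intro action_mult) auto
  also have "\<dots> = \<theta> A (bar a <# ?y) (base_action A (cocycle a ?y) (base_action A (cocycle b x) u))"
    using mult closed by simp
  also have "\<dots> = \<theta> A (bar a <# ?y) (base_action A (cocycle (a \<otimes>\<^bsub>B\<^esub> b) x) u)"
    using mult closed base_action_mult[OF A, of "cocycle a ?y" "cocycle b x" u] by (simp add: cocycle_mult)
  also have "bar a <# ?y = bar (a \<otimes>\<^bsub>B\<^esub> b) <# x"
    using mult closed by (simp add: coset_act_mult)
  finally show ?case .
next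
  case (inv a)
  have aB: "a \<in> carrier M" "a \<in> carrier B" "inv\<^bsub>B\<^esub> a \<in> carrier M"
    using inv(1,2) braid_part_inv_closed[of pos a W S] braid_part_subset[of W S pos] by auto
  \<comment> \<open>The claim for \<open>inv a\<close> at \<open>x\<close> follows from the claim for \<open>a\<close> at the coset \<open>y\<close> that \<open>a\<close> sends to \<open>x\<close>.\<close>
  define y where "y = bar (inv\<^bsub>B\<^esub> a) <# x"
  have y: "y \<in> X" "bar a <# y = x"
    using aB inv.prems by (auto simp: y_def coset_act_inv)
  have "cocycle (inv\<^bsub>B\<^esub> a) x = inv\<^bsub>BJ\<^esub> (cocycle a y)"
    using cocycle_inv[of a y] aB y by simp
  then have cc: "cocycle a y \<otimes>\<^bsub>BJ\<^esub> cocycle (inv\<^bsub>B\<^esub> a) x = \<one>\<^bsub>BJ\<^esub>"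
    using aB y by simp
  define w where "w = base_action A (cocycle (inv\<^bsub>B\<^esub> a) x) u"
  have w: "w \<in> carrier (grade A x\<^sub>0)"
    unfolding w_def using aB inv.prems by (intro base_action_closed[OF A]) auto
  have "base_action A (cocycle a y) w = u"
    unfolding w_def using base_action_mult[OF A, of "cocycle a y" "cocycle (inv\<^bsub>B\<^esub> a) x" u] inv.prems aB y cc
      base_action_one[OF A] by simp
  then have "action A a y (\<theta> A y w) = \<theta> A x u"
    using inv.IH[OF y(1) w] y by simp
  then have "action A (inv\<^bsub>B\<^esub> a) x (\<theta> A x u) = action A (inv\<^bsub>B\<^esub> a) (bar a <# y) (action A a y (\<theta> A y w))"
    using y by simp
  also have "\<dots> = action A (inv\<^bsub>B\<^esub> a \<otimes>\<^bsub>B\<^esub> a) y (\<theta> A y w)"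
    using A aB y w by (intro action_mult[symmetric]) auto
  also have "\<dots> = \<theta> A y w"
    using A aB y w by (simp add: action_one)
  finally show ?case by (simp add: y_def w_def)
qed


subsection \<open>Morphisms by components\<close>

definition component where
  "component A f x = (\<lambda>v \<in> carrier (grade A x). f (inc A x v) x)"

lemma graded_intertwinerD:
  assumes "f \<in> graded_intertwiners K M X A A'"
  shows "f \<in> linear_maps K (graded_sum A) (graded_sum A')"
    and "b \<in> carrier M \<Longrightarrow> v \<in> carrier (graded_sum A) \<Longrightarrow> f (total_act A b v) = total_act A' b (f v)"
    and "x \<in> X \<Longrightarrow> f ` summand X (grade A) x \<subseteq> summand X (grade A') x"
  using assms by (auto simp: graded_intertwiners_def intertwiners_def total_rep_def)

context
  fixes A A' :: "('k, 'v, 'w) coset_graded" and f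
  assumes A: "graded A" and A': "graded A'" and f: "f \<in> graded_intertwiners K M X A A'"
begin

interpretation D: finite_direct_sum K X "grade A" by (rule graded_dsum[OF A])
interpretation D': finite_direct_sum K X "grade A'" by (rule graded_dsum[OF A'])

lemma component_inc:
  assumes "x \<in> X" "v \<in> carrier (grade A x)"
  shows "f (inc A x v) = inc A' x (component A f x v)"
    and component_closed: "component A f x v \<in> carrier (grade A' x)"
proof -
  have "f (inc A x v) \<in> summand X (grade A') x"
    using graded_intertwinerD(3)[OF f assms(1)] assms(2) by (auto simp: summand_def)
  then show "f (inc A x v) = inc A' x (component A f x v)" "component A f x v \<in> carrier (grade A' x)"
    using assms D'.mem_summand by (auto simp: component_def)
qed

lemma component_apply:
  assumes "v \<in> carrier (graded_sum A)" "x \<in> X"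
  shows "f v x = component A f x (v x)"
proof -
  have "f v x = f (inc A x (v x)) x"
    using shifting_linear_map_apply[OF D.finite_direct_sum_axioms D'.finite_direct_sum_axioms
        graded_intertwinerD(1)[OF f], of "\<lambda>x. x" v x] graded_intertwinerD(3)[OF f] assms
    by simp
  then show ?thesis
    using assms D.total_apply_closed by (simp add: component_def)
qed

lemma component_linear:
  assumes "x \<in> X"
  shows "component A f x \<in> linear_maps K (grade A x) (grade A' x)"
proof (rule linear_mapsI)
  interpret module K "grade A x" using graded_module[OF A assms] .
  note lin = linear_map_add[OF graded_intertwinerD(1)[OF f]] linear_map_smult[OF graded_intertwinerD(1)[OF f]]
  show "component A f x \<in> carrier (grade A x) \<rightarrow>\<^sub>E carrier (grade A' x)"
    using component_closed[OF assms] by (auto simp: component_def)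
  show "component A f x (u \<oplus>\<^bsub>grade A x\<^esub> v) = component A f x u \<oplus>\<^bsub>grade A' x\<^esub> component A f x v"
    if "u \<in> carrier (grade A x)" "v \<in> carrier (grade A x)" for u v
    using assms that by (simp add: component_def D.inj_add D.inj_closed lin D'.add_apply)
  show "component A f x (a \<odot>\<^bsub>grade A x\<^esub> v) = a \<odot>\<^bsub>grade A' x\<^esub> component A f x v"
    if "a \<in> carrier K" "v \<in> carrier (grade A x)" for a v
    using assms that by (simp add: component_def D.inj_smult D.inj_closed lin D'.smult_apply)
qed

lemma component_action:
  assumes "b \<in> carrier M" "x \<in> X" "v \<in> carrier (grade A x)"
  shows "component A f (bar b <# x) (action A b x v) = action A' b x (component A f x v)"
proof -
  have "f (total_act A b (inc A x v)) (bar b <# x) = total_act A' b (f (inc A x v)) (bar b <# x)"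
    using graded_intertwinerD(2)[OF f assms(1)] D.inj_closed assms by simp
  moreover have "f (total_act A b (inc A x v)) (bar b <# x)
      = component A f (bar b <# x) (action A b x v)"
    using assms total_act_inc[OF A assms] component_inc[OF _ action_closed[OF A assms]]
    by (simp add: D'.inj_apply)
  moreover have "total_act A' b (f (inc A x v)) (bar b <# x) = action A' b x (component A f x v)"
    using assms component_inc[OF assms(2,3)] component_closed[OF assms(2,3)]
    by (simp add: action_def)
  ultimately show ?thesis by simp
qed

lemma component_\<theta>:
  assumes "x \<in> X" "u \<in> carrier (grade A x\<^sub>0)"
  shows "component A f x (\<theta> A x u) = \<theta> A' x (component A f x\<^sub>0 u)"
  using component_action[of "lift (rep x)" x\<^sub>0 u] assms by (simp add: \<theta>_def)

end

lemma graded_intertwiner_of_family: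
  assumes A: "graded A" and A': "graded A'"
    and \<phi>: "\<And>x. x \<in> X \<Longrightarrow> \<phi> x \<in> linear_maps K (grade A x) (grade A' x)"
    and commute: "\<And>b x v. b \<in> carrier M \<Longrightarrow> x \<in> X \<Longrightarrow> v \<in> carrier (grade A x) \<Longrightarrow>
      \<phi> (bar b <# x) (action A b x v) = action A' b x (\<phi> x v)"
  defines "f \<equiv> (\<lambda>v \<in> carrier (graded_sum A). \<lambda>x \<in> X. \<phi> x (v x))"
  shows "f \<in> graded_intertwiners K M X A A'"
    and "x \<in> X \<Longrightarrow> component A f x = \<phi> x"
proof -
  interpret D: finite_direct_sum K X "grade A" by (rule graded_dsum[OF A])
  interpret D': finite_direct_sum K X "grade A'" by (rule graded_dsum[OF A'])
  have f_apply: "f v x = \<phi> x (v x)" if "v \<in> carrier D.dsum" "x \<in> X" for v x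
    using that by (simp add: f_def)
  have f_closed: "f v \<in> carrier D'.dsum" if "v \<in> carrier D.dsum" for v
    using that linear_map_closed[OF \<phi>] D.total_apply_closed by (auto simp: f_def D'.carrier_total)
  have f_linear: "f \<in> linear_maps K D.dsum D'.dsum"
  proof (rule linear_mapsI)
    show "f \<in> carrier D.dsum \<rightarrow>\<^sub>E carrier D'.dsum"
      using f_closed by (auto simp: f_def)
    show "f (u \<oplus>\<^bsub>D.dsum\<^esub> v) = f u \<oplus>\<^bsub>D'.dsum\<^esub> f v"
      if "u \<in> carrier D.dsum" "v \<in> carrier D.dsum" for u v
      using that f_closed D.total_apply_closed
      by (intro D'.total_eqI) (auto simp: D.total_closed D'.total_closed f_apply D.add_apply
          D'.add_apply linear_map_add[OF \<phi>])
    show "f (a \<odot>\<^bsub>D.dsum\<^esub> v) = a \<odot>\<^bsub>D'.dsum\<^esub> f v"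
      if "a \<in> carrier K" "v \<in> carrier D.dsum" for a v
      using that f_closed D.total_apply_closed
      by (intro D'.total_eqI) (auto simp: D.total_closed D'.total_closed f_apply D.smult_apply
          D'.smult_apply linear_map_smult[OF \<phi>])
  qed
  have "f (total_act A b v) = total_act A' b (f v)" if b: "b \<in> carrier M" and v: "v \<in> carrier D.dsum" for b v
  proof (rule D'.total_eqI)
    have bv: "total_act A b v \<in> carrier D.dsum"
      using linear_map_closed[OF total_act_linear[OF A b] v] .
    then show "f (total_act A b v) \<in> carrier D'.dsum" by (rule f_closed)
    show "total_act A' b (f v) \<in> carrier D'.dsum"
      using linear_map_closed[OF total_act_linear[OF A' b]] f_closed[OF v] by simp
    fix y
    assume "y \<in> X"
    define x where "x = inv (bar b) <# y"
    have x: "x \<in> X" "bar b <# x = y"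
      using \<open>y \<in> X\<close> b by (auto simp: x_def coset_act_inv)
    have "f (total_act A b v) (bar b <# x) = total_act A' b (f v) (bar b <# x)"
      using x(1) b v bv f_closed D.total_apply_closed
      by (simp add: f_apply total_act_apply[OF A] total_act_apply[OF A'] commute)
    then show "f (total_act A b v) y = total_act A' b (f v) y" using x by simp
  qed
  moreover have "f (inc A x v) \<in> summand X (grade A') x" if "x \<in> X" "v \<in> carrier (grade A x)" for x v
  proof -
    have "f (inc A x v) = inc A' x (\<phi> x v)"
    proof (rule D'.total_eqI)
      fix y
      assume "y \<in> X"
      then show "f (inc A x v) y = inc A' x (\<phi> x v) y"
        using that linear_map_zero[OF graded_module[OF A] graded_module[OF A'] \<phi>, of y]
        by (simp add: f_apply D.inj_closed D.inj_apply D'.inj_apply)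
    qed (use that f_closed D.inj_closed D'.inj_closed linear_map_closed[OF \<phi>] in auto)
    then show ?thesis
      using that linear_map_closed[OF \<phi>] by (auto simp: summand_def)
  qed
  ultimately show "f \<in> graded_intertwiners K M X A A'"
    using f_linear by (auto simp: graded_intertwiners_def intertwiners_def total_rep_def summand_def)
  show "component A f x = \<phi> x" if "x \<in> X"
    using linear_map_extensional[OF \<phi>[OF that]] that
    by (intro extensionalityI[of _ "carrier (grade A x)"])
      (auto simp: component_def f_apply D.inj_closed D.inj_apply)
qed

end

section \<open>The equivalence\<close>

context graded_setup
begin

abbreviation graded_category ::
  "(('k, 'v, 'w) coset_graded, ('w set \<Rightarrow> 'v) \<Rightarrow> ('w set \<Rightarrow> 'v)) category"
  where "graded_category \<equiv> graded_rep_category K W S J M"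
abbreviation base_category :: "(('k, 'v, 'w group_word set) representation, 'v \<Rightarrow> 'v) category"
  where "base_category \<equiv> rep_category K MJ"
abbreviation "F \<equiv> base_functor W S J"

lemma graded_compose:
  fixes A A' A'' :: "('k, 'v, 'w) coset_graded"
  assumes "graded A" "f \<in> graded_intertwiners K M X A A'" "g \<in> graded_intertwiners K M X A' A''"
  shows "compose (carrier (graded_sum A)) g f \<in> graded_intertwiners K M X A A''"
proof -
  interpret finite_direct_sum K X "grade A" by (rule graded_dsum[OF assms(1)])
  have "compose (carrier (graded_sum A)) g f \<in> intertwiners K M (total_rep X A) (total_rep X A'')"
    using intertwiner_compose[OF graded_rep[OF assms(1)], of f "total_rep X A'" g "total_rep X A''"] assms(2,3)
    by (auto simp: graded_intertwiners_def total_rep_def)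
  moreover have "compose (carrier (graded_sum A)) g f ` summand X (grade A) x \<subseteq> summand X (grade A'') x"
    if x: "x \<in> X" for x
  proof
    fix v
    assume "v \<in> compose (carrier (graded_sum A)) g f ` summand X (grade A) x"
    then obtain u where u: "u \<in> summand X (grade A) x" "v = compose (carrier (graded_sum A)) g f u"
      by blast
    then have "u \<in> carrier (graded_sum A)"
      using inj_closed[OF x] by (auto simp: summand_def)
    then have "v = g (f u)" using u by (simp add: compose_def)
    then show "v \<in> summand X (grade A'') x"
      using graded_intertwinerD(3)[OF assms(2) x] graded_intertwinerD(3)[OF assms(3) x] u by blast
  qed
  ultimately show ?thesis by (simp add: graded_intertwiners_def)
qed

lemma graded_id:
  assumes "graded A"
  shows "(\<lambda>v \<in> carrier (graded_sum A). v) \<in> graded_intertwiners K M X A A"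
proof -
  interpret finite_direct_sum K X "grade A" by (rule graded_dsum[OF assms(1)])
  have "(\<lambda>v \<in> carrier (graded_sum A). v) \<in> intertwiners K M (total_rep X A) (total_rep X A)"
    using intertwiner_id[OF graded_rep[OF assms]] by (simp add: total_rep_def)
  then show ?thesis
    using inj_closed by (auto simp: graded_intertwiners_def summand_def)
qed

lemma category_graded_category: "category graded_category"
proof -
  have laws: "compose (carrier (graded_sum A)) f (\<lambda>v \<in> carrier (graded_sum A). v) = f"
      "compose (carrier (graded_sum A)) (\<lambda>v \<in> carrier (graded_sum A'). v) f = f"
      "compose (carrier (graded_sum A)) h (compose (carrier (graded_sum A)) g f)
        = compose (carrier (graded_sum A)) (compose (carrier (graded_sum A')) h g) f"
    if "f \<in> graded_intertwiners K M X A A'"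
    for A A' :: "('k, 'v, 'w) coset_graded" and f
      and g :: "('w set \<Rightarrow> 'v) \<Rightarrow> ('w set \<Rightarrow> 'v)" and h :: "('w set \<Rightarrow> 'v) \<Rightarrow> ('w set \<Rightarrow> 'v)"
    using intertwiner_laws[of f K M "total_rep X A" "total_rep X A'"] that
    by (auto simp: graded_intertwiners_def total_rep_def)
  show ?thesis
    by standard
      (auto simp: graded_rep_category_def graded_id graded_compose laws(1,2) intro: laws(3))
qed

lemma rep_space_F [simp]: "rep_space (on_obj F A) = grade A x\<^sub>0"
  by (simp add: base_functor_def)

lemma rep_act_F: "b \<in> carrier MJ \<Longrightarrow> rep_act (on_obj F A) b = base_action A b"
  using \<iota>_base_coset[of b] by (simp add: base_functor_def action_def)

lemma on_hom_F: "on_hom F A A' f = component A f x\<^sub>0"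
  by (simp add: base_functor_def component_def)

lemma representation_F:
  assumes A: "graded A"
  shows "is_representation K MJ (on_obj F A)"
proof (rule is_representationI)
  show "module K (rep_space (on_obj F A))"
    using graded_module[OF A] by simp
  show "rep_act (on_obj F A) b \<in> linear_maps K (rep_space (on_obj F A)) (rep_space (on_obj F A))"
    if "b \<in> carrier MJ" for b
    using action_linear[OF A, of "\<iota> b" x\<^sub>0] that by (simp add: rep_act_F \<iota>_base_coset)
qed (simp_all add: rep_act_F braid_part_one_closed braid_part_mult_closed action_mult action_one A
    \<iota>_base_coset)

lemma component_intertwiner:
  fixes A A' :: "('k, 'v, 'w) coset_graded"
  assumes A: "graded A" and A': "graded A'" and f: "f \<in> graded_intertwiners K M X A A'"
  shows "component A f x\<^sub>0 \<in> intertwiners K MJ (on_obj F A) (on_obj F A')"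
  using component_linear[OF A A' f, of x\<^sub>0] component_action[OF A A' f, of _ x\<^sub>0]
  by (auto simp: intertwiners_def rep_act_F \<iota>_base_coset dest: \<iota>_in_M)
    (metis MJ_subset \<iota>_base_coset \<iota>_in_M base_coset_in)

lemma component_compose:
  fixes A A' :: "('k, 'v, 'w) coset_graded"
  assumes A: "graded A" and A': "graded A'" and f: "f \<in> graded_intertwiners K M X A A'"
    and x: "x \<in> X"
  shows "component A (compose (carrier (graded_sum A)) g f) x
    = compose (carrier (grade A x)) (component A' g x) (component A f x)"
proof -
  interpret finite_direct_sum K X "grade A" by (rule graded_dsum[OF A])
  have "compose (carrier (graded_sum A)) g f (inc A x v) x = component A' g x (component A f x v)"
    if "v \<in> carrier (grade A x)" for v
  proof -
    have "compose (carrier (graded_sum A)) g f (inc A x v) = g (inc A' x (component A f x v))"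
      using inj_closed[OF x that] component_inc[OF A A' f x that] by (simp add: compose_def)
    then show ?thesis
      using component_closed[OF A A' f x that] by (simp add: component_def[of A' g])
  qed
  then show ?thesis
    unfolding component_def[of A "compose _ _ _"] compose_def[of "carrier (grade A x)"]
    by (intro restrict_ext) auto
qed

lemma category_functor_F: "category_functor graded_category base_category F"
proof (intro category_functor.intro category_functor_axioms.intro category_graded_category
    category_rep_category)
  fix A :: "('k, 'v, 'w) coset_graded"
  assume "A \<in> Obj graded_category"
  then have A: "graded A" by (simp add: graded_rep_category_def)
  then show "on_obj F A \<in> Obj base_category"
    using representation_F by (simp add: rep_category_def)
  interpret finite_direct_sum K X "grade A" by (rule graded_dsum[OF A])
  show "on_hom F A A (Ident graded_category A) = Ident base_category (on_obj F A)"
    using inj_closed[of x\<^sub>0]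
    by (auto simp: graded_rep_category_def rep_category_def on_hom_F component_def inj_apply
        simp del: base_coset_in intro!: restrict_ext)
next
  fix A A' :: "('k, 'v, 'w) coset_graded" and f
  assume "A \<in> Obj graded_category" "A' \<in> Obj graded_category" "f \<in> Hom graded_category A A'"
  then show "on_hom F A A' f \<in> Hom base_category (on_obj F A) (on_obj F A')"
    using component_intertwiner by (simp add: graded_rep_category_def rep_category_def on_hom_F)
next
  fix A A' A'' :: "('k, 'v, 'w) coset_graded" and f g
  assume "A \<in> Obj graded_category" "A' \<in> Obj graded_category" "A'' \<in> Obj graded_category"
    "f \<in> Hom graded_category A A'" "g \<in> Hom graded_category A' A''"
  then show "on_hom F A A'' (Comp graded_category A A' A'' g f)
    = Comp base_category (on_obj F A) (on_obj F A') (on_obj F A'') (on_hom F A' A'' g) (on_hom F A A' f)"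
    using component_compose[of A A' f x\<^sub>0 g] by (simp add: graded_rep_category_def rep_category_def on_hom_F)
qed


subsection \<open>Fully faithful\<close>

text \<open>Every element of the component \<open>x\<close> is of the form \<open>\<theta> A x u\<close>, and morphisms commute with \<open>\<theta>\<close>.\<close>

lemma F_faithful:
  fixes A A' :: "('k, 'v, 'w) coset_graded"
  assumes A: "graded A" and A': "graded A'"
    and f: "f \<in> graded_intertwiners K M X A A'" and g: "g \<in> graded_intertwiners K M X A A'"
    and eq: "component A f x\<^sub>0 = component A g x\<^sub>0"
  shows "f = g"
proof (rule linear_map_eqI[OF graded_intertwinerD(1)[OF f] graded_intertwinerD(1)[OF g]])
  interpret D: finite_direct_sum K X "grade A" by (rule graded_dsum[OF A])
  interpret D': finite_direct_sum K X "grade A'" by (rule graded_dsum[OF A'])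
  fix v
  assume v: "v \<in> carrier (graded_sum A)"
  show "f v = g v"
  proof (rule D'.total_eqI)
    show "f v \<in> carrier (graded_sum A')" "g v \<in> carrier (graded_sum A')"
      using linear_map_closed[OF graded_intertwinerD(1)[OF f] v]
        linear_map_closed[OF graded_intertwinerD(1)[OF g] v] .
    fix x
    assume x: "x \<in> X"
    have "v x \<in> \<theta> A x ` carrier (grade A x\<^sub>0)"
      using \<theta>_bij[OF A x] D.total_apply_closed[OF v x] by (simp add: bij_betw_def)
    then obtain u where u: "u \<in> carrier (grade A x\<^sub>0)" "v x = \<theta> A x u" by blast
    have "component A f x (v x) = component A g x (v x)"
      using component_\<theta>[OF A A' f x u(1)] component_\<theta>[OF A A' g x u(1)] u eq by simp
    then show "f v x = g v x"
      using component_apply[OF A A' f v x] component_apply[OF A A' g v x] by simp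
  qed
qed

text \<open>A morphism \<open>h\<close> at the base coset extends to the component \<open>x\<close> by conjugation with \<open>\<theta>\<close>. The result
  commutes with \<open>b\<close>, because \<open>\<theta>\<close> turns \<open>b\<close> into an element of \<open>MJ\<close> that depends on \<open>b\<close> and \<open>x\<close> only,
  not on the representation.\<close>

lemma F_full:
  fixes A A' :: "('k, 'v, 'w) coset_graded"
  assumes A: "graded A" and A': "graded A'"
    and h: "h \<in> intertwiners K MJ (on_obj F A) (on_obj F A')"
  shows "\<exists>f \<in> graded_intertwiners K M X A A'. component A f x\<^sub>0 = h"
proof -
  have h_linear: "h \<in> linear_maps K (grade A x\<^sub>0) (grade A' x\<^sub>0)"
    using intertwiner_linear[OF h] by simp
  have h_commute: "h (base_action A c v) = base_action A' c (h v)"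
    if "c \<in> carrier MJ" "v \<in> carrier (grade A x\<^sub>0)" for c v
    using intertwiner_commute[OF h that(1)] that by (simp add: rep_act_F)
  define \<theta>' where "\<theta>' = (\<lambda>x. \<lambda>v \<in> carrier (grade A x). inv_into (carrier (grade A x\<^sub>0)) (\<theta> A x) v)"
  define \<phi> where "\<phi> = (\<lambda>x. compose (carrier (grade A x)) (\<theta> A' x) (compose (carrier (grade A x)) h (\<theta>' x)))"
  have inv: "\<theta>' x \<in> linear_maps K (grade A x) (grade A x\<^sub>0)"
      "u \<in> carrier (grade A x\<^sub>0) \<Longrightarrow> \<theta>' x (\<theta> A x u) = u"
      "v \<in> carrier (grade A x) \<Longrightarrow> \<theta> A x (\<theta>' x v) = v" if "x \<in> X" for x u v
    using linear_map_inverse[OF \<theta>_linear[OF A that] \<theta>_bij[OF A that] graded_module[OF A] graded_module[OF A]]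
      that by (simp_all add: \<theta>'_def)
  have \<phi>_linear: "\<phi> x \<in> linear_maps K (grade A x) (grade A' x)" if "x \<in> X" for x
    unfolding \<phi>_def using that inv(1)[OF that] h_linear \<theta>_linear[OF A' that] graded_module[OF A that]
    by (intro linear_map_compose)
  have \<phi>_\<theta>: "\<phi> x (\<theta> A x u) = \<theta> A' x (h u)" if "x \<in> X" "u \<in> carrier (grade A x\<^sub>0)" for x u
    using that A by (simp add: \<phi>_def compose_def inv)
  have "\<phi> (bar b <# x) (action A b x v) = action A' b x (\<phi> x v)"
    if b: "b \<in> carrier M" and x: "x \<in> X" and v: "v \<in> carrier (grade A x)" for b x v
  proof -
    define u where "u = \<theta>' x v"
    have u: "u \<in> carrier (grade A x\<^sub>0)" "v = \<theta> A x u"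
      using linear_map_closed[OF inv(1)[OF x] v] inv(3)[OF x v] by (simp_all add: u_def)
    let ?c = "cocycle b x"
    have c: "?c \<in> carrier MJ" "bar b <# x \<in> X" using b x by simp_all
    have hu: "h u \<in> carrier (grade A' x\<^sub>0)"
      using linear_map_closed[OF h_linear u(1)] .
    have "\<phi> (bar b <# x) (action A b x v) = \<phi> (bar b <# x) (\<theta> A (bar b <# x) (base_action A ?c u))"
      using \<theta>_commute[OF A b x u(1)] u(2) by simp
    also have "\<dots> = \<theta> A' (bar b <# x) (h (base_action A ?c u))"
      using c u base_action_closed[OF A c(1)] by (intro \<phi>_\<theta>) auto
    also have "\<dots> = \<theta> A' (bar b <# x) (base_action A' ?c (h u))"
      using h_commute[OF c(1) u(1)] by simp
    also have "\<dots> = action A' b x (\<theta> A' x (h u))"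
      using \<theta>_commute[OF A' b x hu] by simp
    also have "\<dots> = action A' b x (\<phi> x v)"
      using \<phi>_\<theta>[OF x u(1)] u(2) by simp
    finally show ?thesis .
  qed
  note family = graded_intertwiner_of_family[OF A A' \<phi>_linear this]
  have "\<phi> x\<^sub>0 = h"
  proof (rule linear_map_eqI[OF \<phi>_linear h_linear])
    fix u
    assume u: "u \<in> carrier (grade A x\<^sub>0)"
    then show "\<phi> x\<^sub>0 u = h u"
      using \<phi>_\<theta>[of x\<^sub>0 u] \<theta>_base[OF A u] \<theta>_base[OF A' linear_map_closed[OF h_linear u]] by simp
  qed simp
  then show ?thesis
    using family by (intro bexI[OF _ family(1)]) auto
qed


subsection \<open>The induced graded representation\<close>

text \<open>All components are copies of \<open>U\<close>. The formula is written at the target coset \<open>x\<close>; read at the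
  source, \<open>b\<close> acts from \<open>x\<close> to \<open>bar b <# x\<close> as \<open>cocycle b x\<close>, see \<open>induced_apply\<close>.\<close>

definition induced ::
  "('k, 'v, 'w group_word set) representation \<Rightarrow> ('k, 'v, 'w) coset_graded"
  where "induced U = \<lparr>grade = (\<lambda>x. rep_space U),
    total_act = (\<lambda>b. \<lambda>v \<in> carrier (direct_sum X (\<lambda>x. rep_space U)). \<lambda>x \<in> X.
      rep_act U (cocycle b (inv (bar b) <# x)) (v (inv (bar b) <# x)))\<rparr>"

lemma grade_induced [simp]: "grade (induced U) = (\<lambda>x. rep_space U)"
  by (simp add: induced_def)

context
  fixes U :: "('k, 'v, 'w group_word set) representation"
  assumes U: "is_representation K MJ U"
begin

interpretation D: finite_direct_sum K X "\<lambda>x. rep_space U"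
  using rep_module[OF U] by (simp add: finite_direct_sum_def cring_K finite_cosets)

lemma induced_apply:
  assumes "b \<in> carrier M" "v \<in> carrier D.dsum" "x \<in> X"
  shows "total_act (induced U) b v (bar b <# x) = rep_act U (cocycle b x) (v x)"
  using assms by (simp add: induced_def coset_act_inv)

lemma induced_closed:
  assumes "b \<in> carrier M" "v \<in> carrier D.dsum"
  shows "total_act (induced U) b v \<in> carrier D.dsum"
proof -
  have "rep_act U (cocycle b (inv (bar b) <# x)) (v (inv (bar b) <# x)) \<in> carrier (rep_space U)"
    if "x \<in> X" for x
    using assms that D.total_apply_closed[OF assms(2)] by (intro rep_act_closed[OF U]) auto
  then show ?thesis
    using assms by (auto simp: induced_def D.carrier_total)
qed

lemma coset_surj:
  assumes "b \<in> carrier M" "y \<in> X"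
  obtains x where "x \<in> X" "y = bar b <# x"
  using that[of "inv (bar b) <# y"] assms by (simp add: coset_act_inv)

lemma induced_eqI:
  assumes "b \<in> carrier M" "u \<in> carrier D.dsum" "v \<in> carrier D.dsum"
    and "\<And>x. x \<in> X \<Longrightarrow> u (bar b <# x) = v (bar b <# x)"
  shows "u = v"
  using assms by (intro D.total_eqI) (auto elim: coset_surj)

lemma induced_mult:
  assumes "a \<in> carrier M" "b \<in> carrier M" "v \<in> carrier D.dsum"
  shows "total_act (induced U) (a \<otimes>\<^bsub>B\<^esub> b) v = total_act (induced U) a (total_act (induced U) b v)"
proof (rule induced_eqI)
  show ab: "a \<otimes>\<^bsub>B\<^esub> b \<in> carrier M"
    using assms by (simp add: braid_part_mult_closed)
  show "total_act (induced U) (a \<otimes>\<^bsub>B\<^esub> b) v \<in> carrier D.dsum"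
    "total_act (induced U) a (total_act (induced U) b v) \<in> carrier D.dsum"
    using assms ab by (simp_all add: induced_closed)
  fix x
  assume x: "x \<in> X"
  have "total_act (induced U) (a \<otimes>\<^bsub>B\<^esub> b) v (bar (a \<otimes>\<^bsub>B\<^esub> b) <# x)
      = rep_act U (cocycle a (bar b <# x) \<otimes>\<^bsub>BJ\<^esub> cocycle b x) (v x)"
    using assms ab x by (simp only: induced_apply cocycle_mult M_subset)
  also have "\<dots> = rep_act U (cocycle a (bar b <# x)) (rep_act U (cocycle b x) (v x))"
    using rep_mult[OF U, of "cocycle a (bar b <# x)" "cocycle b x" "v x"] assms x
      D.total_apply_closed[of v x] by simp
  also have "\<dots> = total_act (induced U) a (total_act (induced U) b v) (bar a <# (bar b <# x))"
    using assms x induced_apply[of a "total_act (induced U) b v" "bar b <# x"]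
    by (simp add: induced_closed induced_apply)
  also have "bar a <# (bar b <# x) = bar (a \<otimes>\<^bsub>B\<^esub> b) <# x"
    using assms x by (simp add: coset_act_mult)
  finally show "total_act (induced U) (a \<otimes>\<^bsub>B\<^esub> b) v (bar (a \<otimes>\<^bsub>B\<^esub> b) <# x)
    = total_act (induced U) a (total_act (induced U) b v) (bar (a \<otimes>\<^bsub>B\<^esub> b) <# x)" .
qed

lemma induced_linear:
  assumes b: "b \<in> carrier M"
  shows "total_act (induced U) b \<in> linear_maps K D.dsum D.dsum"
proof (rule linear_mapsI)
  note lin = linear_map_add[OF rep_linear[OF U]] linear_map_smult[OF rep_linear[OF U]]
  show "total_act (induced U) b \<in> carrier D.dsum \<rightarrow>\<^sub>E carrier D.dsum"
    using induced_closed[OF b] by (auto simp: induced_def)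
  show "total_act (induced U) b (u \<oplus>\<^bsub>D.dsum\<^esub> v)
      = total_act (induced U) b u \<oplus>\<^bsub>D.dsum\<^esub> total_act (induced U) b v"
    if "u \<in> carrier D.dsum" "v \<in> carrier D.dsum" for u v
    using that b D.total_apply_closed
    by (intro induced_eqI[OF b])
      (simp_all add: induced_closed induced_apply D.total_closed D.add_apply lin)
  show "total_act (induced U) b (a \<odot>\<^bsub>D.dsum\<^esub> v) = a \<odot>\<^bsub>D.dsum\<^esub> total_act (induced U) b v"
    if "a \<in> carrier K" "v \<in> carrier D.dsum" for a v
    using that b D.total_apply_closed
    by (intro induced_eqI[OF b])
      (simp_all add: induced_closed induced_apply D.total_closed D.smult_apply lin)
qed

lemma induced_one:
  assumes v: "v \<in> carrier D.dsum"
  shows "total_act (induced U) \<one>\<^bsub>B\<^esub> v = v"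
proof (rule induced_eqI)
  show one: "\<one>\<^bsub>B\<^esub> \<in> carrier M" by (rule braid_part_one_closed)
  show "total_act (induced U) \<one>\<^bsub>B\<^esub> v \<in> carrier D.dsum" using v one by (rule induced_closed[rotated])
  show "total_act (induced U) \<one>\<^bsub>B\<^esub> v (bar \<one>\<^bsub>B\<^esub> <# x) = v (bar \<one>\<^bsub>B\<^esub> <# x)" if "x \<in> X" for x
    using induced_apply[OF one v that] rep_one[OF U] D.total_apply_closed[OF v that] that by simp
qed (rule v)

lemma induced_inclusion:
  assumes b: "b \<in> carrier M" and x: "x \<in> X" and v: "v \<in> carrier (rep_space U)"
  shows "total_act (induced U) b (D.inclusion x v) = D.inclusion (bar b <# x) (rep_act U (cocycle b x) v)"
proof (rule induced_eqI[OF b])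
  have closed: "rep_act U (cocycle b x) v \<in> carrier (rep_space U)"
    using assms by (intro rep_act_closed[OF U]) auto
  show "total_act (induced U) b (D.inclusion x v) \<in> carrier D.dsum"
    "D.inclusion (bar b <# x) (rep_act U (cocycle b x) v) \<in> carrier D.dsum"
    using assms closed by (simp_all add: induced_closed D.inj_closed)
  fix y
  assume y: "y \<in> X"
  have "rep_act U (cocycle b y) \<zero>\<^bsub>rep_space U\<^esub> = \<zero>\<^bsub>rep_space U\<^esub>"
    using linear_map_zero[OF rep_module[OF U] rep_module[OF U] rep_linear[OF U]] b y by simp
  then show "total_act (induced U) b (D.inclusion x v) (bar b <# y)
      = D.inclusion (bar b <# x) (rep_act U (cocycle b x) v) (bar b <# y)"
    using assms y by (simp add: induced_apply D.inj_closed D.inj_apply coset_act_inj)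
qed

lemma graded_induced: "graded (induced U)"
  unfolding is_graded_representation_def
proof (intro conjI ballI impI)
  show "module K (grade (induced U) x)" for x
    using rep_module[OF U] by simp
  show "is_representation K M (total_rep X (induced U))"
    by (rule is_representationI)
      (simp_all add: total_rep_def D.module_total induced_linear induced_mult induced_one
        braid_part_one_closed braid_part_mult_closed)
  show "total_act (induced U) b ` summand X (grade (induced U)) x
      \<subseteq> summand X (grade (induced U)) (bar b <# x)"
    if "b \<in> carrier M" "x \<in> X" for b x
    using that induced_inclusion[OF that] rep_act_closed[OF U, of "cocycle b x"]
    by (auto simp: summand_def)
  show "total_act (induced U) (\<sigma> s) (total_act (induced U) (\<sigma> s) v) = v"
    if s: "s \<in> S" and x: "x \<in> X" and "s <# x \<noteq> x" and v: "v \<in> summand X (grade (induced U)) x" for s x v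
  proof -
    obtain u where u: "u \<in> carrier (rep_space U)" "v = D.inclusion x u"
      using v by (auto simp: summand_def)
    have moved: "s <# (s <# x) \<noteq> s <# x"
      using that by (simp add: generator_coset_square)
    then have "inv (rep x) \<otimes> s \<otimes> rep x \<notin> WJ" "inv (rep (s <# x)) \<otimes> s \<otimes> rep (s <# x) \<notin> WJ"
      using that generator_moves_coset[of s x] generator_moves_coset[of s "s <# x"] by auto
    then have "cocycle (\<sigma> s) x = \<one>\<^bsub>BJ\<^esub>" "cocycle (\<sigma> s) (s <# x) = \<one>\<^bsub>BJ\<^esub>"
      using s x by (simp_all add: cocycle_\<sigma> step_def)
    then show ?thesis
      using s x u rep_one[OF U] by (simp add: induced_inclusion generator_coset_square)
  qed
qed

lemma F_induced_isomorphic: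
  "isomorphism_in base_category (on_obj F (induced U)) U (\<lambda>v \<in> carrier (rep_space U). v)"
proof -
  have act: "rep_act (on_obj F (induced U)) b v = rep_act U b v"
    if b: "b \<in> carrier MJ" and v: "v \<in> carrier (rep_space U)" for b v
  proof -
    have "total_act (induced U) (\<iota> b) (D.inclusion x\<^sub>0 v) = D.inclusion x\<^sub>0 (rep_act U b v)"
      using induced_inclusion[of "\<iota> b" x\<^sub>0 v] b v by (simp add: \<iota>_base_coset cocycle_\<iota>)
    then show ?thesis
      using b v by (simp add: rep_act_F action_def \<iota>_base_coset D.inj_apply)
  qed
  have U': "is_representation K MJ (on_obj F (induced U))"
    by (rule representation_F[OF graded_induced])
  have "(\<lambda>v \<in> carrier (rep_space U). v) \<in> intertwiners K MJ U U"
    by (rule intertwiner_id[OF U])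
  then have "(\<lambda>v \<in> carrier (rep_space U). v) \<in> intertwiners K MJ (on_obj F (induced U)) U"
    "(\<lambda>v \<in> carrier (rep_space U). v) \<in> intertwiners K MJ U (on_obj F (induced U))"
    using rep_act_closed[OF U] by (simp_all add: intertwiners_def act)
  then show ?thesis
    by (rule rep_category_isomorphismI[OF U' U]) auto
qed

end

lemma equivalence_F:
  "equivalence_of_categories
    (graded_category :: (('k, 'v, 'w) coset_graded, _) category)
    base_category F"
proof (rule equivalence_of_categories_fully_faithful[OF category_functor_F])
  fix A A' :: "('k, 'v, 'w) coset_graded" and f g
  assume "A \<in> Obj graded_category" "A' \<in> Obj graded_category"
    "f \<in> Hom graded_category A A'" "g \<in> Hom graded_category A A'" "on_hom F A A' f = on_hom F A A' g"
  then show "f = g"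
    by (intro F_faithful[of A A' f g]) (simp_all add: graded_rep_category_def on_hom_F)
next
  fix A A' :: "('k, 'v, 'w) coset_graded" and h
  assume "A \<in> Obj graded_category" "A' \<in> Obj graded_category"
    "h \<in> Hom base_category (on_obj F A) (on_obj F A')"
  then show "\<exists>f \<in> Hom graded_category A A'. on_hom F A A' f = h"
    using F_full[of A A' h] by (simp add: graded_rep_category_def rep_category_def on_hom_F)
next
  fix U :: "('k, 'v, 'w group_word set) representation"
  assume "U \<in> Obj base_category"
  then have U: "is_representation K MJ U" by (simp add: rep_category_def)
  show "\<exists>A \<in> Obj graded_category. \<exists>e. isomorphism_in base_category (on_obj F A) U e"
    using graded_induced[OF U] F_induced_isomorphic[OF U]
    by (intro bexI[of _ "induced U"]) (auto simp: graded_rep_category_def)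
qed

end

theorem theorem10p1p1:
  fixes K :: "'k ring" and W :: "'w monoid" and S J :: "'w set"
  assumes "field K"
    and "coxeter_system W S"
    and "finite (carrier W)"
    and "J \<subseteq> S"
  shows "equivalence_of_categories
      (graded_rep_category K W S J (braid_group W S)
        :: (('k, 'v, 'w group_word set, 'w set) graded_representation, _) category)
      (rep_category K (braid_group (parabolic W J) J))
      (base_functor W S J)
    \<and> equivalence_of_categories
      (graded_rep_category K W S J (braid_monoid W S)
        :: (('k, 'v, 'w group_word set, 'w set) graded_representation, _) category)
      (rep_category K (braid_monoid (parabolic W J) J))
      (base_functor W S J)"
proof -
  have axioms: "graded_setup W S J K"
    using assms
    by (simp add: graded_setup_def graded_setup_axioms_def parabolic_coxeter_def
        parabolic_coxeter_axioms_def finite_coxeter_def)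
  show ?thesis
    using graded_setup.equivalence_F[OF axioms, of False] graded_setup.equivalence_F[OF axioms, of True]
    by (simp add: braid_part_def)
qed

end
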